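(* Let $N\in\mathbb{N}$, $N\ge 2$, $T>0$, $\nu\ge 0$, and let $(v,p)$ be a weak solution of the system $(NS)_\nu$ on $\mathbb{R}^N\times(0,T)$ (in the sense defined in the context). (i) (Liouville type property) Suppose that either $p\in L^1_+(0,T;L^1(\mathbb{R}^N))$, or $p\in L^1(0,T;\mathcal{H}^q(\mathbb{R}^N))$ for some $q\in(0,1]$. Then $v(x,t)=0$ for almost every $(x,t)\in\mathbb{R}^N\times(0,T)$. (ii) (Equipartition of energy) Suppose that $p\in L^1_-(0,T;L^1(\mathbb{R}^N))$. Then for almost every $t\in(0,T)$, $$\mathcal{E}_1(t)=\cdots=\mathcal{E}_N(t)=-\frac12\int_{\mathbb{R}^N}p(x,t)\,dx,$$ and $$\int_{\mathbb{R}^N}v^j(x,t)\,v^k(x,t)\,dx=0\qquad\text{for all } j,k\in\{1,\dots,N\}\text{ with } j\ne k.$$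
   Context: The system $(NS)_\nu$ (Navier-Stokes equations for $\nu>0$, Euler equations for $\nu=0$) on $\mathbb{R}^N$ is $$\partial_t v+(v\cdot\nabla)v=-\nabla p+\nu\Delta v,\qquad \operatorname{div}v=0,$$ with velocity $v=(v^1,\dots,v^N)$, scalar pressure $p$ and viscosity $\nu\ge0$. Notation. For $a,b\in\mathbb{R}^N$, $a\otimes b$ is the $N\times N$ matrix with entries $(a\otimes b)_{ij}=a_ib_j$; for $N\times N$ matrices, $A:B=\sum_{i,j=1}^N A_{ij}B_{ij}$; $(\nabla\phi)_{ij}=\partial_i\phi_j$. $L^2_\sigma(\mathbb{R}^N)=\{v\in[L^2(\mathbb{R}^N)]^N:\operatorname{div}v=0\}$, with the divergence taken in the sense of distributions. $\mathcal{S}$ is the Schwartz class on $\mathbb{R}^N$, $\mathcal{S}'$ its dual, and $\langle\cdot,\cdot\rangle$ the dual pairing between them (so $\langle f,\psi\rangle=\int f\psi\,dx$ if $f\in L^1(\mathbb{R}^N)$). $C^1_0(0,T)$ and $C_0^\infty(\mathbb{R}^N)$ denote $C^1$, respectively $C^\infty$, functions with compact support in $(0,T)$, respectively $\mathbb{R}^N$. Hardy space. Fix $\varphi\in\mathcal{S}$ with $\int_{\mathbb{R}^N}\varphi\,dx\ne0$ and set $\varphi_t(x)=t^{-N}\varphi(t^{-1}x)$ for $t>0$. For $0<q\le1$, $$\mathcal{H}^q(\mathbb{R}^N)=\Big\{f\in\mathcal{S}' : \mathcal{M}_\varphi f(x):=\sup_{t>0}|f*\varphi_t(x)|\in L^q(\mathbb{R}^N)\Big\},\qquad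 \|f\|_{\mathcal{H}^q}=\|\mathcal{M}_\varphi f\|_{L^q};$$ the space does not depend on the choice of $\varphi$. The condition $p\in L^1(0,T;\mathcal{H}^q(\mathbb{R}^N))$ includes $\int_0^T\|p(t)\|_{\mathcal{H}^q}\,dt<\infty$. Function classes. $$L^1_{+}(0,T;L^1(\mathbb{R}^N))=\Big\{f\in L^1(0,T;L^1(\mathbb{R}^N)):\int_{\mathbb{R}^N}f(x,t)\,dx\ge0\text{ for a.e. }t\in(0,T)\Big\},$$ and $L^1_{-}(0,T;L^1(\mathbb{R}^N))$ is defined in the same way with $\le0$ in place of $\ge0$. Energies. $\mathcal{E}_j(t)=\frac12\int_{\mathbb{R}^N}(v^j(x,t))^2\,dx$ for $j=1,\dots,N$. Weak solution. A pair $(v,p)\in L^1(0,T;L^2_\sigma(\mathbb{R}^N))\times L^1(0,T;\mathcal{S}'(\mathbb{R}^N))$ is a weak solution of $(NS)_\nu$ on $\mathbb{R}^N\times(0,T)$ if, for all $\xi\in C^1_0(0,T)$ and all $\phi\in[C_0^\infty(\mathbb{R}^N)]^N$, $$-\int_0^T\!\!\int_{\mathbb{R}^N}v(x,t)\cdot\phi(x)\,\xi'(t)\,dx\,dt-\int_0^T\!\!\int_{\mathbb{R}^N}v(x,t)\otimes v(x,t):\nabla\phi(x)\,\xi(t)\,dx\,dt$$ $$=\int_0^T\langle p(t),\operatorname{div}\phi\rangle\,\xi(t)\,dt+\nu\int_0^T\!\!\int_{\mathbb{R}^N}v(x,t)\cdot\Delta\phi(x)\,\xi(t)\,dx\,dt,$$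 where it is part of the definition that all these integrals are well defined (absolutely convergent). No initial condition is imposed. *)

theory Defs
  imports "HOL-Analysis.Analysis"
begin

text \<open>
  Space is \<^typ>\<open>real^'n\<close>, all functions and distributions are real-valued, and "measurable",
  "integrable" and "almost everywhere" refer to Lebesgue (completed) measure. Functions on
  space-time are written with the time argument first, so \<open>v t x\<close> stands for $v(x,t)$.
\<close>

section \<open>Differential operators\<close>

definition partial_deriv :: "'n \<Rightarrow> (real^'n \<Rightarrow> real) \<Rightarrow> real^'n \<Rightarrow> real" where
  "partial_deriv i f x = frechet_derivative f (at x) (axis i 1)"

definition iter_partial :: "'n list \<Rightarrow> (real^'n \<Rightarrow> real) \<Rightarrow> real^'n \<Rightarrow> real" where
  "iter_partial is f = foldr partial_deriv is f"

text \<open>Differentiability of every iterated partial derivative is the same as existence and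
  continuity of all of them, and ensures that \<^const>\<open>partial_deriv\<close> is meaningful at each stage.\<close>

definition smooth :: "(real^'n \<Rightarrow> real) \<Rightarrow> bool" where
  "smooth f \<longleftrightarrow> (\<forall>is x. iter_partial is f differentiable (at x))"

definition gradient :: "(real^'n \<Rightarrow> real) \<Rightarrow> real^'n \<Rightarrow> real^'n" where
  "gradient f x = (\<chi> i. partial_deriv i f x)"

definition divergence :: "(real^'n \<Rightarrow> real^'n) \<Rightarrow> real^'n \<Rightarrow> real" where
  "divergence \<phi> x = (\<Sum>i\<in>UNIV. partial_deriv i (\<lambda>y. \<phi> y $ i) x)"

definition vec_laplacian :: "(real^'n \<Rightarrow> real^'n) \<Rightarrow> real^'n \<Rightarrow> real^'n" where
  "vec_laplacian \<phi> x = (\<chi> j. \<Sum>i\<in>UNIV. partial_deriv i (partial_deriv i (\<lambda>y. \<phi> y $ j)) x)"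

text \<open>Row \<open>i\<close>, column \<open>j\<close> holds $\partial_i\phi_j$, the transpose of the usual Jacobian matrix.\<close>

definition gradient_matrix :: "(real^'n \<Rightarrow> real^'n) \<Rightarrow> real^'n \<Rightarrow> real^'n^'n" where
  "gradient_matrix \<phi> x = (\<chi> i j. partial_deriv i (\<lambda>y. \<phi> y $ j) x)"

definition tensor :: "real^'n \<Rightarrow> real^'n \<Rightarrow> real^'n^'n" where
  "tensor a b = (\<chi> i j. a $ i * b $ j)"

definition contract :: "real^'n^'n \<Rightarrow> real^'n^'n \<Rightarrow> real" where
  "contract A B = (\<Sum>i\<in>UNIV. \<Sum>j\<in>UNIV. A $ i $ j * B $ i $ j)"


section \<open>Test functions\<close>

definition supp :: "('a::topological_space \<Rightarrow> real) \<Rightarrow> 'a set" where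
  "supp f = closure {x. f x \<noteq> 0}"

definition test_functions :: "(real^'n \<Rightarrow> real) set" where
  "test_functions = {f. smooth f \<and> compact (supp f)}"

definition vec_test_functions :: "(real^'n \<Rightarrow> real^'n) set" where
  "vec_test_functions = {\<phi>. \<forall>i. (\<lambda>x. \<phi> x $ i) \<in> test_functions}"

text \<open>$C^1_0(0,T)$, its elements being extended by zero to the whole line.\<close>

definition C1_compact :: "real \<Rightarrow> (real \<Rightarrow> real) set" where
  "C1_compact T = {\<xi>. \<xi> C1_differentiable_on UNIV \<and> compact (supp \<xi>) \<and> supp \<xi> \<subseteq> {0<..<T}}"


section \<open>Schwartz functions and tempered distributions\<close>

definition schwartz :: "(real^'n \<Rightarrow> real) set" where
  "schwartz = {f. smooth f \<and>
     (\<forall>m is. bounded (range (\<lambda>x. (1 + norm x) ^ m * iter_partial is f x)))}"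

definition schwartz_seminorm :: "nat \<Rightarrow> 'n list \<Rightarrow> (real^'n \<Rightarrow> real) \<Rightarrow> real" where
  "schwartz_seminorm m is f = (SUP x. (1 + norm x) ^ m * \<bar>iter_partial is f x\<bar>)"

definition schwartz_topology :: "(real^'n \<Rightarrow> real) topology" where
  "schwartz_topology = topology_generated_by
     {{\<eta> \<in> schwartz. schwartz_seminorm m is (\<lambda>x. \<eta> x - \<psi> x) < e} | m is \<psi> e.
        \<psi> \<in> schwartz \<and> e > 0}"

text \<open>An element of $\mathcal S'$ is represented by a function on all of
  \<^typ>\<open>real^'n \<Rightarrow> real\<close>, of which only the values on \<^const>\<open>schwartz\<close> matter.\<close>

definition tempered :: "((real^'n \<Rightarrow> real) \<Rightarrow> real) set" where
  "tempered = {u.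
     (\<forall>\<psi>\<in>schwartz. \<forall>\<eta>\<in>schwartz. u (\<lambda>x. \<psi> x + \<eta> x) = u \<psi> + u \<eta>) \<and>
     (\<forall>c. \<forall>\<psi>\<in>schwartz. u (\<lambda>x. c * \<psi> x) = c * u \<psi>) \<and>
     continuous_map schwartz_topology euclideanreal u}"

definition convolve :: "((real^'n \<Rightarrow> real) \<Rightarrow> real) \<Rightarrow> (real^'n \<Rightarrow> real) \<Rightarrow> real^'n \<Rightarrow> real" where
  "convolve u \<psi> x = u (\<lambda>y. \<psi> (x - y))"


section \<open>Hardy spaces\<close>

definition dilate :: "(real^'n \<Rightarrow> real) \<Rightarrow> real \<Rightarrow> real^'n \<Rightarrow> real" where
  "dilate \<phi> s x = \<phi> (x /\<^sub>R s) / s ^ CARD('n)"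

definition maximal_fun ::
    "(real^'n \<Rightarrow> real) \<Rightarrow> ((real^'n \<Rightarrow> real) \<Rightarrow> real) \<Rightarrow> real^'n \<Rightarrow> ennreal" where
  "maximal_fun \<phi> u x = (SUP s\<in>{0<..}. ennreal \<bar>convolve u (dilate \<phi> s) x\<bar>)"

text \<open>Powers $a^r$ with $r > 0$ on $[0,\infty]$.\<close>

definition ennreal_powr :: "ennreal \<Rightarrow> real \<Rightarrow> ennreal" where
  "ennreal_powr a r = (if a = top then top else ennreal (enn2real a powr r))"

definition hardy_norm ::
    "(real^'n \<Rightarrow> real) \<Rightarrow> real \<Rightarrow> ((real^'n \<Rightarrow> real) \<Rightarrow> real) \<Rightarrow> ennreal" where
  "hardy_norm \<phi> q u =
     ennreal_powr (\<integral>\<^sup>+ x. ennreal_powr (maximal_fun \<phi> u x) q \<partial>lebesgue) (1 / q)"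

definition hardy ::
    "(real^'n \<Rightarrow> real) \<Rightarrow> real \<Rightarrow> ((real^'n \<Rightarrow> real) \<Rightarrow> real) set" where
  "hardy \<phi> q = {u \<in> tempered.
     maximal_fun \<phi> u \<in> borel_measurable lebesgue \<and> hardy_norm \<phi> q u < top}"


section \<open>Spaces of time-dependent functions and distributions\<close>

abbreviation time :: "real \<Rightarrow> real measure" where
  "time T \<equiv> lebesgue_on {0<..<T}"

abbreviation spacetime :: "real \<Rightarrow> (real \<times> (real^'n)) measure" where
  "spacetime T \<equiv> lebesgue_on ({0<..<T} \<times> UNIV)"

definition L2_norm :: "(real^'n \<Rightarrow> real^'n) \<Rightarrow> real" where
  "L2_norm w = sqrt (LINT x|lebesgue. (norm (w x))\<^sup>2)"

definition L2_sigma :: "(real^'n \<Rightarrow> real^'n) set" where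
  "L2_sigma = {w. w \<in> borel_measurable lebesgue \<and> integrable lebesgue (\<lambda>x. (norm (w x))\<^sup>2) \<and>
     (\<forall>\<phi>\<in>test_functions. (LINT x|lebesgue. w x \<bullet> gradient \<phi> x) = 0)}"

text \<open>Elements of $L^1(0,T;L^2)$ and $L^1(0,T;L^1)$ are given by their jointly measurable
  representatives; for these separable spaces this is Bochner measurability.\<close>

definition L1_L2_sigma :: "real \<Rightarrow> (real \<Rightarrow> real^'n \<Rightarrow> real^'n) set" where
  "L1_L2_sigma T = {v.
     (\<lambda>(t, x). v t x) \<in> borel_measurable (spacetime T) \<and>
     (AE t in time T. v t \<in> L2_sigma) \<and>
     integrable (time T) (\<lambda>t. L2_norm (v t))}"

definition L1_L1 :: "real \<Rightarrow> (real \<Rightarrow> real^'n \<Rightarrow> real) set" where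
  "L1_L1 T = {f. integrable (spacetime T) (\<lambda>(t, x). f t x)}"

definition L1_L1_plus :: "real \<Rightarrow> (real \<Rightarrow> real^'n \<Rightarrow> real) set" where
  "L1_L1_plus T = {f \<in> L1_L1 T. AE t in time T. (LINT x|lebesgue. f t x) \<ge> 0}"

definition L1_L1_minus :: "real \<Rightarrow> (real \<Rightarrow> real^'n \<Rightarrow> real) set" where
  "L1_L1_minus T = {f \<in> L1_L1 T. AE t in time T. (LINT x|lebesgue. f t x) \<le> 0}"

text \<open>$\mathcal S'$ is not normed; $L^1(0,T;\mathcal S')$ is understood in the weak sense, i.e.
  every pairing with a Schwartz function is integrable in time.\<close>

definition L1_tempered :: "real \<Rightarrow> (real \<Rightarrow> (real^'n \<Rightarrow> real) \<Rightarrow> real) set" where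
  "L1_tempered T = {p. (AE t in time T. p t \<in> tempered) \<and>
     (\<forall>\<psi>\<in>schwartz. integrable (time T) (\<lambda>t. p t \<psi>))}"

definition L1_hardy ::
    "(real^'n \<Rightarrow> real) \<Rightarrow> real \<Rightarrow> real \<Rightarrow> (real \<Rightarrow> (real^'n \<Rightarrow> real) \<Rightarrow> real) set" where
  "L1_hardy \<phi> q T = {p \<in> L1_tempered T. (AE t in time T. p t \<in> hardy \<phi> q) \<and>
     (\<lambda>t. hardy_norm \<phi> q (p t)) \<in> borel_measurable (time T) \<and>
     (\<integral>\<^sup>+ t. hardy_norm \<phi> q (p t) \<partial>time T) < top}"

text \<open>The distribution-valued function \<open>p\<close> is given by the function \<open>f\<close>.\<close>

definition has_density ::
    "real \<Rightarrow> (real \<Rightarrow> (real^'n \<Rightarrow> real) \<Rightarrow> real) \<Rightarrow> (real \<Rightarrow> real^'n \<Rightarrow> real) \<Rightarrow> bool" where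
  "has_density T p f \<longleftrightarrow>
     (AE t in time T. \<forall>\<psi>\<in>schwartz. p t \<psi> = (LINT x|lebesgue. f t x * \<psi> x))"


section \<open>Weak solutions and energies\<close>

definition weak_solution ::
    "real \<Rightarrow> real \<Rightarrow> (real \<Rightarrow> real^'n \<Rightarrow> real^'n) \<Rightarrow> (real \<Rightarrow> (real^'n \<Rightarrow> real) \<Rightarrow> real) \<Rightarrow> bool"
  where
  "weak_solution \<nu> T v p \<longleftrightarrow> v \<in> L1_L2_sigma T \<and> p \<in> L1_tempered T \<and>
     (\<forall>\<xi>\<in>C1_compact T. \<forall>\<phi>\<in>vec_test_functions.
        integrable (spacetime T) (\<lambda>(t, x). (v t x \<bullet> \<phi> x) * deriv \<xi> t) \<and>
        integrable (spacetime T)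
          (\<lambda>(t, x). contract (tensor (v t x) (v t x)) (gradient_matrix \<phi> x) * \<xi> t) \<and>
        integrable (time T) (\<lambda>t. p t (divergence \<phi>) * \<xi> t) \<and>
        integrable (spacetime T) (\<lambda>(t, x). (v t x \<bullet> vec_laplacian \<phi> x) * \<xi> t) \<and>
        - (LINT t|time T. LINT x|lebesgue. (v t x \<bullet> \<phi> x) * deriv \<xi> t)
        - (LINT t|time T. LINT x|lebesgue.
             contract (tensor (v t x) (v t x)) (gradient_matrix \<phi> x) * \<xi> t)
        = (LINT t|time T. p t (divergence \<phi>) * \<xi> t)
          + \<nu> * (LINT t|time T. LINT x|lebesgue. (v t x \<bullet> vec_laplacian \<phi> x) * \<xi> t))"

definition energy :: "(real \<Rightarrow> real^'n \<Rightarrow> real^'n) \<Rightarrow> 'n \<Rightarrow> real \<Rightarrow> real" where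
  "energy v j t = 1/2 * (LINT x|lebesgue. (v t x $ j)\<^sup>2)"

end

theory Submission
  imports Defs "HOL-Computational_Algebra.Polynomial"
begin

text \<open>Test functions that are gradients $\nabla\psi$ remove the time derivative
    and the viscosity from
  the equation: $v(t)$ is orthogonal to gradients, and $\Delta\nabla\psi=\nabla\Delta\psi$. What
  remains is, for almost every \<open>t\<close>, the pressure equation
  $$\langle p(t),\Delta\psi\rangle=-\int \sum_{i,j}v^iv^j\,\partial_i\partial_j\psi\,dx$$
  (\<open>pressure_equation\<close>). The theorem is about the matrix $G_{ij}=\int v^iv^j\,dx$ of
  second moments at a fixed time, read off from this equation with test functions that are
  quadratic at large scales: $\psi_k(x)=k^2Z(x/k)$ with $Z(x)=x_ax_b\sigma(x)$ and a cutoff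
  $\sigma$. Their Hessians $D^2Z(x/k)$ are bounded uniformly in \<open>k\<close> and converge
  pointwise to the constant matrix $D^2Z(0)$, so dominated convergence applies on both sides.

  If $p(t)$ is an integrable function, the limit is $G_{ab}=-\delta_{ab}\int p\,dx$
  (\<open>second_moments_of_integrable_pressure\<close>). This is the equipartition of energy when
  $\int p\le0$, and $G_{aa}\le 0$ forces \<open>v = 0\<close> when $\int p\ge0$.

  Let now $p(t)\in\mathcal H^q$ with maximal function \<open>M\<close> built from $\varphi$. The
  regularisations
  $$F_R(x)=\langle p(t),\varphi(x-\cdot/R)\rangle=R^N\,(p(t)*\varphi_R)(Rx)$$
  are smooth and satisfy $|F_R(x)|\le R^NM(Rx)$; since $q\le1$, scaling gives $\int_{|x|\ge
  d}|F_R|^q\le\int_{|y|\ge Rd}M^q\to0$ (\<open>regularize_Lq_bound\<close>). The pressure equation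
  turns the Laplacian of $F_R$ into an average of second derivatives of $\varphi$,
  $$\Delta F_R(x)=-\int\sum_{i,j}v^iv^j(y)\,(\partial_i\partial_j\varphi)(x-y/R)\,dy,$$
  which is bounded uniformly in \<open>R\<close> and tends to
  $-\sum_{i,j}G_{ij}\partial_i\partial_j\varphi(x)$ (\<open>laplacian_regularize_stress\<close>,
  \<open>stress_regularized_limit\<close>). For a function with bounded Laplacian an $L^q$ bound,
  even with $q<1$, gives a pointwise bound (\<open>local_sup_bound\<close>); so the $F_R$ are
  uniformly bounded, and smallness in $L^q$ away from the origin becomes smallness in $L^1$.
  Pairing $F_R$ with $\Delta\eta$, where $\eta$ is a test function that vanishes near the origin,
  therefore gives $\int\eta\sum_{i,j}G_{ij}\partial_i\partial_j\varphi\,dx=0$. A point does not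
  matter for this integral, so every test function $\eta$ is allowed; for $\eta=\psi_k$ with $a=b$
  two integrations by parts and $k\to\infty$ leave $2G_{aa}\int\varphi\,dx=0$
  (\<open>second_moments_of_hardy_pressure\<close>). Hence $v(t)=0$.\<close>

section \<open>Partial derivatives and smooth functions\<close>

lemma partial_deriv_eq:
  assumes "(f has_derivative D) (at x)"
  shows "partial_deriv i f x = D (axis i 1)"
  using frechet_derivative_at[OF assms] by (simp add: partial_deriv_def)

lemma has_derivative_partials:
  assumes "f differentiable (at x)"
  shows "(f has_derivative (\<lambda>h. \<Sum>i\<in>UNIV. h $ i * partial_deriv i f x)) (at x)"
proof -
  have D: "(f has_derivative frechet_derivative f (at x)) (at x)"
    using assms by (simp add: frechet_derivative_works)
  interpret linear "frechet_derivative f (at x)"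
    using D has_derivative_linear by blast
  have "frechet_derivative f (at x) h = (\<Sum>i\<in>UNIV. h $ i * partial_deriv i f x)" for h
  proof -
    have "h = (\<Sum>i\<in>UNIV. (h $ i) *\<^sub>R axis i 1)"
      using basis_expansion[of h] by (simp add: scalar_mult_eq_scaleR)
    then have "frechet_derivative f (at x) h
        = frechet_derivative f (at x) (\<Sum>i\<in>UNIV. (h $ i) *\<^sub>R axis i 1)" by simp
    also have "\<dots> = (\<Sum>i\<in>UNIV. h $ i * partial_deriv i f x)"
      by (simp add: sum scale partial_deriv_def)
    finally show ?thesis .
  qed
  then have "frechet_derivative f (at x) = (\<lambda>h. \<Sum>i\<in>UNIV. h $ i * partial_deriv i f x)" by blast
  with D show ?thesis by simp
qed

lemma partial_deriv_const [simp]: "partial_deriv i (\<lambda>x. c) = (\<lambda>x. 0)"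
  by (rule ext, subst partial_deriv_eq[where D="\<lambda>h. 0"]) auto

lemma partial_deriv_component: "partial_deriv i (\<lambda>x. x $ j) = (\<lambda>x. if i = j then 1 else 0)"
  by (rule ext, subst partial_deriv_eq[where D="\<lambda>h. h $ j"])
     (auto intro!: bounded_linear_imp_has_derivative bounded_linear_vec_nth simp: axis_def)

lemma partial_deriv_add:
  assumes "f differentiable (at x)" "g differentiable (at x)"
  shows "partial_deriv i (\<lambda>x. f x + g x) x = partial_deriv i f x + partial_deriv i g x"
  using partial_deriv_eq[OF has_derivative_add[OF assms[unfolded frechet_derivative_works]]]
  by (simp add: partial_deriv_def)

lemma partial_deriv_cmult:
  assumes "f differentiable (at x)"
  shows "partial_deriv i (\<lambda>x. c * f x) x = c * partial_deriv i f x"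
  using partial_deriv_eq[OF has_derivative_mult_right[OF assms[unfolded frechet_derivative_works]]]
  by (simp add: partial_deriv_def)

lemma partial_deriv_mult:
  assumes "f differentiable (at x)" "g differentiable (at x)"
  shows "partial_deriv i (\<lambda>x. f x * g x) x
    = partial_deriv i f x * g x + f x * partial_deriv i g x"
  using partial_deriv_eq[OF has_derivative_mult[OF assms[unfolded frechet_derivative_works]]]
  by (simp add: partial_deriv_def algebra_simps)

lemma partial_deriv_compose:
  assumes "f differentiable (at x)" "(g has_real_derivative d) (at (f x))"
  shows "partial_deriv i (\<lambda>x. g (f x)) x = d * partial_deriv i f x"
    and "(\<lambda>x. g (f x)) differentiable (at x)"
proof -
  have "((\<lambda>x. g (f x)) has_derivative (\<lambda>h. d * frechet_derivative f (at x) h)) (at x)"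
    using has_derivative_compose[OF assms(1)[unfolded frechet_derivative_works]
        assms(2)[unfolded has_field_derivative_def]] by simp
  then show "partial_deriv i (\<lambda>x. g (f x)) x = d * partial_deriv i f x"
      "(\<lambda>x. g (f x)) differentiable (at x)"
    by (auto simp: partial_deriv_def partial_deriv_eq[unfolded partial_deriv_def]
        differentiable_def)
qed

lemma partial_deriv_affine:
  assumes "f differentiable (at (c *\<^sub>R x + a))"
  shows "partial_deriv i (\<lambda>x. f (c *\<^sub>R x + a)) x = c * partial_deriv i f (c *\<^sub>R x + a)"
    and "(\<lambda>x. f (c *\<^sub>R x + a)) differentiable (at x)"
proof -
  have "((\<lambda>x. c *\<^sub>R x + a) has_derivative (\<lambda>h. c *\<^sub>R h)) (at x)"
    by (auto intro!: derivative_eq_intros)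
  from has_derivative_compose[OF this assms[unfolded frechet_derivative_works]]
  have D: "((\<lambda>x. f (c *\<^sub>R x + a)) has_derivative
      (\<lambda>h. frechet_derivative f (at (c *\<^sub>R x + a)) (c *\<^sub>R h))) (at x)" .
  interpret linear "frechet_derivative f (at (c *\<^sub>R x + a))"
    using assms[unfolded frechet_derivative_works] has_derivative_linear by blast
  show "partial_deriv i (\<lambda>x. f (c *\<^sub>R x + a)) x = c * partial_deriv i f (c *\<^sub>R x + a)"
      "(\<lambda>x. f (c *\<^sub>R x + a)) differentiable (at x)"
    using partial_deriv_eq[OF D] D by (auto simp: scale partial_deriv_def differentiable_def)
qed

lemma iter_partial_Nil [simp]: "iter_partial [] f = f"
  by (simp add: iter_partial_def)

lemma iter_partial_Cons: "iter_partial (i # is) f = partial_deriv i (iter_partial is f)"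
  by (simp add: iter_partial_def)

lemma iter_partial_snoc [simp]: "iter_partial (is @ [i]) f = iter_partial is (partial_deriv i f)"
  by (simp add: iter_partial_def)

lemma iter_partial_append: "iter_partial (is @ js) f = iter_partial is (iter_partial js f)"
  by (simp add: iter_partial_def)

text \<open>Smoothness is treated by induction on the order of differentiability. The induction step peels
  off the partial derivative that is applied \<^emph>\<open>first\<close>, since the rules for
  products and compositions describe the first derivative of the given function.\<close>

definition smooth_upto :: "nat \<Rightarrow> (real^'n \<Rightarrow> real) \<Rightarrow> bool" where
  "smooth_upto n f \<longleftrightarrow> (\<forall>is x. length is \<le> n \<longrightarrow> iter_partial is f differentiable (at x))"

lemma smooth_iff_upto: "smooth f \<longleftrightarrow> (\<forall>n. smooth_upto n f)"
  unfolding smooth_def smooth_upto_def by auto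

lemma smooth_upto_0: "smooth_upto 0 f \<longleftrightarrow> (\<forall>x. f differentiable (at x))"
  by (simp add: smooth_upto_def)

lemma smooth_upto_Suc: "smooth_upto (Suc n) f \<longleftrightarrow>
    (\<forall>x. f differentiable (at x)) \<and> (\<forall>i. smooth_upto n (partial_deriv i f))"
proof
  assume *: "smooth_upto (Suc n) f"
  have "f differentiable (at x)" for x
    using *[unfolded smooth_upto_def, rule_format, of "[]"] by simp
  moreover have "smooth_upto n (partial_deriv i f)" for i
    unfolding smooth_upto_def
    using *[unfolded smooth_upto_def, rule_format, of "_ @ [i]"] by simp
  ultimately show "(\<forall>x. f differentiable (at x)) \<and> (\<forall>i. smooth_upto n (partial_deriv i f))" by blast
next
  assume *: "(\<forall>x. f differentiable (at x)) \<and> (\<forall>i. smooth_upto n (partial_deriv i f))"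
  show "smooth_upto (Suc n) f"
    unfolding smooth_upto_def
  proof (intro allI impI)
    fix il :: "'a list" and x
    assume "length il \<le> Suc n"
    then show "iter_partial il f differentiable (at x)"
      using * by (cases il rule: rev_cases) (auto simp: smooth_upto_def)
  qed
qed

lemma smooth_partial: "smooth f \<Longrightarrow> smooth (partial_deriv i f)"
  unfolding smooth_iff_upto using smooth_upto_Suc by blast

lemma smooth_iter: "smooth f \<Longrightarrow> smooth (iter_partial is f)"
  by (induction "is") (auto simp: iter_partial_Cons smooth_partial)

lemma smooth_diff: "smooth f \<Longrightarrow> f differentiable (at x)"
  unfolding smooth_iff_upto using smooth_upto_0 by blast

lemma smooth_continuous: "smooth f \<Longrightarrow> continuous_on S f"
  by (meson continuous_at_imp_continuous_on differentiable_imp_continuous_within smooth_diff)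

lemma smooth_borel: "smooth f \<Longrightarrow> f \<in> borel_measurable borel"
  by (intro borel_measurable_continuous_onI smooth_continuous)

lemma smooth_upto_const: "smooth_upto n (\<lambda>x. c)"
  by (induction n arbitrary: c) (auto simp: smooth_upto_0 smooth_upto_Suc)

lemma smooth_const: "smooth (\<lambda>x. c)"
  by (simp add: smooth_iff_upto smooth_upto_const)

lemma smooth_component: "smooth (\<lambda>x. x $ j)"
proof -
  have "(\<lambda>x::real^'a. x $ j) differentiable (at x)" for x
    unfolding differentiable_def
    by (rule exI[of _ "\<lambda>h. h $ j"])
        (auto intro!: bounded_linear_imp_has_derivative bounded_linear_vec_nth)
  then have "smooth_upto n (\<lambda>x. x $ j)" for n
    by (cases n) (auto simp: smooth_upto_0 smooth_upto_Suc partial_deriv_component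
        smooth_upto_const)
  then show ?thesis by (simp add: smooth_iff_upto)
qed

lemma smooth_upto_add: "smooth_upto n f \<Longrightarrow> smooth_upto n g \<Longrightarrow> smooth_upto n (\<lambda>x. f x + g x)"
proof (induction n arbitrary: f g)
  case (Suc n)
  have "partial_deriv i (\<lambda>x. f x + g x) = (\<lambda>x. partial_deriv i f x + partial_deriv i g x)" for i
    using Suc.prems by (auto simp: smooth_upto_Suc partial_deriv_add)
  with Suc show ?case by (auto simp: smooth_upto_Suc)
qed (auto simp: smooth_upto_0)

lemma smooth_upto_mono: "smooth_upto (Suc n) f \<Longrightarrow> smooth_upto n f"
  unfolding smooth_upto_def by auto

lemma smooth_upto_mult: "smooth_upto n f \<Longrightarrow> smooth_upto n g \<Longrightarrow> smooth_upto n (\<lambda>x. f x * g x)"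
proof (induction n arbitrary: f g)
  case (Suc n)
  have "partial_deriv i (\<lambda>x. f x * g x)
      = (\<lambda>x. partial_deriv i f x * g x + f x * partial_deriv i g x)" for i
    using Suc.prems by (auto simp: smooth_upto_Suc partial_deriv_mult)
  moreover have "smooth_upto n (\<lambda>x. partial_deriv i f x * g x + f x * partial_deriv i g x)" for i
    using Suc.prems smooth_upto_mono
    by (intro smooth_upto_add Suc.IH) (auto simp: smooth_upto_Suc)
  ultimately show ?case using Suc.prems by (auto simp: smooth_upto_Suc)
qed (auto simp: smooth_upto_0)

lemma smooth_add: "smooth f \<Longrightarrow> smooth g \<Longrightarrow> smooth (\<lambda>x. f x + g x)"
  by (simp add: smooth_iff_upto smooth_upto_add)

lemma smooth_mult: "smooth f \<Longrightarrow> smooth g \<Longrightarrow> smooth (\<lambda>x. f x * g x)"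
  by (simp add: smooth_iff_upto smooth_upto_mult)

lemma smooth_cmult: "smooth f \<Longrightarrow> smooth (\<lambda>x. c * f x)"
  by (intro smooth_mult smooth_const)

lemma smooth_sum: "(\<And>i. i \<in> I \<Longrightarrow> smooth (f i)) \<Longrightarrow> smooth (\<lambda>x. \<Sum>i\<in>I. f i x)"
  by (induction I rule: infinite_finite_induct) (auto intro: smooth_const smooth_add)

lemma smooth_norm_sq: "smooth (\<lambda>x. (norm x)\<^sup>2)"
proof -
  have "(\<lambda>x::real^'a. (norm x)\<^sup>2) = (\<lambda>x. \<Sum>i\<in>UNIV. x $ i * x $ i)"
    by (auto simp: power2_norm_eq_inner inner_vec_def)
  then show ?thesis by (auto intro!: smooth_sum smooth_mult smooth_component)
qed

text \<open>The outer function comes with the sequence of all its derivatives,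
    so that the chain rule stays
  within the family to which the induction hypothesis applies.\<close>

lemma smooth_compose:
  fixes f :: "real^'n \<Rightarrow> real"
  assumes G: "\<And>n t. (G n has_real_derivative G (Suc n) t) (at t)" and f: "smooth f"
  shows "smooth (\<lambda>x. G k (f x))"
proof -
  have "smooth_upto n (\<lambda>x. G k (f x))" for n
  proof (induction n arbitrary: k)
    case 0
    then show ?case using partial_deriv_compose(2)[OF smooth_diff[OF f] G] by
        (simp add: smooth_upto_0)
  next
    case (Suc n)
    have "partial_deriv i (\<lambda>x. G k (f x)) = (\<lambda>x. G (Suc k) (f x) * partial_deriv i f x)" for i
      using partial_deriv_compose(1)[OF smooth_diff[OF f] G] by auto
    moreover have "smooth_upto n (\<lambda>x. G (Suc k) (f x) * partial_deriv i f x)" for i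
      using Suc smooth_partial[OF f, of i] by (auto simp: smooth_iff_upto intro!: smooth_upto_mult)
    ultimately show ?case
      using partial_deriv_compose(2)[OF smooth_diff[OF f] G] by (simp add: smooth_upto_Suc)
  qed
  then show ?thesis by (simp add: smooth_iff_upto)
qed

lemma iter_partial_affine:
  assumes "smooth f"
  shows "iter_partial is (\<lambda>x. f (c *\<^sub>R x + a)) = (\<lambda>x. c ^ length is * iter_partial is f
      (c *\<^sub>R x + a))"
proof (induction "is")
  case (Cons i il)
  have d: "iter_partial il f differentiable (at y)" for y
    using smooth_diff smooth_iter assms by blast
  show ?case
    by (rule ext) (simp add: iter_partial_Cons Cons partial_deriv_cmult partial_deriv_affine d)
qed simp

lemma smooth_affine:
  assumes "smooth f"
  shows "smooth (\<lambda>x. f (c *\<^sub>R x + a))"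
  unfolding smooth_def iter_partial_affine[OF assms]
proof (intro allI)
  fix il x
  have "(\<lambda>x. iter_partial il f (c *\<^sub>R x + a)) differentiable (at x)"
    by (rule partial_deriv_affine(2)) (intro smooth_diff smooth_iter assms)
  then show "(\<lambda>x. c ^ length il * iter_partial il f (c *\<^sub>R x + a)) differentiable (at x)"
    by simp
qed

lemma iter_partial_add:
  assumes "smooth f" "smooth g"
  shows "iter_partial is (\<lambda>x. f x + g x) = (\<lambda>x. iter_partial is f x + iter_partial is g x)"
proof (induction "is")
  case (Cons i il)
  then show ?case
    by (auto simp: iter_partial_Cons partial_deriv_add smooth_diff smooth_iter assms)
qed simp

lemma iter_partial_cmult:
  assumes "smooth f"
  shows "iter_partial is (\<lambda>x. c * f x) = (\<lambda>x. c * iter_partial is f x)"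
proof (induction "is")
  case (Cons i il)
  then show ?case
    by (auto simp: iter_partial_Cons partial_deriv_cmult smooth_diff smooth_iter assms)
qed simp

lemma iter_partial_zero [simp]: "iter_partial is (\<lambda>x. 0) = (\<lambda>x. 0)"
  by (induction "is") (auto simp: iter_partial_Cons)

lemma iter_partial_diff:
  assumes "smooth f" "smooth g"
  shows "iter_partial is (\<lambda>x. f x - g x) = (\<lambda>x. iter_partial is f x - iter_partial is g x)"
  using iter_partial_add[OF assms(1) smooth_cmult[OF assms(2), of "-1"], of "is"]
  unfolding iter_partial_cmult[OF assms(2)] by simp

lemma smooth_minus: "smooth f \<Longrightarrow> smooth g \<Longrightarrow> smooth (\<lambda>x. f x - g x)"
  using smooth_add[of f "\<lambda>x. (-1) * g x"] smooth_cmult[of g "-1"] by simp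

lemma iter_partial_sum:
  assumes "\<And>i. i \<in> I \<Longrightarrow> smooth (f i)"
  shows "iter_partial is (\<lambda>x. \<Sum>i\<in>I. f i x) = (\<lambda>x. \<Sum>i\<in>I. iter_partial is (f i) x)"
  using assms
proof (induction I rule: infinite_finite_induct)
  case (insert a F)
  then show ?case by (simp add: iter_partial_add smooth_sum)
qed auto

lemma has_real_derivative_along:
  fixes f :: "real^'n \<Rightarrow> real"
  assumes "f differentiable (at (x + s *\<^sub>R h))"
  shows "((\<lambda>s. f (x + s *\<^sub>R h)) has_real_derivative
      (\<Sum>i\<in>UNIV. h $ i * partial_deriv i f (x + s *\<^sub>R h))) (at s)"
proof -
  have "((\<lambda>s. x + s *\<^sub>R h) has_derivative (\<lambda>d. d *\<^sub>R h)) (at s)"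
    by (auto intro!: derivative_eq_intros)
  from has_derivative_compose[OF this has_derivative_partials[OF assms]]
  show ?thesis
    unfolding has_field_derivative_def
    by (rule has_derivative_eq_rhs) (auto simp: sum_distrib_right sum_distrib_left algebra_simps)
qed

lemma has_real_derivative_axis:
  fixes f :: "real^'n \<Rightarrow> real"
  assumes "f differentiable (at (x + s *\<^sub>R axis i 1))"
  shows "((\<lambda>s. f (x + s *\<^sub>R axis i 1)) has_real_derivative partial_deriv i f (x
      + s *\<^sub>R axis i 1)) (at s)"
proof -
  have "(\<Sum>j\<in>UNIV. axis i 1 $ j * partial_deriv j f (x + s *\<^sub>R axis i 1))
      = (\<Sum>j\<in>UNIV. if j = i then partial_deriv j f (x + s *\<^sub>R axis i 1) else 0)"
    by (rule sum.cong) (auto simp: axis_def)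
  then show ?thesis using has_real_derivative_along[OF assms] by simp
qed

text \<open>Clairaut's theorem: the mixed second difference equals both mixed derivatives at nearby
  points, by applying the mean value theorem in either order.\<close>

lemma second_difference:
  fixes f :: "real^'n \<Rightarrow> real"
  assumes f: "smooth f" and r: "r > 0"
  shows "\<exists>s u. 0 < s \<and> s < r \<and> 0 < u \<and> u < r \<and>
    f (x + r *\<^sub>R axis i 1 + r *\<^sub>R axis j 1) - f (x + r *\<^sub>R axis i 1)
      - f (x + r *\<^sub>R axis j 1) + f x
    = r\<^sup>2 * partial_deriv j (partial_deriv i f) (x + s *\<^sub>R axis i 1 + u *\<^sub>R axis j 1)"
proof -
  let ?A = "\<lambda>s. f ((x + r *\<^sub>R axis j 1) + s *\<^sub>R axis i 1) - f (x + s *\<^sub>R axis i 1)"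
  have "(?A has_real_derivative partial_deriv i f ((x + r *\<^sub>R axis j 1) + s *\<^sub>R axis i 1)
      - partial_deriv i f (x + s *\<^sub>R axis i 1)) (at s)" for s
    by (intro DERIV_diff has_real_derivative_axis smooth_diff f)
  from MVT2[OF r this] obtain s where s: "0 < s" "s < r" and
    1: "?A r - ?A 0 = (r - 0) * (partial_deriv i f ((x + r *\<^sub>R axis j 1) + s *\<^sub>R axis i 1)
      - partial_deriv i f (x + s *\<^sub>R axis i 1))" by blast
  let ?B = "\<lambda>u. partial_deriv i f ((x + s *\<^sub>R axis i 1) + u *\<^sub>R axis j 1)"
  have "(?B has_real_derivative
      partial_deriv j (partial_deriv i f) ((x + s *\<^sub>R axis i 1) + u *\<^sub>R axis j 1)) (at u)" for u
    by (intro has_real_derivative_axis smooth_diff smooth_partial f)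
  from MVT2[OF r this] obtain u where u: "0 < u" "u < r" and
    2: "?B r - ?B 0 = (r - 0) * partial_deriv j (partial_deriv i f) ((x + s *\<^sub>R axis i 1)
        + u *\<^sub>R axis j 1)"
    by blast
  from 1 2 have "f (x + r *\<^sub>R axis i 1 + r *\<^sub>R axis j 1) - f (x + r *\<^sub>R axis i 1)
      - f (x + r *\<^sub>R axis j 1) + f x
    = r\<^sup>2 * partial_deriv j (partial_deriv i f) (x + s *\<^sub>R axis i 1 + u *\<^sub>R axis j 1)"
    by (simp add: algebra_simps power2_eq_square)
  with s u show ?thesis by blast
qed

lemma partial_deriv_commute:
  fixes f :: "real^'n \<Rightarrow> real"
  assumes f: "smooth f"
  shows "partial_deriv i (partial_deriv j f) = partial_deriv j (partial_deriv i f)"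
proof
  fix x
  let ?a = "partial_deriv i (partial_deriv j f)" and ?b = "partial_deriv j (partial_deriv i f)"
  have ca: "isCont ?a x" and cb: "isCont ?b x"
    by (auto intro!: differentiable_imp_continuous_within smooth_diff smooth_partial f)
  show "?a x = ?b x"
  proof (rule ccontr)
    assume ne: "?a x \<noteq> ?b x"
    \<comment> \<open>If the values differ, both second differences are evaluated so close to \<open>x\<close> that they
        differ too.\<close>
    define e where "e = \<bar>?a x - ?b x\<bar> / 2"
    have e: "e > 0" using ne by (simp add: e_def)
    obtain d1 where d1: "d1 > 0" "\<And>y. dist y x < d1 \<Longrightarrow> dist (?a y) (?a x) < e"
      using ca e unfolding continuous_at_eps_delta by metis
    obtain d2 where d2: "d2 > 0" "\<And>y. dist y x < d2 \<Longrightarrow> dist (?b y) (?b x) < e"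
      using cb e unfolding continuous_at_eps_delta by metis
    define r where "r = min d1 d2 / 2"
    have r: "r > 0" using d1 d2 by (simp add: r_def)
    obtain s u where su: "0 < s" "s < r" "0 < u" "u < r" and 1:
      "f (x + r *\<^sub>R axis i 1 + r *\<^sub>R axis j 1) - f (x + r *\<^sub>R axis i 1)
      - f (x + r *\<^sub>R axis j 1) + f x
      = r\<^sup>2 * ?b (x + s *\<^sub>R axis i 1 + u *\<^sub>R axis j 1)"
      using second_difference[OF f r] by blast
    obtain s' u' where su': "0 < s'" "s' < r" "0 < u'" "u' < r" and 2:
      "f (x + r *\<^sub>R axis j 1 + r *\<^sub>R axis i 1) - f (x + r *\<^sub>R axis j 1)
      - f (x + r *\<^sub>R axis i 1) + f x
      = r\<^sup>2 * ?a (x + s' *\<^sub>R axis j 1 + u' *\<^sub>R axis i 1)"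
      using second_difference[OF f r] by blast
    have near: "dist (x + p *\<^sub>R axis k 1 + q *\<^sub>R axis l 1) x < min d1 d2"
      if "0 < p" "p < r" "0 < q" "q < r" for p q and k l :: 'n
    proof -
      have "norm (p *\<^sub>R axis k 1 + q *\<^sub>R axis l (1::real)) \<le> p + q"
        using that norm_triangle_ineq[of "p *\<^sub>R axis k 1" "q *\<^sub>R axis l (1::real)"] by simp
      then show ?thesis using that by (simp add: dist_norm r_def algebra_simps)
    qed
    have "?b (x + s *\<^sub>R axis i 1 + u *\<^sub>R axis j 1) = ?a (x + s' *\<^sub>R axis j 1 + u' *\<^sub>R axis i 1)"
      using 1 2 r by (simp add: algebra_simps)
    moreover have "dist (?b (x + s *\<^sub>R axis i 1 + u *\<^sub>R axis j 1)) (?b x) < e"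
      using d2(2) near[OF su] by simp
    moreover have "dist (?a (x + s' *\<^sub>R axis j 1 + u' *\<^sub>R axis i 1)) (?a x) < e"
      using d1(2) near[OF su'] by simp
    ultimately show False by (auto simp: e_def dist_real_def abs_if split: if_splits)
  qed
qed

section \<open>A smooth bump\<close>

text \<open>The derivatives of $e^{-1/t}$ are of the form $p(1/t)e^{-1/t}$ with polynomials $p$.\<close>

primrec bump_poly :: "nat \<Rightarrow> real poly" where
  "bump_poly 0 = 1"
| "bump_poly (Suc n) = monom 1 2 * (bump_poly n - pderiv (bump_poly n))"

definition bump :: "nat \<Rightarrow> real \<Rightarrow> real" where
  "bump n t = (if t > 0 then poly (bump_poly n) (1/t) * exp (- (1/t)) else 0)"

lemma poly_times_exp_tendsto_0:
  fixes p :: "real poly"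
  shows "((\<lambda>s. poly p s * exp (- s)) \<longlongrightarrow> 0) at_top"
proof -
  have "((\<lambda>s. \<Sum>i\<le>degree p. coeff p i * (s ^ i / exp s)) \<longlongrightarrow> (\<Sum>i\<le>degree p. coeff p i * 0)) at_top"
    by (intro tendsto_intros tendsto_power_div_exp_0)
  then show ?thesis
    by (simp add: poly_altdef sum_distrib_right exp_minus divide_inverse mult.assoc)
qed

lemma bump_nonpos: "t \<le> 0 \<Longrightarrow> bump n t = 0"
  by (simp add: bump_def)

lemma bump_has_derivative: "(bump n has_real_derivative bump (Suc n) t) (at t)"
proof -
  consider "t > 0" | "t < 0" | "t = 0" by linarith
  then show ?thesis
  proof cases
    case 1
    have "((\<lambda>t. poly (bump_poly n) (1/t) * exp (- (1/t))) has_real_derivative bump (Suc n) t)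
        (at t)"
      using 1
      by (auto intro!: derivative_eq_intros DERIV_chain2[OF poly_DERIV]
            simp: bump_def poly_monom power2_eq_square field_simps)
    moreover have "\<forall>\<^sub>F s in nhds t. s \<in> {0<..}"
      using 1 by (intro eventually_nhds_in_open) auto
    then have ev: "\<forall>\<^sub>F s in nhds t. poly (bump_poly n) (1/s) * exp (- (1/s)) = bump n s"
      by (rule eventually_mono) (auto simp: bump_def)
    ultimately show ?thesis
      using iffD1[OF DERIV_cong_ev[OF refl ev refl]] by blast
  next
    case 2
    have "\<forall>\<^sub>F s in nhds t. s \<in> {..<0}"
      using 2 by (intro eventually_nhds_in_open) auto
    then have "\<forall>\<^sub>F s in nhds t. 0 = bump n s"
      by (rule eventually_mono) (auto simp: bump_def)
    then have "(bump n has_real_derivative 0) (at t)"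
      by (rule iffD1[OF DERIV_cong_ev[OF refl _ refl] DERIV_const])
    then show ?thesis using 2 by (simp add: bump_def)
  next
    case 3
    \<comment> \<open>To the right of \<open>0\<close> the difference quotient is $s\,p(s)e^{-s}$ at $s=1/h$.\<close>
    have "((\<lambda>s. poly (bump_poly n * monom 1 1) s * exp (- s)) \<longlongrightarrow> 0) at_top"
      by (rule poly_times_exp_tendsto_0)
    then have "((\<lambda>h. poly (bump_poly n * monom 1 1) (inverse h) * exp (- inverse h)) \<longlongrightarrow> 0)
        (at_right 0)"
      by (rule filterlim_compose) (rule filterlim_inverse_at_top_right)
    then have R: "((\<lambda>h. bump n h / h) \<longlongrightarrow> 0) (at_right 0)"
      by (rule Lim_transform_eventually)
         (auto simp: bump_def eventually_at_right_field poly_monom field_simps intro!: exI[of _ 1])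
    have L: "((\<lambda>h. bump n h / h) \<longlongrightarrow> 0) (at_left 0)"
      by (rule Lim_transform_eventually[OF tendsto_const])
         (auto simp: bump_def eventually_at_left_field intro!: exI[of _ "-1"])
    have "((\<lambda>h. bump n h / h) \<longlongrightarrow> 0) (at 0)"
      using L R by (rule filterlim_split_at)
    then show ?thesis
      using 3 bump_nonpos[of 0] by (simp add: DERIV_def)
  qed
qed

lemma bump_nonneg: "bump 0 t \<ge> 0" and bump_le_1: "bump 0 t \<le> 1"
  by (auto simp: bump_def)

lemma bump_Suc_0: "bump (Suc 0) t = (if t > 0 then exp (- (1/t)) / t\<^sup>2 else 0)"
  by (simp add: bump_def poly_monom power_divide)

lemma bump_continuous: "continuous_on S (bump n)"
  by (meson DERIV_isCont bump_has_derivative continuous_at_imp_continuous_on)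

lemma smooth_bump: "smooth f \<Longrightarrow> smooth (\<lambda>x. bump k (f x))"
  by (rule smooth_compose[of bump]) (rule bump_has_derivative)

section \<open>Test functions\<close>

lemma test_iff: "f \<in> test_functions \<longleftrightarrow> smooth f \<and> bounded {x. f x \<noteq> 0}"
  by (simp add: test_functions_def supp_def compact_closure)

lemma test_smooth: "f \<in> test_functions \<Longrightarrow> smooth f"
  by (simp add: test_iff)

lemma partial_deriv_eq_0:
  assumes "x \<notin> supp f"
  shows "partial_deriv i f x = 0"
proof -
  have "\<forall>\<^sub>F y in nhds x. y \<in> - supp f"
    using assms by (intro eventually_nhds_in_open) (auto simp: supp_def)
  then have "\<forall>\<^sub>F y in nhds x. f y = 0"
    by (rule eventually_mono) (use closure_subset[of "{x. f x \<noteq> 0}"] in \<open>auto simp: supp_def\<close>)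
  then have "\<forall>\<^sub>F y in at x. 0 = f y"
    unfolding eventually_at_filter by (rule eventually_mono) auto
  moreover have "0 = f x"
    using assms closure_subset[of "{x. f x \<noteq> 0}"] by (auto simp: supp_def)
  ultimately have "(f has_derivative (\<lambda>h. 0)) (at x)"
    by (intro has_derivative_transform_eventually[OF has_derivative_const[of 0]]) auto
  then show ?thesis by (simp add: partial_deriv_eq)
qed

lemma supp_partial: "supp (partial_deriv i f) \<subseteq> supp f"
  unfolding supp_def[of "partial_deriv i f"]
  by (rule closure_minimal) (use partial_deriv_eq_0 in \<open>auto simp: supp_def\<close>)

lemma test_partial:
  assumes "f \<in> test_functions"
  shows "partial_deriv i f \<in> test_functions"
proof -
  have "{x. partial_deriv i f x \<noteq> 0} \<subseteq> closure {x. f x \<noteq> 0}"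
    using partial_deriv_eq_0 by (force simp: supp_def)
  then have "bounded {x. partial_deriv i f x \<noteq> 0}"
    using assms bounded_closure bounded_subset by (auto simp: test_iff)
  then show ?thesis using assms by (auto simp: test_iff smooth_partial)
qed

lemma test_subset:
  assumes "smooth f" "g \<in> test_functions" "\<And>x. g x = 0 \<Longrightarrow> f x = 0"
  shows "f \<in> test_functions"
  using assms bounded_subset[of "{x. g x \<noteq> 0}" "{x. f x \<noteq> 0}"] by (auto simp: test_iff)

lemma test_mult: "smooth f \<Longrightarrow> g \<in> test_functions \<Longrightarrow> (\<lambda>x. f x * g x) \<in> test_functions"
  by (rule test_subset[of _ g]) (auto intro: smooth_mult test_smooth)

lemma test_cmult: "g \<in> test_functions \<Longrightarrow> (\<lambda>x. c * g x) \<in> test_functions"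
  by (intro test_mult smooth_const)

lemma test_add:
  assumes "f \<in> test_functions" "g \<in> test_functions"
  shows "(\<lambda>x. f x + g x) \<in> test_functions"
proof -
  have "bounded ({x. f x \<noteq> 0} \<union> {x. g x \<noteq> 0})" using assms by (auto simp: test_iff)
  then have "bounded {x. f x + g x \<noteq> 0}" by (rule bounded_subset) auto
  then show ?thesis using assms by (auto simp: test_iff smooth_add)
qed

lemma test_zero: "(\<lambda>x. 0) \<in> test_functions"
  by (simp add: test_iff smooth_const)

lemma test_sum: "(\<And>i. i \<in> I \<Longrightarrow> f i \<in> test_functions) \<Longrightarrow> (\<lambda>x. \<Sum>i\<in>I. f i x) \<in> test_functions"
  by (induction I rule: infinite_finite_induct) (auto intro: test_zero test_add)

lemma test_affine:
  assumes "f \<in> test_functions" "c \<noteq> 0"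
  shows "(\<lambda>x. f (c *\<^sub>R x + a)) \<in> test_functions"
proof -
  obtain B where B: "\<And>x. f x \<noteq> 0 \<Longrightarrow> norm x \<le> B"
    using assms by (auto simp: test_iff bounded_iff)
  have "norm x \<le> (B + norm a) / \<bar>c\<bar>" if "f (c *\<^sub>R x + a) \<noteq> 0" for x
  proof -
    have "\<bar>c\<bar> * norm x = norm ((c *\<^sub>R x + a) - a)" by simp
    also have "\<dots> \<le> B + norm a" using B[OF that] norm_triangle_ineq4[of "c *\<^sub>R x + a" a] by linarith
    finally show ?thesis using assms(2) by (simp add: field_simps)
  qed
  then have "bounded {x. f (c *\<^sub>R x + a) \<noteq> 0}" unfolding bounded_iff by blast
  then show ?thesis using assms smooth_affine by (auto simp: test_iff)
qed

lemma continuous_compact_bounded: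
  assumes "continuous_on UNIV f" "bounded {x. f x \<noteq> (0::real)}"
  shows "\<exists>B. \<forall>x. \<bar>f (x::'a::euclidean_space)\<bar> \<le> B"
proof -
  have "compact (f ` closure {x. f x \<noteq> 0})"
    by (intro compact_continuous_image continuous_on_subset[OF assms(1)])
       (auto simp: compact_closure assms(2))
  then obtain B where B: "\<And>y. y \<in> f ` closure {x. f x \<noteq> 0} \<Longrightarrow> norm y \<le> B"
    using compact_imp_bounded bounded_iff by metis
  have "\<bar>f x\<bar> \<le> max B 0" for x
    using B[of "f x"] closure_subset[of "{x. f x \<noteq> 0}"] by (cases "f x = 0") auto
  then show ?thesis by blast
qed

lemma test_bounded: "f \<in> test_functions \<Longrightarrow> \<exists>B. \<forall>x. \<bar>f x\<bar> \<le> B"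
  by (intro continuous_compact_bounded) (auto simp: test_iff smooth_continuous)

lemma test_bump: "(\<lambda>x. bump 0 (1 - (norm x)\<^sup>2)) \<in> test_functions"
proof -
  have "norm x \<le> 1" if "bump 0 (1 - (norm x)\<^sup>2) \<noteq> 0" for x :: "real^'a"
    using that by (auto simp: bump_def power2_le_imp_le abs_square_less_1 split: if_splits)
  then have "bounded {x::real^'a. bump 0 (1 - (norm x)\<^sup>2) \<noteq> 0}"
    unfolding bounded_iff by blast
  moreover have "smooth (\<lambda>x::real^'a. bump 0 (1 - (norm x)\<^sup>2))"
    by (intro smooth_bump smooth_minus smooth_const smooth_norm_sq)
  ultimately show ?thesis by (simp add: test_iff)
qed

text \<open>The factor normalises the value at the origin to \<open>1\<close>. This is the value that
  matters, since the rescaled cutoffs $x\mapsto\sigma(x/k)$ tend to $\sigma(0)$ at every point.\<close>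

definition cutoff :: "real^'n \<Rightarrow> real" where
  "cutoff x = exp 1 * bump 0 (1 - (norm x)\<^sup>2)"

lemma cutoff_test: "cutoff \<in> test_functions"
  unfolding cutoff_def[abs_def] by (intro test_cmult test_bump)

lemma cutoff_0: "cutoff 0 = 1"
  by (simp add: cutoff_def bump_def exp_minus)

section \<open>Schwartz functions\<close>

lemma schwartzD:
  assumes "f \<in> schwartz"
  obtains C where "C \<ge> 0" "\<And>x. (1 + norm x) ^ m * \<bar>iter_partial is f x\<bar> \<le> C"
proof -
  have "bounded (range (\<lambda>x. (1 + norm x) ^ m * iter_partial is f x))"
    using assms by (auto simp: schwartz_def)
  then obtain C where "\<And>x. \<bar>(1 + norm x) ^ m * iter_partial is f x\<bar> \<le> C"
    unfolding bounded_iff by auto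
  then have "(1 + norm x) ^ m * \<bar>iter_partial is f x\<bar> \<le> max C 0" for x
    by (simp add: abs_mult max.coboundedI1)
  then show ?thesis using that by (meson max.cobounded2)
qed

lemma schwartzI:
  assumes "smooth f" "\<And>m is. \<exists>C. \<forall>x. (1 + norm x) ^ m * \<bar>iter_partial is f x\<bar> \<le> C"
  shows "f \<in> schwartz"
  unfolding schwartz_def bounded_iff
  using assms by (auto simp: abs_mult)

lemma schwartz_smooth: "f \<in> schwartz \<Longrightarrow> smooth f"
  by (simp add: schwartz_def)

lemma schwartz_partial:
  assumes "f \<in> schwartz"
  shows "partial_deriv i f \<in> schwartz"
proof (rule schwartzI)
  fix m il
  show "\<exists>C. \<forall>x. (1 + norm x) ^ m * \<bar>iter_partial il (partial_deriv i f) x\<bar> \<le> C"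
    using schwartzD[OF assms, of m "il @ [i]"] by simp blast
qed (use assms in \<open>auto intro: smooth_partial schwartz_smooth\<close>)

lemma schwartz_add:
  assumes "f \<in> schwartz" "g \<in> schwartz"
  shows "(\<lambda>x. f x + g x) \<in> schwartz"
proof (rule schwartzI)
  fix m il
  obtain C where C: "\<And>x. (1 + norm x) ^ m * \<bar>iter_partial il f x\<bar> \<le> C"
    using schwartzD[OF assms(1)] by blast
  obtain D where D: "\<And>x. (1 + norm x) ^ m * \<bar>iter_partial il g x\<bar> \<le> D"
    using schwartzD[OF assms(2)] by blast
  have "(1 + norm x) ^ m * \<bar>iter_partial il f x + iter_partial il g x\<bar> \<le> C + D" for x
  proof -
    have "(1 + norm x) ^ m * \<bar>iter_partial il f x + iter_partial il g x\<bar>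
        \<le> (1 + norm x) ^ m * (\<bar>iter_partial il f x\<bar> + \<bar>iter_partial il g x\<bar>)"
      by (intro mult_left_mono) auto
    with C[of x] D[of x] show ?thesis by (simp add: distrib_left)
  qed
  then show "\<exists>C. \<forall>x. (1 + norm x) ^ m * \<bar>iter_partial il (\<lambda>x. f x + g x) x\<bar> \<le> C"
    by (subst iter_partial_add) (use assms schwartz_smooth in auto)
qed (use assms in \<open>auto intro: smooth_add schwartz_smooth\<close>)

lemma schwartz_cmult:
  assumes "f \<in> schwartz"
  shows "(\<lambda>x. c * f x) \<in> schwartz"
proof (rule schwartzI)
  fix m il
  obtain C where C: "\<And>x. (1 + norm x) ^ m * \<bar>iter_partial il f x\<bar> \<le> C"
    using schwartzD[OF assms(1)] by blast
  have "(1 + norm x) ^ m * \<bar>c * iter_partial il f x\<bar> \<le> \<bar>c\<bar> * C" for x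
    using mult_left_mono[OF C[of x], of "\<bar>c\<bar>"] by (simp add: abs_mult algebra_simps)
  then show "\<exists>C. \<forall>x. (1 + norm x) ^ m * \<bar>iter_partial il (\<lambda>x. c * f x) x\<bar> \<le> C"
    by (subst iter_partial_cmult) (use assms schwartz_smooth in auto)
qed (use assms in \<open>auto intro: smooth_cmult schwartz_smooth\<close>)

lemma schwartz_minus: "f \<in> schwartz \<Longrightarrow> g \<in> schwartz \<Longrightarrow> (\<lambda>x. f x - g x) \<in> schwartz"
  using schwartz_add[of f "\<lambda>x. (-1) * g x"] schwartz_cmult[of g "-1"] by simp

lemma schwartz_zero: "(\<lambda>x. 0) \<in> schwartz"
  by (rule schwartzI) (auto simp: smooth_const)

lemma schwartz_sum: "(\<And>i. i \<in> I \<Longrightarrow> f i \<in> schwartz) \<Longrightarrow> (\<lambda>x. \<Sum>i\<in>I. f i x) \<in> schwartz"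
  by (induction I rule: infinite_finite_induct) (auto intro: schwartz_zero schwartz_add)

text \<open>Schwartz weights survive an affine change of variables up to a constant.\<close>

lemma affine_weight:
  fixes x a :: "'a::real_normed_vector"
  assumes "c \<noteq> 0"
  shows "(1 + norm x) ^ m \<le> (1 + (1 + norm a) / \<bar>c\<bar>) ^ m * (1 + norm (c *\<^sub>R x + a)) ^ m"
proof -
  let ?z = "c *\<^sub>R x + a"
  have "\<bar>c\<bar> * norm x = norm (?z - a)" by simp
  also have "\<dots> \<le> norm ?z + norm a" by (rule norm_triangle_ineq4)
  also have "\<dots> \<le> (1 + norm a) * (1 + norm ?z)" by (simp add: algebra_simps)
  finally have "norm x \<le> (1 + norm a) / \<bar>c\<bar> * (1 + norm ?z)"
    using assms by (simp add: field_simps)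
  then have "1 + norm x \<le> (1 + (1 + norm a) / \<bar>c\<bar>) * (1 + norm ?z)"
    by (simp add: distrib_right) (use norm_ge_zero[of ?z] in linarith)
  then have "(1 + norm x) ^ m \<le> ((1 + (1 + norm a) / \<bar>c\<bar>) * (1 + norm ?z)) ^ m"
    by (intro power_mono) auto
  then show ?thesis by (simp add: power_mult_distrib)
qed

lemma schwartz_affine:
  assumes "f \<in> schwartz" "c \<noteq> 0"
  shows "(\<lambda>x. f (c *\<^sub>R x + a)) \<in> schwartz"
proof (rule schwartzI)
  fix m il
  obtain C where C: "\<And>x. (1 + norm x) ^ m * \<bar>iter_partial il f x\<bar> \<le> C"
    using schwartzD[OF assms(1)] by blast
  let ?K = "(1 + (1 + norm a) / \<bar>c\<bar>) ^ m"
  have K: "?K \<ge> 0" by (intro zero_le_power) auto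
  have "(1 + norm x) ^ m * \<bar>c ^ length il * iter_partial il f (c *\<^sub>R x + a)\<bar> \<le> \<bar>c\<bar> ^ length il
      * (?K * C)" for x
  proof -
    let ?z = "c *\<^sub>R x + a"
    have "(1 + norm x) ^ m * \<bar>iter_partial il f ?z\<bar>
        \<le> (?K * (1 + norm ?z) ^ m) * \<bar>iter_partial il f ?z\<bar>"
      by (intro mult_right_mono affine_weight assms) auto
    also have "\<dots> \<le> ?K * C"
      using mult_left_mono[OF C[of ?z] K] by (simp add: algebra_simps)
    finally have "\<bar>c\<bar> ^ length il * ((1 + norm x) ^ m * \<bar>iter_partial il f ?z\<bar>)
        \<le> \<bar>c\<bar> ^ length il * (?K * C)"
      by (intro mult_left_mono) auto
    then show ?thesis by (simp add: abs_mult power_abs algebra_simps)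
  qed
  then show "\<exists>C. \<forall>x. (1 + norm x) ^ m * \<bar>iter_partial il (\<lambda>x. f (c *\<^sub>R x + a)) x\<bar> \<le> C"
    by (subst iter_partial_affine) (use assms schwartz_smooth in auto)
qed (use assms in \<open>auto intro: smooth_affine schwartz_smooth\<close>)

lemma test_iter: "f \<in> test_functions \<Longrightarrow> iter_partial is f \<in> test_functions"
  by (induction "is") (auto simp: iter_partial_Cons test_partial)

lemma test_schwartz:
  assumes "f \<in> test_functions"
  shows "f \<in> schwartz"
proof (rule schwartzI)
  fix m il
  have t: "iter_partial il f \<in> test_functions" by (rule test_iter[OF assms])
  have b: "bounded {x. (1 + norm x) ^ m * iter_partial il f x \<noteq> 0}"
    using t by (auto simp: test_iff elim: bounded_subset)
  have "continuous_on UNIV (\<lambda>x. (1 + norm x) ^ m * iter_partial il f x)"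
    by (intro continuous_intros smooth_continuous[OF test_smooth[OF t]])
  from continuous_compact_bounded[OF this b]
  obtain C where "\<And>x. \<bar>(1 + norm x) ^ m * iter_partial il f x\<bar> \<le> C" by blast
  then show "\<exists>C. \<forall>x. (1 + norm x) ^ m * \<bar>iter_partial il f x\<bar> \<le> C"
    by (auto simp: abs_mult)
qed (rule test_smooth[OF assms])

section \<open>Continuity of tempered distributions\<close>

lemma seminorm_upper:
  assumes "f \<in> schwartz"
  shows "(1 + norm x) ^ m * \<bar>iter_partial is f x\<bar> \<le> schwartz_seminorm m is f"
proof -
  obtain C where "\<And>x. (1 + norm x) ^ m * \<bar>iter_partial is f x\<bar> \<le> C"
    using schwartzD[OF assms] by blast
  then have "bdd_above (range (\<lambda>x. (1 + norm x) ^ m * \<bar>iter_partial is f x\<bar>))"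
    by (auto simp: bdd_above_def)
  then show ?thesis unfolding schwartz_seminorm_def by (rule cSUP_upper[OF UNIV_I])
qed

lemma seminorm_least:
  "(\<And>x. (1 + norm x) ^ m * \<bar>iter_partial is f x\<bar> \<le> C) \<Longrightarrow> schwartz_seminorm m is f \<le> C"
  unfolding schwartz_seminorm_def by (rule cSUP_least) auto

lemma seminorm_triangle:
  assumes "f \<in> schwartz" "g \<in> schwartz" "h \<in> schwartz"
  shows "schwartz_seminorm m is (\<lambda>x. f x - h x)
    \<le> schwartz_seminorm m is (\<lambda>x. f x - g x) + schwartz_seminorm m is (\<lambda>x. g x - h x)"
proof (rule seminorm_least)
  fix x
  have 1: "iter_partial is (\<lambda>x. f x - h x) x
      = iter_partial is (\<lambda>x. f x - g x) x + iter_partial is (\<lambda>x. g x - h x) x"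
    using assms by (simp add: iter_partial_diff schwartz_smooth)
  have "(1 + norm x) ^ m * \<bar>iter_partial is (\<lambda>x. f x - h x) x\<bar>
      \<le> (1 + norm x) ^ m * (\<bar>iter_partial is (\<lambda>x. f x - g x) x\<bar> + \<bar>iter_partial is (\<lambda>x. g x
          - h x) x\<bar>)"
    unfolding 1 by (intro mult_left_mono) auto
  also have "\<dots> \<le> schwartz_seminorm m is (\<lambda>x. f x - g x) + schwartz_seminorm m is (\<lambda>x. g x - h x)"
    unfolding distrib_left by (intro add_mono seminorm_upper schwartz_minus assms)
  finally show "(1 + norm x) ^ m * \<bar>iter_partial is (\<lambda>x. f x - h x) x\<bar> \<le> \<dots>" .
qed

text \<open>The balls that generate the topology may be centred anywhere,
    but the triangle inequality puts a
  ball around the limit inside each of them; so convergence in all seminorms is convergence in the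
  topology.\<close>

lemma tempered_tendsto_seminorm:
  fixes u :: "(real^'n \<Rightarrow> real) \<Rightarrow> real"
  assumes u: "u \<in> tempered" and \<psi>: "\<psi> \<in> schwartz"
    and \<Psi>: "\<forall>\<^sub>F k in F. \<Psi> k \<in> schwartz"
    and lim: "\<And>m is. ((\<lambda>k. schwartz_seminorm m is (\<lambda>x. \<Psi> k x - \<psi> x)) \<longlongrightarrow> 0) F"
  shows "((\<lambda>k. u (\<Psi> k)) \<longlongrightarrow> u \<psi>) F"
proof -
  let ?B = "{{\<eta> \<in> schwartz. schwartz_seminorm m is (\<lambda>x. \<eta> x - \<psi> x) < e} | m is \<psi> e.
        (\<psi> :: real^'n \<Rightarrow> real) \<in> schwartz \<and> (e::real) > 0}"
  have near: "\<psi> \<in> U \<Longrightarrow> \<forall>\<^sub>F k in F. \<Psi> k \<in> U" if "generate_topology_on ?B U" for U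
    using that
  proof induction
    case (Int a b)
    then show ?case by (auto simp: eventually_conj_iff)
  next
    case (UN K)
    then obtain k where "k \<in> K" "\<forall>\<^sub>F i in F. \<Psi> i \<in> k" by blast
    then show ?case by (auto elim: eventually_mono)
  next
    case (Basis s)
    then obtain m il \<psi>' e where s: "s = {\<eta> \<in> schwartz. schwartz_seminorm m il (\<lambda>x. \<eta> x - \<psi>' x) < e}"
      and \<psi>': "\<psi>' \<in> schwartz" by blast
    have "e - schwartz_seminorm m il (\<lambda>x. \<psi> x - \<psi>' x) > 0"
      using Basis.prems s by simp
    then have "\<forall>\<^sub>F k in F. schwartz_seminorm m il (\<lambda>x. \<Psi> k x - \<psi> x)
        < e - schwartz_seminorm m il (\<lambda>x. \<psi> x - \<psi>' x)"
      using lim by (rule order_tendstoD(2)[rotated])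
    with \<Psi> show ?case
    proof eventually_elim
      case (elim k)
      then show ?case using seminorm_triangle[OF elim(1) \<psi> \<psi>', of m il] by (simp add: s)
    qed
  qed auto
  have top: "topspace schwartz_topology = (schwartz :: (real^'n \<Rightarrow> real) set)"
    unfolding schwartz_topology_def topology_generated_by_topspace
  proof (intro equalityI subsetI)
    fix f :: "real^'n \<Rightarrow> real" assume f: "f \<in> schwartz"
    have "schwartz_seminorm 0 [] (\<lambda>x. f x - f x) \<le> 0"
      by (rule seminorm_least) simp
    then have "f \<in> {\<eta> \<in> schwartz. schwartz_seminorm 0 [] (\<lambda>x. \<eta> x - f x) < 1}"
      using f by simp
    moreover have "{\<eta> \<in> schwartz. schwartz_seminorm 0 [] (\<lambda>x. \<eta> x - f x) < 1} \<in> ?B"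
      using f zero_less_one by blast
    ultimately show "f \<in> \<Union>?B" by blast
  qed auto
  have "limitin schwartz_topology \<Psi> \<psi> F"
    unfolding limitin_def top using \<psi> near
    by (auto simp: schwartz_topology_def openin_topology_generated_by_iff)
  moreover have "continuous_map schwartz_topology euclideanreal u"
    using u by (simp add: tempered_def)
  ultimately have "limitin euclideanreal (u \<circ> \<Psi>) (u \<psi>) F"
    by (meson continuous_map_limit)
  then show ?thesis by (simp add: o_def)
qed

text \<open>The form in which continuity is used: one common rate \<open>r\<close> for all seminorms, with
  constants that may depend on the seminorm.\<close>

lemma tempered_tendsto:
  assumes u: "u \<in> tempered" and \<psi>: "\<psi> \<in> schwartz"
    and \<Psi>: "\<forall>\<^sub>F k in F. \<Psi> k \<in> schwartz"
    and r: "(r \<longlongrightarrow> 0) F"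
    and bd: "\<And>m is. \<exists>C. \<forall>\<^sub>F k in F. \<forall>x. (1 + norm x) ^ m * \<bar>iter_partial is (\<lambda>x. \<Psi> k x
        - \<psi> x) x\<bar> \<le> C * r k"
  shows "((\<lambda>k. u (\<Psi> k)) \<longlongrightarrow> u \<psi>) F"
proof (rule tempered_tendsto_seminorm[OF u \<psi> \<Psi>])
  fix m il
  obtain C where C: "\<forall>\<^sub>F k in F. \<forall>x. (1 + norm x) ^ m * \<bar>iter_partial il (\<lambda>x. \<Psi> k x - \<psi> x) x\<bar>
      \<le> C * r k"
    using bd by blast
  have "((\<lambda>k. C * r k) \<longlongrightarrow> 0) F" using tendsto_mult_right_zero[OF r] by simp
  moreover have "\<forall>\<^sub>F k in F. norm (schwartz_seminorm m il (\<lambda>x. \<Psi> k x - \<psi> x)) \<le> C * r k"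
    using C \<Psi>
  proof eventually_elim
    case (elim k)
    have "schwartz_seminorm m il (\<lambda>x. \<Psi> k x - \<psi> x) \<le> C * r k"
      using elim by (intro seminorm_least) auto
    moreover have "0 \<le> (1 + norm 0) ^ m * \<bar>iter_partial il (\<lambda>x. \<Psi> k x - \<psi> x) 0\<bar>" by simp
    then have "0 \<le> schwartz_seminorm m il (\<lambda>x. \<Psi> k x - \<psi> x)"
      using seminorm_upper[OF schwartz_minus[OF elim(2) \<psi>]] order_trans by blast
    ultimately show ?case by simp
  qed
  ultimately show "((\<lambda>k. schwartz_seminorm m il (\<lambda>x. \<Psi> k x - \<psi> x)) \<longlongrightarrow> 0) F"
    by (rule Lim_null_comparison[rotated])
qed

section \<open>Cutting off Schwartz functions\<close>

lemma iter_partial_const: "is \<noteq> [] \<Longrightarrow> iter_partial is (\<lambda>x. c) = (\<lambda>x. 0)"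
  by (cases "is" rule: rev_cases) auto

lemma lipschitz_of_partials:
  fixes f :: "real^'n \<Rightarrow> real"
  assumes f: "\<And>x. f differentiable (at x)" and B: "\<And>i x. \<bar>partial_deriv i f x\<bar> \<le> B"
  shows "\<bar>f (x + h) - f x\<bar> \<le> real CARD('n) * B * norm h"
proof -
  obtain s where "f (x + 1 *\<^sub>R h) - f (x + 0 *\<^sub>R h)
      = (1 - 0) * (\<Sum>i\<in>UNIV. h $ i * partial_deriv i f (x + s *\<^sub>R h))"
    using MVT2[of 0 1 "\<lambda>s. f (x + s *\<^sub>R h)", OF _ has_real_derivative_along[OF f]] by auto
  then have "\<bar>f (x + h) - f x\<bar> = \<bar>\<Sum>i\<in>UNIV. h $ i * partial_deriv i f (x + s *\<^sub>R h)\<bar>" by simp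
  also have "\<dots> \<le> (\<Sum>i\<in>(UNIV::'n set). norm h * B)"
    by (intro order.trans[OF sum_abs] sum_mono)
       (auto simp: abs_mult intro!: mult_mono component_le_norm_cart B)
  finally show ?thesis by (simp add: algebra_simps)
qed

text \<open>The error $1-\sigma(x/k)$ of a rescaled cutoff does not tend to zero uniformly, but all its
  derivatives are of size $(1+|x|)/k$, and the growth in \<open>x\<close> is harmless after
  multiplication by a Schwartz function. The class is closed under partial derivatives, as the
  Leibniz rule needs.\<close>

definition vanishing_multiplier :: "(nat \<Rightarrow> real^'n \<Rightarrow> real) \<Rightarrow> bool" where
  "vanishing_multiplier X \<longleftrightarrow> (\<forall>k. smooth (X k)) \<and>
    (\<forall>is. \<exists>C. \<forall>k y. \<bar>iter_partial is (X k) y\<bar> \<le> C * (1 + norm y) / Suc k)"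

lemma vanishing_multiplier_partial:
  assumes "vanishing_multiplier X"
  shows "vanishing_multiplier (\<lambda>k. partial_deriv i (X k))"
  unfolding vanishing_multiplier_def
proof (intro conjI allI)
  fix il
  show "\<exists>C. \<forall>k y. \<bar>iter_partial il (partial_deriv i (X k)) y\<bar> \<le> C * (1 + norm y) / Suc k"
    using assms[unfolded vanishing_multiplier_def, THEN conjunct2, rule_format, of "il @ [i]"]
        by simp
qed (use assms in \<open>auto simp: vanishing_multiplier_def smooth_partial\<close>)

text \<open>Without derivatives one more power of the weight on $\psi$ absorbs the growth of the
    multiplier.
  A derivative falls on either factor, and both products are again of the same kind.\<close>

lemma vanishing_multiplier_decay:
  assumes "\<psi> \<in> schwartz" "vanishing_multiplier X"
  shows "\<exists>C. \<forall>k y. (1 + norm y) ^ m * \<bar>iter_partial is (\<lambda>x. \<psi> x * X k x) y\<bar> \<le> C / Suc k"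
  using assms
proof (induction "is" arbitrary: \<psi> X rule: rev_induct)
  case Nil
  obtain C where C: "C \<ge> 0" "\<And>x. (1 + norm x) ^ Suc m * \<bar>iter_partial [] \<psi> x\<bar> \<le> C"
    using schwartzD[OF Nil(1)] by blast
  obtain D where D: "\<And>k y. \<bar>iter_partial [] (X k) y\<bar> \<le> D * (1 + norm y) / Suc k"
    using Nil(2) unfolding vanishing_multiplier_def by blast
  have D0: "D \<ge> 0" using D[of 0 0] by simp
  have "(1 + norm y) ^ m * \<bar>\<psi> y * X k y\<bar> \<le> (C * D) / Suc k" for k y
  proof -
    have "(1 + norm y) ^ m * \<bar>\<psi> y * X k y\<bar> \<le> ((1 + norm y) ^ m * \<bar>\<psi> y\<bar>) * (D * (1
        + norm y) / Suc k)"
      using D[of k y] mult_left_mono[of "\<bar>X k y\<bar>" "D * (1 + norm y) / Suc k" "(1 + norm y) ^ m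
          * \<bar>\<psi> y\<bar>"]
      by (simp add: abs_mult mult.assoc)
    also have "\<dots> = ((1 + norm y) ^ Suc m * \<bar>\<psi> y\<bar>) * (D / Suc k)" by simp
    also have "\<dots> \<le> C * (D / Suc k)"
      using C(2)[of y] D0 by (intro mult_right_mono) auto
    finally show ?thesis by simp
  qed
  then show ?case by auto
next
  case (snoc i il)
  have sm: "smooth \<psi>" "\<And>k. smooth (X k)"
    using snoc.prems by (auto simp: schwartz_smooth vanishing_multiplier_def)
  obtain C where C: "\<And>k y. (1 + norm y) ^ m * \<bar>iter_partial il (\<lambda>x. partial_deriv i \<psi> x
      * X k x) y\<bar> \<le> C / Suc k"
    using snoc.IH[OF schwartz_partial[OF snoc.prems(1)] snoc.prems(2)] by blast
  obtain D where D: "\<And>k y. (1 + norm y) ^ m * \<bar>iter_partial il (\<lambda>x. \<psi> x * partial_deriv i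
      (X k) x) y\<bar> \<le> D / Suc k"
    using snoc.IH[OF snoc.prems(1) vanishing_multiplier_partial[OF snoc.prems(2)]] by blast
  have "(1 + norm y) ^ m * \<bar>iter_partial (il @ [i]) (\<lambda>x. \<psi> x * X k x) y\<bar> \<le> (C + D) / Suc k" for k y
  proof -
    have "partial_deriv i (\<lambda>x. \<psi> x * X k x)
        = (\<lambda>x. partial_deriv i \<psi> x * X k x + \<psi> x * partial_deriv i (X k) x)"
      by (rule ext) (simp add: partial_deriv_mult smooth_diff sm)
    then have eq: "iter_partial (il @ [i]) (\<lambda>x. \<psi> x * X k x)
      = (\<lambda>y. iter_partial il (\<lambda>x. partial_deriv i \<psi> x * X k x) y
           + iter_partial il (\<lambda>x. \<psi> x * partial_deriv i (X k) x) y)"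
      by (simp add: iter_partial_add smooth_mult smooth_partial sm)
    have "(1 + norm y) ^ m * \<bar>iter_partial (il @ [i]) (\<lambda>x. \<psi> x * X k x) y\<bar>
      \<le> (1 + norm y) ^ m * (\<bar>iter_partial il (\<lambda>x. partial_deriv i \<psi> x * X k x) y\<bar>
         + \<bar>iter_partial il (\<lambda>x. \<psi> x * partial_deriv i (X k) x) y\<bar>)"
      unfolding eq by (intro mult_left_mono) auto
    also have "\<dots> \<le> C / Suc k + D / Suc k"
      unfolding distrib_left by (intro add_mono C D)
    finally show ?thesis by (simp add: add_divide_distrib)
  qed
  then show ?case by blast
qed

lemma vanishing_multiplier_cutoff:
  "vanishing_multiplier (\<lambda>k (x::real^'n). 1 - cutoff ((1 / Suc k) *\<^sub>R x))"
  unfolding vanishing_multiplier_def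
proof (intro conjI allI)
  have sc: "smooth (\<lambda>x::real^'n. cutoff ((1 / Suc k) *\<^sub>R x))" for k
    using smooth_affine[OF test_smooth[OF cutoff_test], of "1 / Suc k" 0] by simp
  then show "smooth (\<lambda>x::real^'n. 1 - cutoff ((1 / Suc k) *\<^sub>R x))" for k
    by (intro smooth_minus smooth_const)
  fix il :: "'n list"
  show "\<exists>C. \<forall>k (y::real^'n). \<bar>iter_partial il (\<lambda>x. 1 - cutoff ((1 / Suc k) *\<^sub>R x)) y\<bar> \<le> C * (1
      + norm y) / Suc k"
  proof (cases "il = []")
    case True
    have "\<exists>B. \<forall>i (x::real^'n). \<bar>partial_deriv i cutoff x\<bar> \<le> B"
    proof -
      have "\<forall>i. \<exists>B. \<forall>x::real^'n. \<bar>partial_deriv i cutoff x\<bar> \<le> B"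
        using test_bounded[OF test_partial[OF cutoff_test]] by blast
      then obtain b where b: "\<And>i. \<forall>x::real^'n. \<bar>partial_deriv i cutoff x\<bar> \<le> b i" by metis
      have "\<bar>partial_deriv i cutoff x\<bar> \<le> (\<Sum>i\<in>UNIV. b i)" for i and x :: "real^'n"
      proof -
        have "b j \<ge> 0" for j by (rule order_trans[OF abs_ge_zero b[rule_format]])
        then have "b i \<le> (\<Sum>i\<in>UNIV. b i)" by (intro member_le_sum) auto
        then show ?thesis using b[of i] order_trans by blast
      qed
      then show ?thesis by blast
    qed
    then obtain B where B: "\<And>i (x::real^'n). \<bar>partial_deriv i cutoff x\<bar> \<le> B" by blast
    have B0: "B \<ge> 0" by (rule order_trans[OF abs_ge_zero B])
    have "\<bar>1 - cutoff ((1 / Suc k) *\<^sub>R y)\<bar> \<le> (real CARD('n) * B) * (1 + norm y) / Suc k" for k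
        and y :: "real^'n"
    proof -
      have "\<bar>cutoff (0 + (1 / Suc k) *\<^sub>R y) - cutoff (0 :: real^'n)\<bar> \<le> real CARD('n) * B
          * norm ((1 / Suc k) *\<^sub>R y)"
        by (intro lipschitz_of_partials[of cutoff B 0] smooth_diff test_smooth cutoff_test B)
      also have "\<dots> = (real CARD('n) * B / Suc k) * norm y" by simp
      also have "\<dots> \<le> (real CARD('n) * B / Suc k) * (1 + norm y)"
        using B0 by (intro mult_left_mono) auto
      finally show ?thesis by (simp add: cutoff_0 abs_minus_commute)
    qed
    then show ?thesis using True by auto
  next
    case False
    obtain B where B: "\<And>x::real^'n. \<bar>iter_partial il cutoff x\<bar> \<le> B"
      using test_bounded[OF test_iter[OF cutoff_test]] by blast
    have B0: "B \<ge> 0" by (rule order_trans[OF abs_ge_zero B])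
    have "\<bar>iter_partial il (\<lambda>x. 1 - cutoff ((1 / Suc k) *\<^sub>R x)) y\<bar> \<le> B * (1 + norm y) / Suc k"
        for k and y :: "real^'n"
    proof -
      have "iter_partial il (\<lambda>x. 1 - cutoff ((1 / Suc k) *\<^sub>R x)) y
          = - ((1 / Suc k) ^ length il * iter_partial il cutoff ((1 / Suc k) *\<^sub>R y))"
        using iter_partial_affine[OF test_smooth[OF cutoff_test], of il "1 / Suc k" 0]
        unfolding iter_partial_diff[OF smooth_const sc] iter_partial_const[OF False] by simp
      then have "\<bar>iter_partial il (\<lambda>x. 1 - cutoff ((1 / Suc k) *\<^sub>R x)) y\<bar>
          = (1 / Suc k) ^ length il * \<bar>iter_partial il cutoff ((1 / Suc k) *\<^sub>R y)\<bar>"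
        by (simp add: abs_mult)
      also have "\<dots> \<le> (1 / Suc k) ^ 1 * (B * (1 + norm y))"
      proof (intro mult_mono power_decreasing)
        show "1 \<le> length il" using False by (cases il) auto
        have "\<bar>iter_partial il cutoff ((1 / Suc k) *\<^sub>R y)\<bar> \<le> B * 1" using B by simp
        also have "\<dots> \<le> B * (1 + norm y)" using B0 by (intro mult_left_mono) auto
        finally show "\<bar>iter_partial il cutoff ((1 / Suc k) *\<^sub>R y)\<bar> \<le> B * (1 + norm y)" .
      qed (auto)
      finally show ?thesis by simp
    qed
    then show ?thesis by blast
  qed
qed

lemma cutoff_converges:
  fixes \<psi> :: "real^'n \<Rightarrow> real"
  assumes "\<psi> \<in> schwartz"
  shows "\<exists>C. \<forall>k y. (1 + norm y) ^ m * \<bar>iter_partial is (\<lambda>x. \<psi> x * cutoff ((1 / Suc k) *\<^sub>R x)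
      - \<psi> x) y\<bar> \<le> C / Suc k"
proof -
  obtain C where C: "\<And>k y. (1 + norm y) ^ m * \<bar>iter_partial is (\<lambda>x. \<psi> x * (1 - cutoff
      ((1 / Suc k) *\<^sub>R x))) y\<bar> \<le> C / Suc k"
    using vanishing_multiplier_decay[OF assms vanishing_multiplier_cutoff] by blast
  have "iter_partial is (\<lambda>x. \<psi> x * cutoff ((1 / Suc k) *\<^sub>R x) - \<psi> x) y
      = (-1) * iter_partial is (\<lambda>x. \<psi> x * (1 - cutoff ((1 / Suc k) *\<^sub>R x))) y" for k y
  proof -
    have "smooth (\<lambda>x::real^'n. 1 - cutoff ((1 / Suc k) *\<^sub>R x))"
      using vanishing_multiplier_cutoff unfolding vanishing_multiplier_def by blast
    then have "smooth (\<lambda>x. \<psi> x * (1 - cutoff ((1 / Suc k) *\<^sub>R x)))"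
      by (rule smooth_mult[OF schwartz_smooth[OF assms]])
    from iter_partial_cmult[OF this, of "is" "-1"] show ?thesis
      by (simp add: algebra_simps)
  qed
  then show ?thesis using C by (intro exI[of _ C]) simp
qed

lemma cutoff_mult_test: "smooth \<psi> \<Longrightarrow> (\<lambda>x. \<psi> x * cutoff ((1 / Suc k) *\<^sub>R x)) \<in> test_functions"
  using test_mult[of \<psi> "\<lambda>x. cutoff ((1 / Suc k) *\<^sub>R x + 0)"] test_affine[OF cutoff_test,
      of "1 / Suc k" 0]
  by simp

section \<open>Regularisation of a tempered distribution\<close>

lemma iter_partial_commute:
  assumes "smooth f"
  shows "iter_partial is (partial_deriv i f) = partial_deriv i (iter_partial is f)"
proof (induction "is")
  case (Cons j il)
  then show ?case
    using partial_deriv_commute[OF smooth_iter[OF assms], of j i il] by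
        (simp add: iter_partial_Cons)
qed simp

lemma schwartz_iter: "f \<in> schwartz \<Longrightarrow> iter_partial is f \<in> schwartz"
  by (induction "is") (auto simp: iter_partial_Cons schwartz_partial)

lemma schwartz_second_partials:
  fixes f :: "real^'n \<Rightarrow> real"
  assumes "f \<in> schwartz"
  obtains C where "C \<ge> 0" "\<And>i j x. (1 + norm x) ^ m * \<bar>partial_deriv j (partial_deriv i f) x\<bar> \<le> C"
proof -
  have "\<forall>p. \<exists>C. \<forall>x. (1 + norm x) ^ m * \<bar>iter_partial [snd p, fst p] f x\<bar> \<le> C"
    using schwartzD[OF assms] by metis
  then obtain c where c: "\<And>p x. (1 + norm x) ^ m * \<bar>iter_partial [snd p, fst p] f x\<bar> \<le> c p" by metis
  have "(1 + norm x) ^ m * \<bar>partial_deriv j (partial_deriv i f) x\<bar> \<le> (\<Sum>p\<in>UNIV. \<bar>c p\<bar>)" for i j x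
  proof -
    have "(1 + norm x) ^ m * \<bar>partial_deriv j (partial_deriv i f) x\<bar> \<le> \<bar>c (i, j)\<bar>"
      using c[of x "(i, j)"] by (simp add: iter_partial_Cons)
    also have "\<dots> \<le> (\<Sum>p\<in>UNIV. \<bar>c p\<bar>)" by (intro member_le_sum) auto
    finally show ?thesis .
  qed
  then show ?thesis using that[of "\<Sum>p\<in>UNIV. \<bar>c p\<bar>"] by (simp add: sum_nonneg)
qed

text \<open>Two applications of the mean value theorem along the segment from \<open>z\<close> to \<open>z +
  h\<close>. The second derivatives are taken at other points of the segment, where the weight
  differs by a factor of at most $2^m$ because \<open>h\<close> has length at most
  \<open>1\<close>.\<close>

lemma schwartz_taylor:
  fixes g :: "real^'n \<Rightarrow> real"
  assumes "g \<in> schwartz"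
  shows "\<exists>C\<ge>0. \<forall>z h. norm h \<le> 1 \<longrightarrow>
    (1 + norm z) ^ m * \<bar>g (z + h) - g z - (\<Sum>i\<in>UNIV. h $ i * partial_deriv i g z)\<bar> \<le> C * (norm h)\<^sup>2"
proof -
  let ?N = "real CARD('n)"
  obtain C where C: "C \<ge> 0" "\<And>i j x. (1 + norm x) ^ m * \<bar>partial_deriv j (partial_deriv i g) x\<bar> \<le> C"
    using schwartz_second_partials[OF assms] by blast
  have sm: "smooth g" by (rule schwartz_smooth[OF assms])
  have wt: "(1 + norm z) ^ m * \<bar>partial_deriv j (partial_deriv i g) (z + s *\<^sub>R h)\<bar> \<le> 2 ^ m * C"
    if "norm h \<le> 1" "0 < s" "s < 1" for z h s i j
  proof -
    let ?x = "z + s *\<^sub>R h"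
    have "norm z = norm (?x - s *\<^sub>R h)" by simp
    also have "\<dots> \<le> norm ?x + norm (s *\<^sub>R h)" by (rule norm_triangle_ineq4)
    finally have "norm z \<le> norm ?x + norm (s *\<^sub>R h)" .
    moreover have "norm (s *\<^sub>R h) \<le> 1" using that mult_mono[of s 1 "norm h" 1] by simp
    ultimately have "1 + norm z \<le> 2 * (1 + norm ?x)" using norm_ge_zero[of ?x] by argo
    then have "(1 + norm z) ^ m \<le> (2 * (1 + norm ?x)) ^ m" by (intro power_mono) auto
    then have "(1 + norm z) ^ m \<le> 2 ^ m * (1 + norm ?x) ^ m" unfolding power_mult_distrib .
    then have "(1 + norm z) ^ m * \<bar>partial_deriv j (partial_deriv i g) ?x\<bar>
        \<le> (2 ^ m * (1 + norm ?x) ^ m) * \<bar>partial_deriv j (partial_deriv i g) ?x\<bar>"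
      by (rule mult_right_mono) auto
    also have "\<dots> = 2 ^ m * ((1 + norm ?x) ^ m * \<bar>partial_deriv j (partial_deriv i g) ?x\<bar>)" by simp
    also have "\<dots> \<le> 2 ^ m * C" by (intro mult_left_mono C) auto
    finally show ?thesis .
  qed
  have "(1 + norm z) ^ m * \<bar>g (z + h) - g z - (\<Sum>i\<in>UNIV. h $ i * partial_deriv i g z)\<bar>
      \<le> (?N * ?N * (2 ^ m * C)) * (norm h)\<^sup>2" if h: "norm h \<le> 1" for z h
  proof -
    obtain s where s: "0 < s" "s < 1" and "g (z + 1 *\<^sub>R h) - g (z + 0 *\<^sub>R h)
      = (1 - 0) * (\<Sum>i\<in>UNIV. h $ i * partial_deriv i g (z + s *\<^sub>R h))"
      using MVT2[of 0 1 "\<lambda>s. g (z + s *\<^sub>R h)",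
          OF _ has_real_derivative_along[OF smooth_diff[OF sm]]] by auto
    then have 1: "g (z + h) - g z - (\<Sum>i\<in>UNIV. h $ i * partial_deriv i g z)
      = (\<Sum>i\<in>UNIV. h $ i * (partial_deriv i g (z + s *\<^sub>R h) - partial_deriv i g z))"
      by (simp add: sum_subtractf algebra_simps)
    have 2: "(1 + norm z) ^ m * \<bar>partial_deriv i g (z + s *\<^sub>R h) - partial_deriv i g z\<bar>
        \<le> ?N * (2 ^ m * C) * norm h" for i
    proof -
      obtain t where t: "0 < t" "t < s" and
        "partial_deriv i g (z + s *\<^sub>R h) - partial_deriv i g (z + 0 *\<^sub>R h)
        = (s - 0) * (\<Sum>j\<in>UNIV. h $ j * partial_deriv j (partial_deriv i g) (z + t *\<^sub>R h))"
        using MVT2[of 0 s "\<lambda>s. partial_deriv i g (z + s *\<^sub>R h)", OF _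
            has_real_derivative_along[OF smooth_diff[OF smooth_partial[OF sm]]]] s by auto
      then have "\<bar>partial_deriv i g (z + s *\<^sub>R h) - partial_deriv i g z\<bar>
          = s * \<bar>\<Sum>j\<in>UNIV. h $ j * partial_deriv j (partial_deriv i g) (z + t *\<^sub>R h)\<bar>"
        using s by (simp add: abs_mult)
      also have "\<dots> \<le> 1 * (\<Sum>j\<in>UNIV. norm h * \<bar>partial_deriv j (partial_deriv i g) (z + t *\<^sub>R h)\<bar>)"
        using s by (intro mult_mono order.trans[OF sum_abs] sum_mono)
           (auto simp: abs_mult intro!: mult_right_mono component_le_norm_cart)
      finally have "(1 + norm z) ^ m * \<bar>partial_deriv i g (z + s *\<^sub>R h) - partial_deriv i g z\<bar>
          \<le> (1 + norm z) ^ m * (\<Sum>j\<in>UNIV. norm h * \<bar>partial_deriv j (partial_deriv i g) (z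
              + t *\<^sub>R h)\<bar>)"
        by (intro mult_left_mono) auto
      also have "\<dots> = (\<Sum>j\<in>UNIV. norm h * ((1 + norm z) ^ m * \<bar>partial_deriv j
          (partial_deriv i g) (z + t *\<^sub>R h)\<bar>))"
        by (simp add: sum_distrib_left algebra_simps)
      also have "\<dots> \<le> (\<Sum>j\<in>(UNIV::'n set). norm h * (2 ^ m * C))"
        using s t h by (intro sum_mono mult_left_mono wt) auto
      finally show ?thesis by (simp add: algebra_simps)
    qed
    have "(1 + norm z) ^ m * \<bar>\<Sum>i\<in>UNIV. h $ i * (partial_deriv i g (z + s *\<^sub>R h)
        - partial_deriv i g z)\<bar>
      \<le> (1 + norm z) ^ m * (\<Sum>i\<in>UNIV. norm h * \<bar>partial_deriv i g (z + s *\<^sub>R h)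
          - partial_deriv i g z\<bar>)"
      by (intro mult_left_mono order.trans[OF sum_abs] sum_mono)
         (auto simp: abs_mult intro!: mult_right_mono component_le_norm_cart)
    also have "\<dots> = (\<Sum>i\<in>UNIV. norm h * ((1 + norm z) ^ m * \<bar>partial_deriv i g (z + s *\<^sub>R h)
        - partial_deriv i g z\<bar>))"
      by (simp add: sum_distrib_left algebra_simps)
    also have "\<dots> \<le> (\<Sum>i\<in>(UNIV::'n set). norm h * (?N * (2 ^ m * C) * norm h))"
      by (intro sum_mono mult_left_mono 2) auto
    finally show ?thesis unfolding 1 by (simp add: power2_eq_square algebra_simps)
  qed
  then show ?thesis using C(1) by (intro exI[of _ "?N * ?N * (2 ^ m * C)"]) auto
qed

text \<open>With $c=-1/R$ this is the convolution of \<open>u\<close> with the dilation $\theta_R$, seen at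
  unit scale: it equals $R^N(u*\theta_R)(Rx)$.\<close>

definition regularize :: "((real^'n \<Rightarrow> real) \<Rightarrow> real) \<Rightarrow> real \<Rightarrow>
    (real^'n \<Rightarrow> real) \<Rightarrow> real^'n \<Rightarrow> real" where
  "regularize u c \<theta> x = u (\<lambda>y. \<theta> (c *\<^sub>R y + x))"

lemma tempered_add: "u \<in> tempered \<Longrightarrow> \<psi> \<in> schwartz \<Longrightarrow> \<eta> \<in> schwartz \<Longrightarrow> u (\<lambda>x. \<psi> x + \<eta> x) = u \<psi> + u \<eta>"
  and tempered_cmult: "u \<in> tempered \<Longrightarrow> \<psi> \<in> schwartz \<Longrightarrow> u (\<lambda>x. c * \<psi> x) = c * u \<psi>"
  by (auto simp: tempered_def)

lemma tempered_zero: "u \<in> tempered \<Longrightarrow> u (\<lambda>x. 0) = 0"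
  using tempered_cmult[of u "\<lambda>x. 0" 0] schwartz_zero by simp

lemma tempered_minus: "u \<in> tempered \<Longrightarrow> \<psi> \<in> schwartz \<Longrightarrow> \<eta> \<in> schwartz \<Longrightarrow> u (\<lambda>x. \<psi> x - \<eta> x) = u \<psi> - u \<eta>"
  using tempered_add[of u \<psi> "\<lambda>x. (-1) * \<eta> x"] tempered_cmult[of u \<eta> "-1"] schwartz_cmult[of \<eta> "-1"]
  by simp

lemma tempered_sum:
  assumes "u \<in> tempered" "\<And>i. i \<in> I \<Longrightarrow> f i \<in> schwartz"
  shows "u (\<lambda>x. \<Sum>i\<in>I. f i x) = (\<Sum>i\<in>I. u (f i))"
  using assms(2)
  by (induction I rule: infinite_finite_induct)
     (auto simp: tempered_zero[OF assms(1)] tempered_add[OF assms(1)] schwartz_sum)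

text \<open>By the second order Taylor estimate the difference quotients of the translates of $\theta$
  converge in every Schwartz seminorm, and \<open>u\<close> is continuous and linear. In
  particular the regularisation has derivatives of all orders, which are regularisations of the
  derivatives of $\theta$.\<close>

lemma regularize_has_derivative:
  fixes u :: "(real^'n \<Rightarrow> real) \<Rightarrow> real"
  assumes u: "u \<in> tempered" and \<theta>: "\<theta> \<in> schwartz" and c: "c \<noteq> 0"
  shows "(regularize u c \<theta> has_derivative
    (\<lambda>h. \<Sum>i\<in>UNIV. h $ i * regularize u c (partial_deriv i \<theta>) x)) (at x)"
proof -
  define D where "D = (\<lambda>h::real^'n. \<Sum>i\<in>UNIV. h $ i * regularize u c (partial_deriv i \<theta>) x)"
  define Q where "Q g h z = g (z + h) - g z - (\<Sum>i\<in>UNIV. h $ i * partial_deriv i g z)"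
    for g :: "real^'n \<Rightarrow> real" and h z
  define \<Psi> where "\<Psi> h y = (1 / norm h) * Q \<theta> h (c *\<^sub>R y + x)" for h y
  have aff: "(\<lambda>y. g (c *\<^sub>R y + x + a)) \<in> schwartz" if "g \<in> schwartz" for g a
    using schwartz_affine[OF that c, of "x + a"] by (simp add: add.assoc)
  note aff0 = schwartz_affine[OF _ c, of _ x]
  have QS: "(\<lambda>z. Q g h z) \<in> schwartz" if "g \<in> schwartz" for g h
    unfolding Q_def
    using schwartz_affine[OF that, of 1 h]
    by (intro schwartz_minus schwartz_sum schwartz_cmult schwartz_partial that) auto
  have \<Psi>S: "\<Psi> h \<in> schwartz" for h
    unfolding \<Psi>_def[abs_def] by (intro schwartz_cmult schwartz_affine[OF QS[OF \<theta>] c])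
  have "u (\<Psi> h) = (regularize u c \<theta> (x + h) - regularize u c \<theta> x - D h) / norm h" for h
  proof -
    have "u (\<Psi> h) = 1 / norm h * u (\<lambda>y. Q \<theta> h (c *\<^sub>R y + x))"
      unfolding \<Psi>_def by (intro tempered_cmult u schwartz_affine[OF QS[OF \<theta>] c])
    also have "u (\<lambda>y. Q \<theta> h (c *\<^sub>R y + x))
        = regularize u c \<theta> (x + h) - regularize u c \<theta> x
          - u (\<lambda>y. \<Sum>i\<in>UNIV. h $ i * partial_deriv i \<theta> (c *\<^sub>R y + x))"
      unfolding Q_def regularize_def
      by (subst tempered_minus[OF u],
          (intro schwartz_minus schwartz_sum schwartz_cmult aff aff0 schwartz_partial \<theta>)+)
         (subst tempered_minus[OF u],
             auto intro: aff aff0 \<theta> schwartz_affine[OF \<theta> c] simp: add.assoc)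
    also have "u (\<lambda>y. \<Sum>i\<in>UNIV. h $ i * partial_deriv i \<theta> (c *\<^sub>R y + x)) = D h"
      unfolding D_def regularize_def
      by (subst tempered_sum[OF u])
         (auto intro!: schwartz_cmult aff0 schwartz_partial \<theta> sum.cong tempered_cmult[OF u])
    finally show ?thesis by simp
  qed
  moreover have "((\<lambda>h. u (\<Psi> h)) \<longlongrightarrow> u (\<lambda>x. 0)) (at 0)"
  proof (rule tempered_tendsto[OF u schwartz_zero])
    show "(norm \<longlongrightarrow> 0) (at (0::real^'n))" by (rule tendsto_norm_zero) (rule tendsto_ident_at)
    fix m :: nat and il :: "'n list"
    let ?g = "iter_partial il \<theta>"
    let ?K = "(1 + (1 + norm x) / \<bar>c\<bar>) ^ m"
    have K: "?K \<ge> 0" by (intro zero_le_power) auto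
    obtain C where C: "C \<ge> 0" "\<And>z h. norm h \<le> 1 \<Longrightarrow> (1 + norm z) ^ m * \<bar>Q ?g h z\<bar> \<le> C * (norm h)\<^sup>2"
      using schwartz_taylor[OF schwartz_iter[OF \<theta>], of m il] unfolding Q_def by blast
    have iQ: "iter_partial il (Q \<theta> h) z = Q ?g h z" for h z
    proof -
      have sh: "(\<lambda>z. \<theta> (z + h)) \<in> schwartz" using schwartz_affine[OF \<theta>, of 1 h] by simp
      have "iter_partial il (\<lambda>z. \<theta> (z + h)) z = ?g (z + h)"
        using iter_partial_affine[OF schwartz_smooth[OF \<theta>], of il 1 h] by simp
      moreover have "iter_partial il (Q \<theta> h) z = iter_partial il (\<lambda>z. \<theta> (z + h)) z
          - iter_partial il \<theta> z
          - (\<Sum>i\<in>UNIV. h $ i * iter_partial il (partial_deriv i \<theta>) z)"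
        unfolding Q_def[abs_def]
        by (simp add: iter_partial_diff iter_partial_sum iter_partial_cmult schwartz_smooth
            sh \<theta> schwartz_minus schwartz_sum schwartz_cmult schwartz_partial)
      ultimately show ?thesis
        by (simp add: Q_def iter_partial_commute[OF schwartz_smooth[OF \<theta>]])
    qed
    have i\<Psi>: "iter_partial il (\<Psi> h) y = (1 / norm h) * (c ^ length il * Q ?g h (c *\<^sub>R y + x))"
        for h y
      unfolding \<Psi>_def[abs_def]
      by (subst iter_partial_cmult)
         (auto intro: schwartz_smooth schwartz_affine[OF QS[OF \<theta>] c]
            simp: iter_partial_affine[OF schwartz_smooth[OF QS[OF \<theta>]]] iQ)
    have "(1 + norm y) ^ m * \<bar>iter_partial il (\<Psi> h) y\<bar> \<le> \<bar>c\<bar> ^ length il * ?K * C * norm h"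
      if h: "norm h \<le> 1" "h \<noteq> 0" for h y
    proof -
      let ?z = "c *\<^sub>R y + x"
      have "(1 + norm y) ^ m * \<bar>Q ?g h ?z\<bar> \<le> (?K * (1 + norm ?z) ^ m) * \<bar>Q ?g h ?z\<bar>"
        by (intro mult_right_mono affine_weight c) auto
      also have "\<dots> \<le> ?K * (C * (norm h)\<^sup>2)"
        using mult_left_mono[OF C(2)[OF h(1), of ?z] K] by (simp only: mult.assoc)
      finally have "(\<bar>c\<bar> ^ length il / norm h) * ((1 + norm y) ^ m * \<bar>Q ?g h ?z\<bar>)
          \<le> (\<bar>c\<bar> ^ length il / norm h) * (?K * (C * (norm h)\<^sup>2))"
        by (intro mult_left_mono) auto
      then show ?thesis using h by (simp add: i\<Psi> abs_mult power_abs power2_eq_square algebra_simps)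
    qed
    moreover have "\<forall>\<^sub>F h::real^'n in at 0. norm h \<le> 1 \<and> h \<noteq> 0"
      by (auto simp: eventually_at intro!: exI[of _ 1])
    ultimately show "\<exists>C. \<forall>\<^sub>F h in at 0. \<forall>y. (1 + norm y) ^ m * \<bar>iter_partial il (\<lambda>x. \<Psi> h x
        - 0) y\<bar> \<le> C * norm h"
      by (intro exI[of _ "\<bar>c\<bar> ^ length il * ?K * C"]) (auto elim!: eventually_mono)
  qed (use \<Psi>S in auto)
  ultimately have "((\<lambda>h. (regularize u c \<theta> (x + h) - regularize u c \<theta> x - D h) / norm h) \<longlongrightarrow> 0)
      (at 0)"
    by (simp add: tempered_zero[OF u])
  moreover have "bounded_linear D"
    unfolding D_def
    by (intro bounded_linear_sum)
       (rule bounded_linear_compose[OF bounded_linear_mult_left bounded_linear_vec_nth])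
  ultimately have "(regularize u c \<theta> has_derivative D) (at x)"
    unfolding has_derivative_at using tendsto_norm_zero by fastforce
  then show ?thesis by (simp add: D_def)
qed

lemma regularize_differentiable:
  "u \<in> tempered \<Longrightarrow> \<theta> \<in> schwartz \<Longrightarrow> c \<noteq> 0 \<Longrightarrow> regularize u c \<theta> differentiable (at x)"
  using regularize_has_derivative differentiableI by blast

lemma regularize_partial:
  assumes "u \<in> tempered" "\<theta> \<in> schwartz" "c \<noteq> 0"
  shows "partial_deriv i (regularize u c \<theta>) = regularize u c (partial_deriv i \<theta>)"
proof
  fix x
  have "partial_deriv i (regularize u c \<theta>) x
      = (\<Sum>j\<in>UNIV. axis i 1 $ j * regularize u c (partial_deriv j \<theta>) x)"
    by (rule partial_deriv_eq[OF regularize_has_derivative[OF assms]])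
  also have "\<dots> = (\<Sum>j\<in>UNIV. if j = i then regularize u c (partial_deriv j \<theta>) x else 0)"
    by (rule sum.cong) (auto simp: axis_def)
  finally show "partial_deriv i (regularize u c \<theta>) x = regularize u c (partial_deriv i \<theta>) x" by simp
qed

section \<open>Integration by parts\<close>

lemma integral_lebesgue_borel:
  fixes f :: "'a::euclidean_space \<Rightarrow> real"
  shows "f \<in> borel_measurable borel \<Longrightarrow> (LINT x|lebesgue. f x) = (LINT x|lborel. f x)"
  by (rule integral_completion) simp

lemma integrable_lebesgue_borel:
  fixes f :: "'a::euclidean_space \<Rightarrow> real"
  shows "f \<in> borel_measurable borel \<Longrightarrow> integrable lebesgue f \<longleftrightarrow> integrable lborel f"
  by (rule integrable_completion) simp

lemma integrable_bounded_support:
  fixes f :: "'a::euclidean_space \<Rightarrow> real"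
  assumes m: "f \<in> borel_measurable lebesgue" and bd: "\<And>x. \<bar>f x\<bar> \<le> B"
    and s: "bounded {x. f x \<noteq> 0}"
  shows "integrable lebesgue f"
proof -
  obtain b where "\<And>x. f x \<noteq> 0 \<Longrightarrow> norm x \<le> b"
    using s by (auto simp: bounded_iff)
  then obtain a where a: "{x. f x \<noteq> 0} \<subseteq> cball 0 a" by (auto intro: that[of b])
  have "integrable lebesgue (\<lambda>x. indicator (cball 0 a) x * B)"
    by (intro integrable_mult_left integrable_real_indicator)
        (auto simp: emeasure_lborel_cball_finite[unfolded infinity_ennreal_def])
  then show ?thesis
    by (rule Bochner_Integration.integrable_bound[OF _ m])
       (use a bd abs_ge_self in \<open>auto simp: indicator_def intro!: AE_I2 order_trans[OF bd]\<close>)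
qed

lemma integrable_continuous_support:
  fixes f :: "'a::euclidean_space \<Rightarrow> real"
  assumes "continuous_on UNIV f" "bounded {x. f x \<noteq> 0}"
  shows "integrable lebesgue f"
proof -
  obtain B where "\<And>x. \<bar>f x\<bar> \<le> B" using continuous_compact_bounded[OF assms] by blast
  moreover have "f \<in> borel_measurable lebesgue"
    by (intro measurable_completion) (use borel_measurable_continuous_onI[OF assms(1)] in simp)
  ultimately show ?thesis using assms(2) integrable_bounded_support by blast
qed

lemma integrable_test: "f \<in> test_functions \<Longrightarrow> integrable lebesgue f"
  by (intro integrable_continuous_support) (auto simp: test_iff smooth_continuous)

lemma integral_affine:
  fixes g :: "'a::euclidean_space \<Rightarrow> real"
  assumes g: "g \<in> borel_measurable borel" and c: "c \<noteq> 0"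
  shows "(LINT x|lebesgue. g x) = \<bar>c\<bar> ^ DIM('a) * (LINT x|lebesgue. g (t + c *\<^sub>R x))"
proof -
  have "(LINT x|lborel. g x)
      = (LINT x|density (distr lborel borel (\<lambda>x. t + c *\<^sub>R x)) (\<lambda>_. \<bar>c\<bar> ^ DIM('a)). g x)"
    using lborel_affine[OF c, of t] by simp
  also have "\<dots> = \<bar>c\<bar> ^ DIM('a) * (LINT x|lborel. g (t + c *\<^sub>R x))"
    using g by (subst integral_density) (auto simp: integral_distr)
  finally show ?thesis using g by (simp add: integral_lebesgue_borel)
qed

text \<open>The difference quotients have integral zero by translation invariance, and they are dominated
  because of the mean value theorem.\<close>

lemma integral_partial_test:
  fixes f :: "real^'n \<Rightarrow> real"
  assumes f: "f \<in> test_functions"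
  shows "(LINT x|lebesgue. partial_deriv i f x) = 0"
proof -
  define s where "s n = 1 / real (Suc n)" for n
  have s: "0 < s n" "s n \<le> 1" for n by (auto simp: s_def)
  define g where "g n x = (f (s n *\<^sub>R axis i 1 + 1 *\<^sub>R x) - f x) / s n" for n x
  have sm: "smooth f" using f by (rule test_smooth)
  have mf[measurable]: "f \<in> borel_measurable borel" "partial_deriv i f \<in> borel_measurable borel"
    using smooth_borel[OF sm] smooth_borel[OF smooth_partial[OF sm]] by auto
  obtain B where B: "\<And>x. \<bar>partial_deriv i f x\<bar> \<le> B"
    using test_bounded[OF test_partial[OF f]] by blast
  obtain a where a: "\<And>x. f x \<noteq> 0 \<Longrightarrow> norm x \<le> a"
    using f by (auto simp: test_iff bounded_iff)
  have g0: "(LINT x|lborel. g n x) = 0" for n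
  proof -
    have i: "integrable lborel f"
      using integrable_test[OF f] by (simp add: integrable_lebesgue_borel)
    have "(\<lambda>x. f (1 *\<^sub>R x + s n *\<^sub>R axis i 1)) \<in> test_functions" by (rule test_affine[OF f]) simp
    from integrable_test[OF this] have i': "integrable lborel (\<lambda>x. f (s n *\<^sub>R axis i 1 + x))"
      by (subst (asm) integrable_lebesgue_borel) (auto simp: add.commute)
    have "(LINT x|lborel. f (s n *\<^sub>R axis i 1 + x)) = (LINT x|lborel. f x)"
      using integral_affine[OF mf(1), of 1 "s n *\<^sub>R axis i 1"] by
          (simp add: integral_lebesgue_borel)
    then show ?thesis using i i' by (simp add: g_def)
  qed
  have "(\<lambda>n. LINT x|lborel. g n x) \<longlonglongrightarrow> (LINT x|lborel. partial_deriv i f x)"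
  proof (rule integral_dominated_convergence[where w="\<lambda>x. indicator (cball 0 (a + 1)) x * B"])
    show "g n \<in> borel_measurable lborel" for n unfolding g_def by measurable
    show "integrable lborel (\<lambda>x::real^'n. indicator (cball 0 (a + 1)) x * B)"
      by (intro integrable_mult_left integrable_real_indicator)
          (auto simp: emeasure_lborel_cball_finite[unfolded infinity_ennreal_def])
    have "(\<lambda>n. g n x) \<longlonglongrightarrow> partial_deriv i f x" for x
    proof -
      have "((\<lambda>h. (f (x + h *\<^sub>R axis i 1) - f x) / h) \<longlongrightarrow> partial_deriv i f x) (at 0)"
        using has_real_derivative_axis[OF smooth_diff[OF sm], where x=x and s=0 and i=i] by
            (simp add: DERIV_def)
      moreover have "filterlim s (at 0) sequentially"
        unfolding s_def filterlim_at
        using LIMSEQ_inverse_real_of_nat by (auto simp: inverse_eq_divide)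
      ultimately show ?thesis
        by (auto simp: g_def add.commute dest: filterlim_compose)
    qed
    then show "AE x in lborel. (\<lambda>n. g n x) \<longlonglongrightarrow> partial_deriv i f x" by simp
    have "norm (g n x) \<le> indicator (cball 0 (a + 1)) x * B" for n x
    proof (cases "x \<in> cball 0 (a + 1)")
      case True
      obtain t where "f (x + s n *\<^sub>R axis i 1) - f (x + 0 *\<^sub>R axis i 1)
          = (s n - 0) * partial_deriv i f (x + t *\<^sub>R axis i 1)"
        using MVT2[of 0 "s n", OF _ has_real_derivative_axis[OF smooth_diff[OF sm], where x=x
            and i=i]] s by blast
      then have "g n x = partial_deriv i f (x + t *\<^sub>R axis i 1)"
        using s[of n] by (simp add: g_def add.commute)
      then show ?thesis using True B by simp
    next
      case False
      have "norm x \<le> norm (s n *\<^sub>R axis i 1 + x) + norm (s n *\<^sub>R axis i (1::real))"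
        by (metis add_diff_cancel_left' norm_triangle_ineq4)
      moreover have "norm (s n *\<^sub>R axis i (1::real)) \<le> 1" using s[of n] by simp
      ultimately have "norm (s n *\<^sub>R axis i 1 + x) > a" "norm x > a" using False by auto
      then have "f (s n *\<^sub>R axis i 1 + x) = 0" "f x = 0" using a by force+
      then show ?thesis using False by (simp add: g_def)
    qed
    then show "AE x in lborel. norm (g n x) \<le> indicator (cball 0 (a + 1)) x * B" for n by simp
  qed simp
  then show ?thesis using g0 LIMSEQ_unique tendsto_const by
      (simp add: integral_lebesgue_borel) blast
qed

lemma integral_by_parts:
  fixes f \<eta> :: "real^'n \<Rightarrow> real"
  assumes f: "smooth f" and \<eta>: "\<eta> \<in> test_functions"
  shows "(LINT x|lebesgue. partial_deriv i f x * \<eta> x) = - (LINT x|lebesgue. f x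
      * partial_deriv i \<eta> x)"
proof -
  have "partial_deriv i (\<lambda>x. f x * \<eta> x) = (\<lambda>x. partial_deriv i f x * \<eta> x + f x
      * partial_deriv i \<eta> x)"
    by (rule ext) (intro partial_deriv_mult smooth_diff f test_smooth \<eta>)
  then have "(LINT x|lebesgue. partial_deriv i f x * \<eta> x + f x * partial_deriv i \<eta> x) = 0"
    using integral_partial_test[OF test_mult[OF f \<eta>], of i] by simp
  moreover have "integrable lebesgue (\<lambda>x. partial_deriv i f x * \<eta> x)"
      "integrable lebesgue (\<lambda>x. f x * partial_deriv i \<eta> x)"
    by (intro integrable_test test_mult smooth_partial f \<eta> test_partial)+
  ultimately show ?thesis by simp
qed

lemma integral_by_parts2:
  fixes f \<eta> :: "real^'n \<Rightarrow> real"
  assumes f: "smooth f" and \<eta>: "\<eta> \<in> test_functions"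
  shows "(LINT x|lebesgue. partial_deriv i (partial_deriv j f) x * \<eta> x)
    = (LINT x|lebesgue. f x * partial_deriv j (partial_deriv i \<eta>) x)"
  by (simp add: integral_by_parts smooth_partial f \<eta> test_partial)

section \<open>Mean values of functions with bounded Laplacian\<close>

definition laplacian :: "(real^'n \<Rightarrow> real) \<Rightarrow> real^'n \<Rightarrow> real" where
  "laplacian f x = (\<Sum>i\<in>UNIV. partial_deriv i (partial_deriv i f) x)"

text \<open>With the profile $P(z)=e^{-1/(1-|z|^2)}$ on the unit ball one has $-\nabla P(z)=z\,K(z)$
    for the
  kernel \<open>K\<close> below. This turns the radial derivative of a mean with weight
  \<open>K\<close> into an integral of the Laplacian against \<open>P\<close>. The kernel is
  nonnegative because the bump is increasing.\<close>

definition avg_kernel :: "real^'n \<Rightarrow> real" where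
  "avg_kernel z = 2 * bump 1 (1 - (norm z)\<^sup>2)"

lemma smooth_laplacian: "smooth f \<Longrightarrow> smooth (laplacian f)"
  unfolding laplacian_def[abs_def] by (intro smooth_sum smooth_partial)

lemma avg_kernel_zero: "norm z \<ge> 1 \<Longrightarrow> avg_kernel z = 0"
  by (simp add: avg_kernel_def bump_nonpos power_mono[of 1 "norm z" 2, simplified])

lemma avg_kernel_test: "avg_kernel \<in> test_functions"
proof -
  have "smooth (avg_kernel :: real^'a \<Rightarrow> real)"
    unfolding avg_kernel_def[abs_def]
    by (intro smooth_cmult smooth_bump smooth_minus smooth_const smooth_norm_sq)
  moreover have "bounded {x::real^'a. avg_kernel x \<noteq> 0}"
    unfolding bounded_iff using avg_kernel_zero by (metis
        (mono_tags) linorder_le_cases mem_Collect_eq)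
  ultimately show ?thesis by (simp add: test_iff)
qed

lemma avg_kernel_nonneg: "avg_kernel z \<ge> 0"
  by (simp add: avg_kernel_def bump_Suc_0)

lemma avg_kernel_integral_pos: "(LINT z|lebesgue. avg_kernel (z :: real^'n)) > 0"
proof (rule ccontr)
  assume "\<not> ?thesis"
  moreover have "(LINT z|lebesgue. avg_kernel (z :: real^'n)) \<ge> 0"
    by (simp add: avg_kernel_nonneg)
  ultimately have "(LINT z|lebesgue. avg_kernel (z :: real^'n)) = 0" by simp
  then have "AE z in lebesgue. avg_kernel (z :: real^'n) = 0"
    using integral_nonneg_eq_0_iff_AE[OF integrable_test[OF avg_kernel_test]] avg_kernel_nonneg
        by auto
  moreover have "avg_kernel z \<noteq> 0" if "norm z < 1" for z :: "real^'n"
  proof -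
    have "(norm z)\<^sup>2 < 1" using that by (simp add: abs_square_less_1)
    then show ?thesis by (simp add: avg_kernel_def bump_Suc_0)
  qed
  ultimately have "AE z in lebesgue. z \<notin> ball (0 :: real^'n) 1"
    by (auto elim!: eventually_mono)
  then have "negligible (ball (0 :: real^'n) 1)"
    by (subst (asm) AE_iff_null_sets[symmetric]) (auto simp: negligible_iff_null_sets)
  then show False using open_not_negligible[of "ball (0 :: real^'n) 1"] by simp
qed

lemma partial_bump_profile:
  "partial_deriv i (\<lambda>z. bump 0 (1 - (norm z)\<^sup>2)) z = - (z $ i * avg_kernel z)"
proof -
  have d: "((\<lambda>z. 1 - (norm z)\<^sup>2) has_derivative (\<lambda>h. - (2 * (z \<bullet> h)))) (at z)"
    unfolding power2_norm_eq_inner by (auto intro!: derivative_eq_intros simp: inner_commute)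
  have "partial_deriv i (\<lambda>z. bump 0 (1 - (norm z)\<^sup>2)) z
      = bump 1 (1 - (norm z)\<^sup>2) * partial_deriv i (\<lambda>z. 1 - (norm z)\<^sup>2) z"
    using partial_deriv_compose(1)[OF differentiableI[OF d] bump_has_derivative] by simp
  also have "partial_deriv i (\<lambda>z. 1 - (norm z)\<^sup>2) z = - 2 * z $ i"
    by (subst partial_deriv_eq[OF d]) (simp add: inner_axis)
  finally show ?thesis by (simp add: avg_kernel_def)
qed

text \<open>For $m(t)=\int F(x+tz)K(z)\,dz$ differentiation under the integral and integration
    by parts give
  $$m'(t)=-\int\nabla F(x+tz)\cdot\nabla P(z)\,dz=t\int\Delta F(x+tz)P(z)\,dz,$$
  and the claim compares $m(r)$ with $m(0)=F(x)\int K$.\<close>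

lemma mean_value_bound:
  fixes F :: "real^'n \<Rightarrow> real"
  assumes F: "smooth F" and C: "\<And>x. \<bar>laplacian F x\<bar> \<le> C" and r: "r > 0"
  shows "(LINT z|lebesgue. avg_kernel (z :: real^'n)) * \<bar>F x\<bar>
    \<le> (LINT z|lebesgue. \<bar>F (x + r *\<^sub>R z)\<bar> * avg_kernel z)
      + r\<^sup>2 * C * (LINT z|lebesgue. bump 0 (1 - (norm (z :: real^'n))\<^sup>2))"
proof -
  let ?P = "\<lambda>z::real^'n. bump 0 (1 - (norm z)\<^sup>2)"
  let ?p = "LINT z|lebesgue. ?P z"
  define m where "m t = (LINT z|lebesgue. F (t *\<^sub>R z + x) * avg_kernel z)" for t
  have sF: "smooth (\<lambda>z. F (t *\<^sub>R z + x))" for t by (rule smooth_affine[OF F])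
  have deriv: "(m has_real_derivative t * (LINT z|lebesgue. laplacian F (t *\<^sub>R z + x) * ?P z))
      (at t)" for t
  proof -
    let ?D = "\<lambda>t z. (\<Sum>i\<in>UNIV. z $ i * partial_deriv i F (t *\<^sub>R z + x)) * avg_kernel z"
    have hk: "(LINT z|lebesgue. g z) = integral (cbox (-1) 1) g"
      if g: "continuous_on UNIV g" "\<And>z. norm z \<ge> 1 \<Longrightarrow> g z = 0" for g :: "real^'n \<Rightarrow> real"
    proof -
      have out: "g z = 0" if z: "z \<notin> cbox (-1) 1" for z
      proof -
        obtain i where "z $ i < -1 \<or> z $ i > 1"
          using z by (auto simp: mem_box_cart not_le)
        then have "norm z \<ge> 1" using component_le_norm_cart[of z i] by linarith
        then show ?thesis by (rule g(2))
      qed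
      have "{z. g z \<noteq> 0} \<subseteq> ball 0 1" using g(2) by (auto simp: not_le[symmetric])
      then have "bounded {z. g z \<noteq> 0}" by (rule bounded_subset[OF bounded_ball])
      from integrable_continuous_support[OF g(1) this] have "integrable lborel g"
        using integrable_lebesgue_borel borel_measurable_continuous_onI[OF g(1)] by blast
      then have "integral UNIV g = (LINT z|lborel. g z)" by (rule integral_lborel)
      moreover have "integral UNIV g = integral (cbox (-1) 1) g"
      proof -
        have "(\<lambda>x. if x \<in> cbox (-1) 1 then g x else 0) = g" using out by auto
        then show ?thesis
          using Henstock_Kurzweil_Integration.integral_restrict_UNIV[of "cbox (-1) 1" g] by simp
      qed
      ultimately show ?thesis
        by (simp add: integral_lebesgue_borel borel_measurable_continuous_onI[OF g(1)])
    qed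
    note cK = smooth_continuous[OF test_smooth[OF avg_kernel_test]]
    have m_hk: "m = (\<lambda>t. integral (cbox (-1) 1) (\<lambda>z. F (t *\<^sub>R z + x) * avg_kernel z))"
      unfolding m_def
      by (intro ext hk continuous_on_mult smooth_continuous sF cK) (simp add: avg_kernel_zero)
    have c2: "continuous_on UNIV (\<lambda>(t, z). ?D t z)"
      unfolding case_prod_unfold
      by (intro continuous_intros continuous_on_compose2[OF smooth_continuous[OF
          smooth_partial[OF F]], of UNIV]
           continuous_on_compose2[OF smooth_continuous[OF test_smooth[OF avg_kernel_test]],
               of UNIV]) auto
    have "(m has_real_derivative integral (cbox (-1) 1) (?D t)) (at t within UNIV)"
      unfolding m_hk
    proof (rule leibniz_rule_field_derivative)
      fix t and z :: "real^'n"
      have "((\<lambda>t. F (x + t *\<^sub>R z)) has_real_derivative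
          (\<Sum>i\<in>UNIV. z $ i * partial_deriv i F (x + t *\<^sub>R z))) (at t)"
        by (rule has_real_derivative_along) (rule smooth_diff[OF F])
      then show "((\<lambda>t. F (t *\<^sub>R z + x) * avg_kernel z) has_real_derivative ?D t z)
          (at t within UNIV)"
        by (intro DERIV_cmult_right) (simp add: add.commute)
      show "(\<lambda>z. F (t *\<^sub>R z + x) * avg_kernel z) integrable_on cbox (-1) 1"
        by (intro integrable_continuous continuous_on_mult smooth_continuous sF cK)
      show "continuous_on (UNIV \<times> cbox (-1) 1) (\<lambda>(t, z). ?D t z)"
        by (rule continuous_on_subset[OF c2]) auto
    qed auto
    also have "integral (cbox (-1) 1) (?D t) = (LINT z|lebesgue. ?D t z)"
      by (rule hk[symmetric], intro continuous_intros smooth_continuous[OF smooth_affine]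
          smooth_partial F cK)
         (simp add: avg_kernel_zero)
    also have "?D t = (\<lambda>z. \<Sum>i\<in>UNIV. - (partial_deriv i F (t *\<^sub>R z + x) * partial_deriv i ?P z))"
      unfolding partial_bump_profile sum_distrib_right by (simp add: mult_ac)
    also have "(LINT z|lebesgue. (\<Sum>i\<in>UNIV. - (partial_deriv i F (t *\<^sub>R z + x)
        * partial_deriv i ?P z)))
        = (\<Sum>i\<in>UNIV. - (LINT z|lebesgue. partial_deriv i F (t *\<^sub>R z + x) * partial_deriv i ?P z))"
      by (subst Bochner_Integration.integral_sum)
         (auto intro!: integrable_test test_mult smooth_affine smooth_partial F test_partial
             test_bump)
    also have "\<dots> = (\<Sum>i\<in>UNIV. LINT z|lebesgue. t * (partial_deriv i (partial_deriv i F)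
        (t *\<^sub>R z + x) * ?P z))"
    proof (rule sum.cong[OF refl])
      fix i
      have "partial_deriv i (\<lambda>z. partial_deriv i F (t *\<^sub>R z + x))
          = (\<lambda>z. t * partial_deriv i (partial_deriv i F) (t *\<^sub>R z + x))"
        by (rule ext) (intro partial_deriv_affine smooth_diff smooth_partial F)
      then show "- (LINT z|lebesgue. partial_deriv i F (t *\<^sub>R z + x) * partial_deriv i ?P z)
          = (LINT z|lebesgue. t * (partial_deriv i (partial_deriv i F) (t *\<^sub>R z + x) * ?P z))"
        using integral_by_parts[OF smooth_affine[OF smooth_partial[OF F]] test_bump, of i i t x]
        by (simp add: mult.assoc)
    qed
    also have "\<dots> = (LINT z|lebesgue. (\<Sum>i\<in>UNIV. t * (partial_deriv i (partial_deriv i F)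
        (t *\<^sub>R z + x) * ?P z)))"
      by (subst Bochner_Integration.integral_sum)
         (auto intro!: integrable_test test_mult smooth_affine smooth_partial F test_bump
             integrable_mult_right)
    also have "\<dots> = t * (LINT z|lebesgue. laplacian F (t *\<^sub>R z + x) * ?P z)"
      by (simp add: laplacian_def sum_distrib_left[symmetric] sum_distrib_right[symmetric])
    finally show ?thesis .
  qed
  have p0: "?p \<ge> 0" by (simp add: bump_nonneg)
  have C0: "C \<ge> 0" by (rule order_trans[OF abs_ge_zero C])
  obtain t where t: "0 < t" "t < r"
    "m r - m 0 = (r - 0) * (t * (LINT z|lebesgue. laplacian F (t *\<^sub>R z + x) * ?P z))"
    using MVT2[OF r deriv] by blast
  have "\<bar>LINT z|lebesgue. laplacian F (t *\<^sub>R z + x) * ?P z\<bar> \<le> (LINT z|lebesgue. C * ?P z)"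
  proof (rule order_trans[OF integral_abs_bound integral_mono])
    show "integrable lebesgue (\<lambda>z. \<bar>laplacian F (t *\<^sub>R z + x) * ?P z\<bar>)"
      by (intro integrable_abs integrable_test test_mult smooth_affine smooth_laplacian F test_bump)
    show "integrable lebesgue (\<lambda>z. C * ?P z)"
      by (intro integrable_test test_cmult test_bump)
  qed (auto simp: abs_mult bump_nonneg intro!: mult_right_mono C)
  also have "\<dots> = C * ?p" by simp
  finally have "\<bar>m r - m 0\<bar> \<le> r * (r * (C * ?p))"
    unfolding t(3) using t(1,2) p0 C0 by (auto simp: abs_mult intro!: mult_mono)
  then have "\<bar>m 0\<bar> \<le> \<bar>m r\<bar> + r\<^sup>2 * C * ?p" by (simp add: power2_eq_square algebra_simps)
  moreover have "\<bar>m 0\<bar> = (LINT z|lebesgue. avg_kernel (z :: real^'n)) * \<bar>F x\<bar>"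
    using avg_kernel_integral_pos[where 'n='n] by (simp add: m_def abs_mult)
  moreover have "\<bar>m r\<bar> \<le> (LINT z|lebesgue. \<bar>F (x + r *\<^sub>R z)\<bar> * avg_kernel z)"
    using integral_abs_bound[of lebesgue "\<lambda>z. F (r *\<^sub>R z + x) * avg_kernel z"]
    by (simp add: m_def abs_mult avg_kernel_nonneg add.commute)
  ultimately show ?thesis by linarith
qed

text \<open>An $L^q$ bound controls the value at the centre of a ball even though $|F|^q$ has no convexity
  for $q<1$. Let $x_1$ maximise $(d-|x-x_0|)^{N/q}|F(x)|$ over the ball and let \<open>S\<close>
  be the maximum. On the ball around $x_1$ with half the distance to the boundary as radius, $|F|$
  is at most a constant times $|F(x_1)|$, so there $|F|=|F|^{1-q}|F|^q$ is bounded by $S^{1-q}$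
  times $|F|^q$. The mean value estimate at $x_1$ gives $S\lesssim A\,S^{1-q}+C$, that is, a bound
  on \<open>S\<close>. The exponent $N/q$ of the weight is the one for which all powers of the
  radius cancel.\<close>

lemma local_sup_bound:
  fixes q d C A :: real
  assumes q: "0 < q" "q \<le> 1" and d: "d > 0"
  shows "\<exists>B. \<forall>(F :: real^'n \<Rightarrow> real) x0. smooth F \<longrightarrow> (\<forall>x. \<bar>laplacian F x\<bar> \<le> C) \<longrightarrow>
    (LINT x|lebesgue. indicator (cball x0 d) x * \<bar>F x\<bar> powr q) \<le> A \<longrightarrow> \<bar>F x0\<bar> \<le> B"
proof -
  let ?N = "CARD('n)"
  \<comment> \<open>The exponent for which the powers of the radius cancel.\<close>
  define a where "a = real ?N / q"
  have a: "a > 0" "a * q = real ?N" using q by (auto simp: a_def)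
  define c0 where "c0 = (LINT z|lebesgue. avg_kernel (z :: real^'n))"
  have c0: "c0 > 0" unfolding c0_def by (rule avg_kernel_integral_pos)
  define p where "p = (LINT z|lebesgue. bump 0 (1 - (norm (z :: real^'n))\<^sup>2))"
  have p: "p \<ge> 0" by (simp add: p_def bump_nonneg)
  obtain k where k: "\<And>z::real^'n. \<bar>avg_kernel z\<bar> \<le> k" using test_bounded[OF avg_kernel_test]
      by blast
  have k0: "k \<ge> 0" by (rule order_trans[OF abs_ge_zero k])
  define K where "K = 2 powr a * (k * A + C * p * d powr (2 + a))"
  define B where "B = max 1 ((K / c0) powr (1 / q)) / d powr a"
  have "\<bar>F x0\<bar> \<le> B" if F: "smooth F" and C: "\<And>x. \<bar>laplacian F x\<bar> \<le> C"
    and A: "(LINT x|lebesgue. indicator (cball x0 d) x * \<bar>F x\<bar> powr q) \<le> A"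
    for F :: "real^'n \<Rightarrow> real" and x0
  proof -
    have C0: "C \<ge> 0" by (rule order_trans[OF abs_ge_zero C])
    have cF: "continuous_on S F" for S by (rule smooth_continuous[OF F])
    have cFq: "continuous_on S (\<lambda>x. \<bar>F x\<bar> powr q)" for S
      using q by (intro continuous_on_powr' continuous_intros cF) auto
    have int: "integrable lebesgue (\<lambda>x. indicator (cball x1 r) x * \<bar>F x\<bar> powr q)" for x1 r
    proof -
      have i: "integrable lborel (\<lambda>x. indicator (cball x1 r) x * \<bar>F x\<bar> powr q)"
        using borel_integrable_compact[OF compact_cball cFq, of x1 r] by simp
      then show ?thesis
        using borel_measurable_integrable[OF i] by (subst integrable_lebesgue_borel) auto
    qed
    have A0: "A \<ge> 0"
      by (rule order_trans[OF _ A]) (auto intro!: integral_nonneg_AE)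
    define g where "g y = (d - norm (y - x0)) powr a * \<bar>F y\<bar>" for y
    have "continuous_on (cball x0 d) g"
      unfolding g_def using a
      by (intro continuous_on_powr' continuous_intros cF) (auto simp: dist_norm norm_minus_commute)
    then obtain x1 where x1: "x1 \<in> cball x0 d" and max: "\<And>y. y \<in> cball x0 d \<Longrightarrow> g y \<le> g x1"
      using continuous_attains_sup[OF compact_cball, of x0 d g] d by (auto simp: Ball_def)
    define S where "S = g x1"
    have S0: "d powr a * \<bar>F x0\<bar> \<le> S" using max[of x0] d by (simp add: S_def g_def)
    have "S \<le> max 1 ((K / c0) powr (1 / q))"
    proof (cases "S \<le> 1")
      case False
      then have S1: "S > 1" by simp
      define r where "r = (d - norm (x1 - x0)) / 2"
      have rd: "norm (x1 - x0) \<le> d" using x1 by (simp add: dist_norm norm_minus_commute)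
      have r: "r > 0"
        using rd S1 by (cases "norm (x1 - x0) = d") (auto simp: r_def S_def g_def)
      have r_le: "r \<le> d" unfolding r_def using norm_ge_zero[of "x1 - x0"] d by argo
      define T where "T = S / r powr a"
      have T: "\<bar>F (x1 + r *\<^sub>R z)\<bar> \<le> T" and inb: "x1 + r *\<^sub>R z \<in> cball x0 d" if z: "norm z \<le> 1" for z
      proof -
        let ?y = "x1 + r *\<^sub>R z"
        have "norm (?y - x0) \<le> norm (x1 - x0) + norm (r *\<^sub>R z)"
          using norm_triangle_ineq[of "x1 - x0" "r *\<^sub>R z"] by (simp add: algebra_simps)
        moreover have "norm (r *\<^sub>R z) \<le> r" using z r by (simp add: mult_left_le)
        ultimately have y: "r \<le> d - norm (?y - x0)" by (simp add: r_def field_simps)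
        then show in': "?y \<in> cball x0 d" using r by (simp add: dist_norm norm_minus_commute)
        have "r powr a * \<bar>F ?y\<bar> \<le> g ?y"
          unfolding g_def using y r a by (intro mult_right_mono powr_mono2) auto
        also have "\<dots> \<le> S" unfolding S_def by (rule max[OF in'])
        finally show "\<bar>F ?y\<bar> \<le> T" using r by (simp add: T_def field_simps)
      qed
      have T0: "T > 0" using S1 r by (simp add: T_def)
      have pt: "\<bar>F (x1 + r *\<^sub>R z)\<bar> * avg_kernel z
          \<le> k * T powr (1 - q) * (indicator (cball x1 r) (x1 + r *\<^sub>R z) * \<bar>F (x1
              + r *\<^sub>R z)\<bar> powr q)" for z
      proof (cases "norm z \<le> 1")
        case True
        let ?f = "\<bar>F (x1 + r *\<^sub>R z)\<bar>"
        have "?f \<le> T powr (1 - q) * ?f powr q"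
        proof (cases "?f = 0")
          case False
          then have "?f = ?f powr (1 - q) * ?f powr q" by (simp add: powr_add[symmetric])
          also have "\<dots> \<le> T powr (1 - q) * ?f powr q"
            using T[OF True] q by (intro mult_right_mono powr_mono2) auto
          finally show ?thesis .
        qed simp
        moreover have "avg_kernel z \<le> k" using k[of z] by simp
        ultimately have "?f * avg_kernel z \<le> (T powr (1 - q) * ?f powr q) * k"
          using k0 by (intro mult_mono) (auto simp: avg_kernel_nonneg)
        moreover have "x1 + r *\<^sub>R z \<in> cball x1 r" using True r by (simp add: dist_norm mult_left_le)
        ultimately show ?thesis by (simp add: mult_ac)
      next
        case False
        then show ?thesis using k0 by (simp add: avg_kernel_zero)
      qed
      have sc: "(LINT x|lebesgue. indicator (cball x1 r) x * \<bar>F x\<bar> powr q)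
          = r ^ ?N * (LINT z|lebesgue. indicator (cball x1 r) (x1 + r *\<^sub>R z) * \<bar>F (x1
              + r *\<^sub>R z)\<bar> powr q)"
      proof -
        have "(\<lambda>x. indicator (cball x1 r) x * \<bar>F x\<bar> powr q) \<in> borel_measurable borel"
          by (intro borel_measurable_times borel_measurable_indicator
              borel_measurable_continuous_onI cFq) auto
        from integral_affine[OF this, of r x1] r show ?thesis by simp
      qed
      have int': "integrable lebesgue (\<lambda>z. indicator (cball x1 r) (x1 + r *\<^sub>R z) * \<bar>F (x1
          + r *\<^sub>R z)\<bar> powr q)"
      proof -
        have "cball 0 1 = {z. x1 + r *\<^sub>R z \<in> cball x1 r}"
          using r by (auto simp: dist_norm mult_left_le pos_le_divide_eq[symmetric])
        then have eq: "indicator (cball x1 r) (x1 + r *\<^sub>R z) = (indicator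
            (cball 0 1) z :: real)" for z
          by (auto simp: indicator_def)
        have "continuous_on (cball 0 1) (\<lambda>z. \<bar>F (x1 + r *\<^sub>R z)\<bar> powr q)"
          by (rule continuous_on_compose2[OF cFq[of UNIV]]) (auto intro!: continuous_intros)
        from borel_integrable_compact[OF compact_cball this]
        have i: "integrable lborel (\<lambda>z. indicator (cball 0 1) z * \<bar>F (x1 + r *\<^sub>R z)\<bar> powr q)"
            by simp
        show ?thesis unfolding eq
          using i borel_measurable_integrable[OF i] by (subst integrable_lebesgue_borel) auto
      qed
      have sub: "(LINT x|lebesgue. indicator (cball x1 r) x * \<bar>F x\<bar> powr q) \<le> A"
      proof (rule order_trans[OF integral_mono[OF int int] A])
        fix x
        have "x \<in> cball x0 d" if x: "x \<in> cball x1 r"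
        proof -
          have "norm ((1 / r) *\<^sub>R (x - x1)) \<le> 1" using x r by
              (simp add: dist_norm norm_minus_commute)
          from inb[OF this] show ?thesis using r by simp
        qed
        then show "indicator (cball x1 r) x * \<bar>F x\<bar> powr q \<le> indicator (cball x0 d) x
            * \<bar>F x\<bar> powr q"
          by (auto simp: indicator_def)
      qed
      have ikF: "integrable lebesgue (\<lambda>z. \<bar>F (x1 + r *\<^sub>R z)\<bar> * avg_kernel z)"
      proof -
        have "(\<lambda>z. F (r *\<^sub>R z + x1) * avg_kernel z) \<in> test_functions"
          by (intro test_mult smooth_affine F avg_kernel_test)
        from integrable_abs[OF integrable_test[OF this]] show ?thesis
          by (simp add: abs_mult avg_kernel_nonneg add.commute)
      qed
      have "c0 * \<bar>F x1\<bar> \<le> (LINT z|lebesgue. \<bar>F (x1 + r *\<^sub>R z)\<bar> * avg_kernel z) + r\<^sup>2 * C * p"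
        unfolding c0_def p_def by (rule mean_value_bound[OF F C r])
      also have "(LINT z|lebesgue. \<bar>F (x1 + r *\<^sub>R z)\<bar> * avg_kernel z)
          \<le> k * T powr (1 - q) * (LINT z|lebesgue. indicator (cball x1 r) (x1 + r *\<^sub>R z) * \<bar>F
              (x1 + r *\<^sub>R z)\<bar> powr q)"
        unfolding integral_mult_right_zero[symmetric]
        by (intro integral_mono ikF integrable_mult_right int' pt)
      also have "\<dots> \<le> k * T powr (1 - q) * (A / r ^ ?N)"
        using sub sc r k0 by (intro mult_left_mono) (auto simp: field_simps)
      finally have main: "c0 * \<bar>F x1\<bar> \<le> k * T powr (1 - q) * (A / r ^ ?N) + r\<^sup>2 * C * p" by simp
      have SF: "S = 2 powr a * r powr a * \<bar>F x1\<bar>"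
      proof -
        have "2 powr a * r powr a = (2 * r) powr a" using r by (simp add: powr_mult)
        also have "2 * r = d - norm (x1 - x0)" by (simp add: r_def)
        finally show ?thesis by (simp add: S_def g_def)
      qed
      define W where "W = r powr (a * (1 - q))"
      have W: "W > 0" using r by (simp add: W_def)
      have eT: "T powr (1 - q) = S powr (1 - q) / W"
        using S1 r by (simp add: T_def W_def powr_divide powr_powr)
      have eW: "r powr a = W * r ^ ?N"
        using r a by (simp add: W_def powr_realpow[symmetric] powr_add[symmetric] algebra_simps)
      \<comment> \<open>The cancellation of the powers of \<open>r\<close>, by the choice of \<open>a\<close>.\<close>
      have e1: "r powr a * (k * T powr (1 - q) * (A / r ^ ?N)) = k * A * S powr (1 - q)"
        unfolding eT eW using W r by simp
      have e2: "r powr a * (r\<^sup>2 * C * p) \<le> C * p * d powr (2 + a)"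
      proof -
        have "r powr a * (r\<^sup>2 * C * p) = C * p * r powr (2 + a)"
          using r by (simp add: powr_add powr_numeral)
        also have "\<dots> \<le> C * p * d powr (2 + a)"
          using r r_le a C0 p by (intro mult_left_mono powr_mono2) auto
        finally show ?thesis .
      qed
      \<comment> \<open>In the case $S>1$ the term without \<open>S\<close> may be multiplied by $S^{1-q}\ge1$ as well.\<close>
      have Sq: "1 \<le> S powr (1 - q)" using S1 q by (intro ge_one_powr_ge_zero) auto
      have "c0 * S = 2 powr a * (r powr a * (c0 * \<bar>F x1\<bar>))" by (simp add: SF)
      also have "\<dots> \<le> 2 powr a * (r powr a * (k * T powr (1 - q) * (A / r ^ ?N) + r\<^sup>2 * C * p))"
        by (intro mult_left_mono main) auto
      also have "\<dots> \<le> 2 powr a * (k * A * S powr (1 - q) + C * p * d powr (2 + a) * 1)"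
        unfolding distrib_left using e1 e2 by simp
      also have "\<dots> \<le> 2 powr a * (k * A * S powr (1 - q) + C * p * d powr (2 + a) * S powr (1 - q))"
        using Sq C0 p by (intro mult_left_mono add_left_mono) auto
      also have "\<dots> = K * S powr (1 - q)" by (simp add: K_def algebra_simps)
      finally have "c0 * (S powr q * S powr (1 - q)) \<le> K * S powr (1 - q)"
        using S1 by (simp add: powr_add[symmetric])
      then have "(c0 * S powr q) * S powr (1 - q) \<le> K * S powr (1 - q)" by (simp only: mult.assoc)
      then have "c0 * S powr q \<le> K" using Sq by (subst (asm) mult_le_cancel_right_pos) auto
      then have "S powr q \<le> K / c0" using c0 by (simp add: field_simps)
      then have "(S powr q) powr (1 / q) \<le> (K / c0) powr (1 / q)"
        using q by (intro powr_mono2) auto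
      then have "S \<le> (K / c0) powr (1 / q)" using q S1 by (simp add: powr_powr)
      then show ?thesis by simp
    qed simp
    with S0 have "d powr a * \<bar>F x0\<bar> \<le> max 1 ((K / c0) powr (1 / q))" by (rule order_trans)
    then show ?thesis using d unfolding B_def by (simp add: pos_le_divide_eq mult.commute)
  qed
  then show ?thesis by blast
qed

section \<open>Fubini for Lebesgue measurable functions\<close>

text \<open>Lebesgue measure on a product is the completion of the product measure and not the product of
  the completions. So the theorems of Fubini and Tonelli are applied to Borel representatives, and
  almost every section of the exceptional null set is a null set.\<close>

lemma lebesgue_borel_version:
  fixes f :: "'a::euclidean_space \<Rightarrow> real"
  assumes "f \<in> borel_measurable lebesgue"
  obtains g where "g \<in> borel_measurable borel" "AE x in lborel. f x = g x"
  using completion_ex_borel_measurable_real[OF assms] by auto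

lemma AE_lborel_pair:
  fixes P :: "'a::euclidean_space \<times> 'b::euclidean_space \<Rightarrow> bool"
  assumes "AE z in lborel. P z"
  shows "AE t in lebesgue. AE x in lebesgue. P (t, x)"
proof -
  have "AE z in lborel \<Otimes>\<^sub>M lborel. P z" unfolding lborel_prod by (rule assms)
  from AE_completion[OF lborel_pair.AE_pair[OF this]] show ?thesis
    by eventually_elim (rule AE_completion)
qed

lemma fubini_lebesgue:
  fixes f :: "'a::euclidean_space \<times> 'b::euclidean_space \<Rightarrow> real"
  assumes f: "integrable lebesgue f"
  shows "AE t in lebesgue. integrable lebesgue (\<lambda>x. f (t, x))"
    and "integrable lebesgue (\<lambda>t. LINT x|lebesgue. f (t, x))"
proof -
  obtain g where g[measurable]: "g \<in> borel_measurable borel" and fg: "AE z in lborel. f z = g z"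
    using lebesgue_borel_version borel_measurable_integrable[OF f] by blast
  have "integrable lebesgue g"
    using f by (rule integrable_cong_AE_imp)
      (use fg in \<open>auto intro!: AE_completion measurable_completion elim: eventually_mono\<close>)
  then have "integrable (lborel \<Otimes>\<^sub>M lborel) g"
    by (simp add: integrable_lebesgue_borel lborel_prod)
  note g1 = lborel_pair.AE_integrable_fst'[OF this] and g2 = lborel_pair.integrable_fst'[OF this]
  have gt: "(\<lambda>x. g (t, x)) \<in> borel_measurable borel" for t
    by measurable
  have "AE t in lebesgue. integrable lebesgue (\<lambda>x. g (t, x))"
    using AE_completion[OF g1] by eventually_elim (simp add: integrable_lebesgue_borel gt)
  moreover note fg' = AE_lborel_pair[OF fg]
  ultimately show "AE t in lebesgue. integrable lebesgue (\<lambda>x. f (t, x))"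
  proof eventually_elim
    case (elim t)
    have eq: "AE x in lebesgue. g (t, x) = f (t, x)" using elim(2) by eventually_elim simp
    have "(\<lambda>x. f (t, x)) \<in> borel_measurable lebesgue"
      by (rule borel_measurable_AE[OF borel_measurable_integrable[OF elim(1)] eq])
    from integrable_cong_AE_imp[OF elim(1) this eq] show ?case .
  qed
  have i: "integrable lebesgue (\<lambda>t. LINT x|lebesgue. g (t, x))"
    using g2 by (simp add: integral_lebesgue_borel gt integrable_completion)
  have eq: "AE t in lebesgue. (LINT x|lebesgue. g (t, x)) = (LINT x|lebesgue. f (t, x))"
    using fg'
  proof eventually_elim
    case (elim t)
    have "AE x in lebesgue. g (t, x) = f (t, x)" using elim by eventually_elim simp
    moreover have "(\<lambda>x. g (t, x)) \<in> borel_measurable lebesgue"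
      using gt by (intro measurable_completion) simp
    moreover have "(\<lambda>x. f (t, x)) \<in> borel_measurable lebesgue"
      by (rule borel_measurable_AE[OF calculation(2,1)])
    ultimately show ?case by (intro integral_cong_AE)
  qed
  show "integrable lebesgue (\<lambda>t. LINT x|lebesgue. f (t, x))"
    by (rule integrable_cong_AE_imp[OF i borel_measurable_AE[OF borel_measurable_integrable[OF
        i] eq] eq])
qed

lemma AE_lebesgue_of_sections:
  fixes S :: "('a::euclidean_space \<times> 'b::euclidean_space) set"
  assumes S: "S \<in> sets lebesgue" and AE: "AE t in lebesgue. AE x in lebesgue. (t, x) \<notin> S"
  shows "AE z in lebesgue. z \<notin> S"
proof -
  have "indicator S \<in> borel_measurable lebesgue" using S by simp
  then obtain g :: "_ \<Rightarrow> ennreal" where g[measurable]: "g \<in> borel_measurable lborel"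
    and fg: "AE z in lborel. indicator S z = g z"
    using completion_ex_borel_measurable by blast
  have g'[measurable]: "g \<in> borel_measurable (lborel \<Otimes>\<^sub>M lborel)" using g by (simp add: lborel_prod)
  have "AE t in lebesgue. (\<integral>\<^sup>+x. g (t, x) \<partial>lborel) = 0"
    using AE AE_lborel_pair[OF fg]
  proof eventually_elim
    case (elim t)
    then have "AE x in lebesgue. g (t, x) = 0" by eventually_elim (auto split: split_indicator_asm)
    then have "(\<integral>\<^sup>+x. g (t, x) \<partial>lebesgue) = 0" by (simp add: nn_integral_cong_AE[where v="\<lambda>_. 0"])
    then show ?case by (simp add: nn_integral_completion)
  qed
  then have "(\<integral>\<^sup>+t. (\<integral>\<^sup>+x. g (t, x) \<partial>lborel) \<partial>lebesgue) = 0"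
    by (simp add: nn_integral_cong_AE[where v="\<lambda>_. 0"])
  then have "(\<integral>\<^sup>+z. g z \<partial>(lborel \<Otimes>\<^sub>M lborel)) = 0"
    by (simp add: nn_integral_completion lborel.nn_integral_fst)
  then have "AE z in lborel. g z = 0"
    using nn_integral_0_iff_AE[OF g'] unfolding lborel_prod by blast
  with fg have "AE z in lborel. z \<notin> S" by eventually_elim (auto split: split_indicator_asm)
  then show ?thesis by (rule AE_completion)
qed

lemma time_sets [simp]: "{0<..<T::real} \<inter> space lebesgue \<in> sets lebesgue"
    "({0<..<T::real} \<times> (UNIV::(real^'n) set)) \<inter> space lebesgue \<in> sets lebesgue"
proof -
  have "open ({0<..<T::real} \<times> (UNIV::(real^'n) set))" by (intro open_Times) auto
  then show "({0<..<T::real} \<times> (UNIV::(real^'n) set)) \<inter> space lebesgue \<in> sets lebesgue"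
    by (simp add: lebesgue_openin)
qed simp

lemma AE_time: "(AE t in time T. P t) \<longleftrightarrow> (AE t in lebesgue. t \<in> {0<..<T} \<longrightarrow> P t)"
  by (rule AE_restrict_space_iff) (rule time_sets)

lemma fubini_spacetime:
  fixes g :: "real \<Rightarrow> real^'n \<Rightarrow> real"
  assumes "integrable (spacetime T) (\<lambda>(t, x). g t x)"
  shows "AE t in time T. integrable lebesgue (g t)"
    and "integrable (time T) (\<lambda>t. LINT x|lebesgue. g t x)"
proof -
  have eq: "indicator ({0<..<T} \<times> UNIV) z *\<^sub>R (case z of (t, x) \<Rightarrow> g t x)
      = (case z of (t, x) \<Rightarrow> indicator {0<..<T} t * g t x)" for z :: "real \<times> (real^'n)"
    by (auto simp: indicator_def split: prod.split)
  have "integrable lebesgue (\<lambda>(t, x). indicator {0<..<T} t * g t x)"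
    using assms unfolding integrable_restrict_space[OF time_sets(2)] eq .
  note i = fubini_lebesgue[OF this]
  show "AE t in time T. integrable lebesgue (g t)"
    unfolding AE_time using i(1) by eventually_elim auto
  show "integrable (time T) (\<lambda>t. LINT x|lebesgue. g t x)"
    using i(2) unfolding integrable_restrict_space[OF time_sets(1)] by simp
qed

section \<open>The fundamental lemma of the calculus of variations in time\<close>

text \<open>The positive and the negative part of \<open>k\<close> are densities of two finite measures that
  agree on all half lines, hence are equal; so the two parts agree almost everywhere.\<close>

lemma integral_intervals_zero_imp_AE:
  fixes k :: "real \<Rightarrow> real"
  assumes k: "integrable lebesgue k"
    and zero: "\<And>c. (LINT t|lebesgue. indicator {c<..} t * k t) = 0"
  shows "AE t in lebesgue. k t = 0"
proof -
  obtain g where g[measurable]: "g \<in> borel_measurable borel" and kg: "AE t in lborel. k t = g t"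
    using lebesgue_borel_version borel_measurable_integrable[OF k] by blast
  have kg': "AE t in lebesgue. k t = g t" using kg by (rule AE_completion)
  have ig: "integrable lborel g"
  proof -
    have "integrable lebesgue g"
      using k by (rule integrable_cong_AE_imp)
        (use kg' in \<open>auto intro!: measurable_completion elim: eventually_mono\<close>)
    then show ?thesis by (simp add: integrable_lebesgue_borel)
  qed
  have zg: "(LINT t|lborel. indicator {c<..} t * g t) = 0" for c
  proof -
    have "(LINT t|lebesgue. indicator {c<..} t * g t) = (LINT t|lebesgue. indicator {c<..} t * k t)"
    proof (intro integral_cong_AE borel_measurable_times borel_measurable_indicator)
      show "k \<in> borel_measurable lebesgue" by (rule borel_measurable_integrable[OF k])
      show "g \<in> borel_measurable lebesgue" by (intro measurable_completion) simp
      show "AE t in lebesgue. indicator {c<..} t * g t = indicator {c<..} t * k t"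
        using kg' by eventually_elim simp
    qed auto
    then show ?thesis using zero by (simp add: integral_lebesgue_borel)
  qed
  let ?M = "density lborel (\<lambda>t. ennreal (g t))" and ?N = "density lborel (\<lambda>t. ennreal (- g t))"
  have em: "emeasure ?M {c<..} = ennreal (LINT t|lborel. indicator {c<..} t * max 0 (g t))"
       "emeasure ?N {c<..} = ennreal (LINT t|lborel. indicator {c<..} t * max 0 (- g t))" for c
  proof -
    have "integrable lborel (\<lambda>t. indicator {c<..} t * max 0 (g t))"
         "integrable lborel (\<lambda>t. indicator {c<..} t * max 0 (- g t))"
      using ig by (auto intro!: integrable_real_mult_indicator integrable_max simp:
          mult.commute[of "indicator _ _"])
    then show "emeasure ?M {c<..} = ennreal (LINT t|lborel. indicator {c<..} t * max 0 (g t))"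
       "emeasure ?N {c<..} = ennreal (LINT t|lborel. indicator {c<..} t * max 0 (- g t))"
      by (auto simp: emeasure_density nn_integral_eq_integral[symmetric] ennreal_mult'
          ennreal_max_0 mult.commute
          intro!: nn_integral_cong split: split_indicator)
  qed
  have "?M = ?N"
  proof (rule measure_eqI_lessThan)
    fix c
    have i: "integrable lborel (\<lambda>t. indicator {c<..} t * max 0 (g t))"
         "integrable lborel (\<lambda>t. indicator {c<..} t * max 0 (- g t))"
      using ig by (auto intro!: integrable_real_mult_indicator integrable_max simp:
          mult.commute[of "indicator _ _"])
    have "(LINT t|lborel. indicator {c<..} t * max 0 (g t)) -
        (LINT t|lborel. indicator {c<..} t * max 0 (- g t))
        = (LINT t|lborel. indicator {c<..} t * g t)"
      by (subst Bochner_Integration.integral_diff[OF i, symmetric])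
          (auto intro!: Bochner_Integration.integral_cong simp: max_def indicator_def)
    then show "emeasure ?M {c<..} = emeasure ?N {c<..}" unfolding em zg by simp
    show "emeasure ?M {c<..} < \<infinity>" unfolding em by simp
  qed auto
  then have "AE t in lborel. ennreal (g t) = ennreal (- g t)"
    by (subst (asm) sigma_finite_measure.density_unique_iff[OF sigma_finite_lborel]) auto
  with kg have "AE t in lborel. k t = 0"
  proof eventually_elim
    case (elim t)
    then show ?case by (cases "g t \<ge> 0") (auto simp: ennreal_neg ennreal_eq_0_iff)
  qed
  then show ?thesis by (rule AE_completion)
qed

text \<open>As the steepness \<open>k\<close> grows these functions increase to the indicator of the
  interval \<open>{c<..<d}\<close>.\<close>

definition time_bump :: "real \<Rightarrow> real \<Rightarrow> real \<Rightarrow> real \<Rightarrow> real" where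
  "time_bump k c d t = bump 0 (k * ((t - c) * (d - t)))"

lemma time_bump_outside: "k > 0 \<Longrightarrow> c < d \<Longrightarrow> t \<notin> {c<..<d} \<Longrightarrow> time_bump k c d t = 0"
  unfolding time_bump_def
  by (rule bump_nonpos) (auto simp: mult_le_0_iff not_less intro!: mult_nonneg_nonpos
      mult_nonpos_nonneg)

lemma time_bump_C1:
  assumes "0 < c" "c < d" "d < T" "k > 0"
  shows "time_bump k c d \<in> C1_compact T"
proof -
  have "(time_bump k c d has_real_derivative bump 1 (k * ((t - c) * (d - t))) * (k * (c + d
      - 2 * t))) (at t)" for t
    unfolding time_bump_def
    by (rule DERIV_chain2[where f="bump 0", OF bump_has_derivative[of 0,
        simplified One_nat_def[symmetric]]])
       (auto intro!: derivative_eq_intros simp: algebra_simps)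
  moreover have "continuous_on UNIV (\<lambda>t. bump 1 (k * ((t - c) * (d - t))) * (k * (c + d - 2 * t)))"
    by (intro continuous_intros continuous_on_compose2[OF bump_continuous[of UNIV]]) auto
  ultimately have "time_bump k c d C1_differentiable_on UNIV"
    unfolding C1_differentiable_on_def
    by (auto simp: has_real_derivative_iff_has_vector_derivative intro!: exI)
  moreover have sub: "supp (time_bump k c d) \<subseteq> {c..d}"
    unfolding supp_def
  proof (rule closure_minimal)
    show "{t. time_bump k c d t \<noteq> 0} \<subseteq> {c..d}"
    proof
      fix t assume "t \<in> {t. time_bump k c d t \<noteq> 0}"
      then have "t \<in> {c<..<d}" using time_bump_outside[OF assms(4,2)] by blast
      then show "t \<in> {c..d}" by simp
    qed
  qed simp
  moreover have "compact (supp (time_bump k c d))"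
    unfolding compact_eq_bounded_closed
    by (intro conjI bounded_subset[OF bounded_closed_interval sub]) (simp add: supp_def)
  moreover have "{c..d} \<subseteq> {0<..<T}" using assms by auto
  ultimately show ?thesis unfolding C1_compact_def by blast
qed

lemma bump_mono: "0 < s \<Longrightarrow> s \<le> t \<Longrightarrow> bump 0 s \<le> bump 0 t"
  by (simp add: bump_def frac_le)

lemma time_bump_limit: "c < d \<Longrightarrow> (\<lambda>k. time_bump (real (Suc k)) c d t) \<longlonglongrightarrow> indicator {c<..<d} t"
proof (cases "t \<in> {c<..<d}")
  case True
  define s where "s = (t - c) * (d - t)"
  have s: "s > 0" using True by (simp add: s_def)
  have "(\<lambda>k. exp (- (inverse (real (Suc k)) * (1 / s)))) \<longlonglongrightarrow> exp (- (0 * (1 / s)))"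
    by (intro tendsto_intros LIMSEQ_inverse_real_of_nat)
  moreover have "time_bump (real (Suc k)) c d t = exp (- (inverse (real (Suc k)) * (1 / s)))" for k
  proof -
    have "time_bump (real (Suc k)) c d t = bump 0 (real (Suc k) * s)"
      by (simp add: time_bump_def s_def)
    then show ?thesis using s by (simp add: bump_def divide_inverse)
  qed
  ultimately show ?thesis using True by simp
qed (simp add: time_bump_outside)

text \<open>Testing with ever steeper bumps on \<open>{c<..<d}\<close> shows that \<open>h\<close> has
  integral zero over this interval; the integrable majorant is a multiple of \<open>h\<close>
  times one bump on a slightly larger interval, which is bounded below on \<open>{c<..<d}\<close>.
  Near the end points of \<open>{0<..<T}\<close> the function \<open>h\<close> may fail to be
  integrable, so the conclusion is first drawn on compactly contained intervals.\<close>

lemma fundamental_lemma_time: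
  fixes h :: "real \<Rightarrow> real"
  assumes int: "\<And>\<xi>. \<xi> \<in> C1_compact T \<Longrightarrow> integrable (time T) (\<lambda>t. h t * \<xi> t)"
    and zero: "\<And>\<xi>. \<xi> \<in> C1_compact T \<Longrightarrow> (LINT t|time T. h t * \<xi> t) = 0"
  shows "AE t in time T. h t = 0"
proof -
  let ?h = "\<lambda>t. indicator {0<..<T} t * h t"
  have int': "integrable lebesgue (\<lambda>t. ?h t * \<xi> t)" and zero': "(LINT t|lebesgue. ?h t * \<xi> t) = 0"
    if "\<xi> \<in> C1_compact T" for \<xi>
    using int[OF that] zero[OF that]
    by (simp_all add: integrable_restrict_space integral_restrict_space mult.assoc)
  have sub: "integrable lebesgue (\<lambda>t. indicator {c<..<d} t * ?h t) \<and>
      (LINT t|lebesgue. indicator {c<..<d} t * ?h t) = 0"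
    if cd: "0 < c" "c < d" "d < T" for c d
  proof -
    \<comment> \<open>A slightly larger interval, on which a bump dominates the indicator of \<open>{c<..<d}\<close>.\<close>
    define c' d' where "c' = c / 2" and "d' = (d + T) / 2"
    have o: "0 < c'" "c' < c" "d < d'" "d' < T" "c' < d'" using cd by (auto simp: c'_def d'_def)
    define w where "w t = \<bar>?h t * time_bump 1 c' d' t\<bar> / bump 0 ((c - c') * (d' - d))" for t
    have m: "bump 0 ((c - c') * (d' - d)) > 0" using o by (simp add: bump_def)
    have iw: "integrable lebesgue w"
      unfolding w_def by (intro integrable_divide integrable_abs int' time_bump_C1) (use o in auto)
    have tb: "\<And>k. time_bump (real (Suc k)) c d \<in> C1_compact T" using cd by (intro time_bump_C1) auto
    have dom: "\<bar>?h t * time_bump (real (Suc k)) c d t\<bar> \<le> w t" for t k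
    proof (cases "t \<in> {c<..<d}")
      case True
      have "(c - c') * (d' - d) \<le> (t - c') * (d' - t)" using True o by (intro mult_mono) auto
      then have "bump 0 ((c - c') * (d' - d)) \<le> time_bump 1 c' d' t"
        unfolding time_bump_def using o by (auto intro!: bump_mono)
      then have "\<bar>?h t\<bar> * bump 0 ((c - c') * (d' - d)) \<le> \<bar>?h t\<bar> * time_bump 1 c' d' t"
        by (intro mult_left_mono) auto
      then have "\<bar>?h t\<bar> \<le> w t"
        using m by (simp add: w_def abs_mult pos_le_divide_eq time_bump_def bump_nonneg)
      moreover have "\<bar>?h t * time_bump (real (Suc k)) c d t\<bar> \<le> \<bar>?h t\<bar>"
        unfolding abs_mult time_bump_def by (intro mult_left_le) (auto simp: bump_nonneg bump_le_1)
      ultimately show ?thesis by linarith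
    next
      case False
      then show ?thesis using m cd by (simp add: time_bump_outside w_def)
    qed
    have lim: "(\<lambda>k. ?h t * time_bump (real (Suc k)) c d t) \<longlonglongrightarrow> indicator {c<..<d} t * ?h t" for t
      using tendsto_mult_left[OF time_bump_limit[OF cd(2)], of "?h t" t] by (simp add: mult.commute)
    have meas: "(\<lambda>t. ?h t * time_bump (real (Suc k)) c d t) \<in> borel_measurable lebesgue" for k
      using borel_measurable_integrable[OF int'[OF tb]] .
    have meas': "(\<lambda>t. indicator {c<..<d} t * ?h t) \<in> borel_measurable lebesgue"
      by (rule borel_measurable_LIMSEQ_real[OF lim meas])
    have "integrable lebesgue (\<lambda>t. indicator {c<..<d} t * ?h t)"
      by (rule integrable_dominated_convergence[where s="\<lambda>k t. ?h t * time_bump (real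
          (Suc k)) c d t", OF meas' meas iw])
         (simp_all only: real_norm_def dom lim AE_I2)
    moreover have "(\<lambda>k. LINT t|lebesgue. ?h t * time_bump (real (Suc k)) c d t)
        \<longlonglongrightarrow> (LINT t|lebesgue. indicator {c<..<d} t * ?h t)"
      by (rule integral_dominated_convergence[where s="\<lambda>k t. ?h t * time_bump (real
          (Suc k)) c d t", OF meas' meas iw])
         (simp_all only: real_norm_def dom lim AE_I2)
    ultimately show ?thesis using zero'[OF tb] LIMSEQ_unique[OF tendsto_const] by fastforce
  qed
  have *: "AE t in lebesgue. indicator {c<..<d} t * ?h t = 0" if cd: "0 < c" "c < d" "d < T" for c d
  proof (rule integral_intervals_zero_imp_AE)
    show "integrable lebesgue (\<lambda>t. indicator {c<..<d} t * ?h t)" using sub[OF cd] by blast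
    fix e
    have eq: "indicator {e<..} t * (indicator {c<..<d} t * ?h t) = indicator {max c e<..<d} t
        * ?h t" for t
      by (auto simp: indicator_def)
    show "(LINT t|lebesgue. indicator {e<..} t * (indicator {c<..<d} t * ?h t)) = 0"
    proof (cases "max c e < d")
      case True
      then show ?thesis unfolding eq using sub[of "max c e" d] cd by auto
    next
      case False
      then have "{max c e<..<d} = {}" by auto
      then show ?thesis unfolding eq by simp
    qed
  qed
  have ae: "AE t in lebesgue. \<forall>n. indicator {T / real (n + 3)<..<T - T / real (n + 3)} t
      * ?h t = 0" if "T > 0"
    unfolding AE_all_countable
  proof (intro allI)
    fix n :: nat
    have "T / real (n + 3) \<le> T / 3" using that by (intro divide_left_mono) auto
    then have "T / real (n + 3) < T - T / real (n + 3)" using that by argo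
    moreover have "T / real (n + 3) > 0" using that by simp
    ultimately show "AE t in lebesgue. indicator {T / real (n + 3)<..<T - T / real (n + 3)} t
        * ?h t = 0"
      using * by simp
  qed
  have "AE t in lebesgue. t \<in> {0<..<T} \<longrightarrow> h t = 0" if T: "T > 0"
    using ae[OF T]
  proof eventually_elim
    case (elim t)
    show ?case
    proof
      assume t: "t \<in> {0<..<T}"
      \<comment> \<open>The relative distance of \<open>t\<close> to the end points decides which of the exhausting
          intervals contains it.\<close>
      define m where "m = min t (T - t) / T"
      have "m > 0" using t by (simp add: m_def)
      then obtain n where n: "inverse (real (Suc n)) < m" using reals_Archimedean by blast
      have "1 / real (n + 3) \<le> inverse (real (Suc n))" by (simp add: field_simps)
      then have "1 / real (n + 3) < m" using n by linarith
      then have "T / real (n + 3) < min t (T - t)" using T by (simp add: m_def field_simps)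
      then have "t \<in> {T / real (n + 3)<..<T - T / real (n + 3)}" by auto
      then show "h t = 0" using elim t by (auto dest!: spec[of _ n])
    qed
  qed
  then show ?thesis unfolding AE_time by (cases "T > 0") auto
qed

section \<open>The pressure equation\<close>

definition hessian_pairing :: "(real^'n \<Rightarrow> real^'n) \<Rightarrow> (real^'n \<Rightarrow> real) \<Rightarrow> real" where
  "hessian_pairing w \<psi> = (LINT x|lebesgue.
     (\<Sum>i\<in>UNIV. \<Sum>j\<in>UNIV. w x $ i * w x $ j * partial_deriv i (partial_deriv j \<psi>) x))"

lemma contract_gradient: "contract (tensor a a) (gradient_matrix (gradient \<psi>) x)
    = (\<Sum>i\<in>UNIV. \<Sum>j\<in>UNIV. a $ i * a $ j * partial_deriv i (partial_deriv j \<psi>) x)"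
  by (simp add: contract_def tensor_def gradient_matrix_def gradient_def)

lemma divergence_gradient: "divergence (gradient \<psi>) = laplacian \<psi>"
  by (rule ext) (simp add: divergence_def laplacian_def gradient_def)

lemma partial_deriv_sum:
  assumes "\<And>i. i \<in> I \<Longrightarrow> smooth (f i)"
  shows "partial_deriv j (\<lambda>x. \<Sum>i\<in>I. f i x) = (\<lambda>x. \<Sum>i\<in>I. partial_deriv j (f i) x)"
  using iter_partial_sum[where 'a='a, of I f "[j]"] assms by (simp add: iter_partial_Cons)

lemma vec_laplacian_gradient:
  assumes "smooth \<psi>"
  shows "vec_laplacian (gradient \<psi>) x = gradient (laplacian \<psi>) x"
proof -
  have "partial_deriv i (partial_deriv i (partial_deriv j \<psi>))
      = partial_deriv j (partial_deriv i (partial_deriv i \<psi>))" for i j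
    by (simp add: partial_deriv_commute[OF assms, of i j]
        partial_deriv_commute[OF smooth_partial[OF assms], of i j])
  then show ?thesis
    unfolding vec_eq_iff
    by (simp add: vec_laplacian_def gradient_def laplacian_def[abs_def] partial_deriv_sum
        smooth_partial assms)
qed

lemma laplacian_test: "\<psi> \<in> test_functions \<Longrightarrow> laplacian \<psi> \<in> test_functions"
  unfolding laplacian_def[abs_def] by (intro test_sum test_partial)

text \<open>The test field is $\nabla\psi$. Since $v(t)$ is weakly divergence free, it is orthogonal to
  $\nabla\psi$ and to $\Delta\nabla\psi=\nabla\Delta\psi$, which removes two of the four terms.
  The exceptional set of times depends on $\psi$; later only countably many test functions are
  used.\<close>

lemma pressure_equation:
  fixes v :: "real \<Rightarrow> real^'n \<Rightarrow> real^'n"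
  assumes sol: "weak_solution \<nu> T v p" and \<psi>: "\<psi> \<in> test_functions"
  shows "AE t in time T. p t (laplacian \<psi>) = - hessian_pairing (v t) \<psi>"
proof -
  let ?\<phi> = "gradient \<psi>"
  have \<phi>: "?\<phi> \<in> vec_test_functions"
    by (simp add: vec_test_functions_def gradient_def test_partial[OF \<psi>])
  have div: "AE t in time T. v t \<in> L2_sigma"
    using sol by (simp add: weak_solution_def L1_L2_sigma_def)
  have div1: "AE t in time T. (LINT x|lebesgue. v t x \<bullet> gradient \<eta> x) = 0"
      if "\<eta> \<in> test_functions" for \<eta>
    using div by eventually_elim (use that in \<open>auto simp: L2_sigma_def\<close>)
  let ?h = "\<lambda>t. hessian_pairing (v t) \<psi> + p t (laplacian \<psi>)"
  have main: "integrable (time T) (\<lambda>t. ?h t * \<xi> t) \<and> (LINT t|time T. ?h t * \<xi> t) = 0"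
    if \<xi>: "\<xi> \<in> C1_compact T" for \<xi>
  proof -
    note w = sol[unfolded weak_solution_def, THEN conjunct2, THEN conjunct2, rule_format, OF \<xi> \<phi>]
    have I2: "integrable (spacetime T)
        (\<lambda>(t, x). contract (tensor (v t x) (v t x)) (gradient_matrix ?\<phi> x) * \<xi> t)"
      and I3: "integrable (time T) (\<lambda>t. p t (laplacian \<psi>) * \<xi> t)"
      using w by (simp_all add: divergence_gradient)
    have inner: "(LINT x|lebesgue. contract (tensor (v t x) (v t x)) (gradient_matrix ?\<phi> x) * \<xi> t)
        = hessian_pairing (v t) \<psi> * \<xi> t" for t
      by (simp add: contract_gradient hessian_pairing_def)
    have I2': "integrable (time T) (\<lambda>t. hessian_pairing (v t) \<psi> * \<xi> t)"
      using fubini_spacetime(2)[OF I2] unfolding inner .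
    have z1: "(LINT t|time T. LINT x|lebesgue. (v t x \<bullet> ?\<phi> x) * deriv \<xi> t) = 0"
      using div1[OF \<psi>] by (intro integral_eq_zero_AE) (auto elim: eventually_mono)
    have z2: "(LINT t|time T. LINT x|lebesgue. (v t x \<bullet> vec_laplacian ?\<phi> x) * \<xi> t) = 0"
      using div1[OF laplacian_test[OF \<psi>]]
      by (intro integral_eq_zero_AE)
         (auto simp: vec_laplacian_gradient[OF test_smooth[OF \<psi>]] elim: eventually_mono)
    have "- (LINT t|time T. hessian_pairing (v t) \<psi> * \<xi> t) = (LINT t|time T. p t (laplacian \<psi>)
        * \<xi> t)"
      using w unfolding inner z1 z2 divergence_gradient by simp
    then show ?thesis using I2' I3 by (simp add: distrib_right)
  qed
  have "AE t in time T. ?h t = 0"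
    by (rule fundamental_lemma_time) (use main in auto)
  then show ?thesis by eventually_elim simp
qed

section \<open>Second moments of the velocity\<close>

lemma L2_products_integrable:
  fixes w :: "real^'n \<Rightarrow> real^'n"
  assumes w: "w \<in> L2_sigma"
  shows "integrable lebesgue (\<lambda>x. w x $ i * w x $ j)"
proof (rule Bochner_Integration.integrable_bound)
  show "integrable lebesgue (\<lambda>x. (norm (w x))\<^sup>2)" using w by (simp add: L2_sigma_def)
  have m: "w \<in> borel_measurable lebesgue" using w by (simp add: L2_sigma_def)
  have "(\<lambda>x. w x $ i) \<in> borel_measurable lebesgue" for i
    by (rule borel_measurable_continuous_on[OF _ m]) (intro continuous_intros)
  then show "(\<lambda>x. w x $ i * w x $ j) \<in> borel_measurable lebesgue" by (intro borel_measurable_times)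
  have "\<bar>w x $ i * w x $ j\<bar> \<le> norm (w x) * norm (w x)" for x
    unfolding abs_mult by (intro mult_mono component_le_norm_cart) auto
  then show "AE x in lebesgue. norm (w x $ i * w x $ j) \<le> norm ((norm (w x))\<^sup>2)"
    by (simp add: power2_eq_square)
qed

lemma integrable_times_bounded:
  fixes f g :: "'a::euclidean_space \<Rightarrow> real"
  assumes f: "integrable lebesgue f" and g: "g \<in> borel_measurable lebesgue" and C: "\<And>x. \<bar>g x\<bar> \<le> C"
  shows "integrable lebesgue (\<lambda>x. f x * g x)"
proof (rule Bochner_Integration.integrable_bound)
  show "integrable lebesgue (\<lambda>x. C * f x)" using f by simp
  show "(\<lambda>x. f x * g x) \<in> borel_measurable lebesgue"
    using borel_measurable_integrable[OF f] g by (rule borel_measurable_times)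
  have "\<bar>f x * g x\<bar> \<le> \<bar>C * f x\<bar>" for x
  proof -
    have "\<bar>g x\<bar> \<le> \<bar>C\<bar>" using C[of x] by linarith
    then show ?thesis unfolding abs_mult by (subst mult.commute) (intro mult_right_mono, auto)
  qed
  then show "AE x in lebesgue. norm (f x * g x) \<le> norm (C * f x)" by simp
qed

lemma integral_times_bounded_limit:
  fixes f :: "'a::euclidean_space \<Rightarrow> real"
  assumes f: "integrable lebesgue f" and g: "\<And>k. g k \<in> borel_measurable lebesgue"
    and C: "\<And>k x. \<bar>g k x\<bar> \<le> C" and lim: "\<And>x. (\<lambda>k. g k x) \<longlonglongrightarrow> h x"
  shows "(\<lambda>k. LINT x|lebesgue. f x * g k x) \<longlonglongrightarrow> (LINT x|lebesgue. f x * h x)"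
proof (rule integral_dominated_convergence[where w="\<lambda>x. C * \<bar>f x\<bar>"])
  have fm: "f \<in> borel_measurable lebesgue" using f by (rule borel_measurable_integrable)
  have "h \<in> borel_measurable lebesgue" by (rule borel_measurable_LIMSEQ_real[OF lim g])
  then show "(\<lambda>x. f x * h x) \<in> borel_measurable lebesgue" using fm by (intro borel_measurable_times)
  show "(\<lambda>x. f x * g k x) \<in> borel_measurable lebesgue" for k using fm g by
      (intro borel_measurable_times)
  show "integrable lebesgue (\<lambda>x. C * \<bar>f x\<bar>)" using f by (intro integrable_mult_right integrable_abs)
  show "AE x in lebesgue. (\<lambda>k. f x * g k x) \<longlonglongrightarrow> f x * h x" by (simp add: lim tendsto_mult_left)
  have "\<bar>f x * g k x\<bar> \<le> C * \<bar>f x\<bar>" for k x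
    unfolding abs_mult using C[of k x] by (subst mult.commute) (intro mult_right_mono, auto)
  then show "AE x in lebesgue. norm (f x * g k x) \<le> C * \<bar>f x\<bar>" for k by simp
qed

lemma smooth_lebesgue: "smooth f \<Longrightarrow> f \<in> borel_measurable lebesgue"
  by (intro measurable_completion) (simp add: smooth_borel)

lemma hessian_pairing_sum:
  fixes w :: "real^'n \<Rightarrow> real^'n"
  assumes w: "w \<in> L2_sigma" and \<psi>: "smooth \<psi>" and C: "\<And>i j x. \<bar>partial_deriv i
      (partial_deriv j \<psi>) x\<bar> \<le> C i j"
  shows "hessian_pairing w \<psi> = (\<Sum>i\<in>UNIV. \<Sum>j\<in>UNIV.
    LINT x|lebesgue. w x $ i * w x $ j * partial_deriv i (partial_deriv j \<psi>) x)"
proof -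
  have i: "integrable lebesgue (\<lambda>x. w x $ i * w x $ j * partial_deriv i
      (partial_deriv j \<psi>) x)" for i j
    by (rule integrable_times_bounded[OF L2_products_integrable[OF w]])
       (auto intro!: smooth_lebesgue smooth_partial \<psi> C)
  show ?thesis
    unfolding hessian_pairing_def
    by (simp add: Bochner_Integration.integral_sum Bochner_Integration.integrable_sum i)
qed

lemma hessian_pairing_limit:
  fixes w :: "real^'n \<Rightarrow> real^'n"
  assumes w: "w \<in> L2_sigma" and \<psi>: "\<And>k. smooth (\<psi> k)"
    and C: "\<And>k i j x. \<bar>partial_deriv i (partial_deriv j (\<psi> k)) x\<bar> \<le> C i j"
    and lim: "\<And>i j x. (\<lambda>k. partial_deriv i (partial_deriv j (\<psi> k)) x) \<longlonglongrightarrow> H i j x"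
  shows "(\<lambda>k. hessian_pairing w (\<psi> k)) \<longlonglongrightarrow> (\<Sum>i\<in>UNIV. \<Sum>j\<in>UNIV. LINT x|lebesgue. w x $ i * w x $ j
      * H i j x)"
  unfolding hessian_pairing_sum[OF w \<psi> C]
  by (intro tendsto_sum integral_times_bounded_limit[OF L2_products_integrable[OF w]])
     (auto intro!: smooth_lebesgue smooth_partial \<psi> C lim)

text \<open>The function $k^2Z(x/k)$ with $Z(x)=x_ax_b\sigma(x)$ has the Hessian $D^2Z(x/k)$: it is
    bounded
  independently of \<open>k\<close> and tends to $D^2Z(0)$, the Hessian of $x_ax_b$. The index is
  shifted to avoid division by zero.\<close>

definition quadratic_profile :: "'n \<Rightarrow> 'n \<Rightarrow> real^'n \<Rightarrow> real" where
  "quadratic_profile a b x = x $ a * x $ b * cutoff x"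

definition quadratic_test :: "'n \<Rightarrow> 'n \<Rightarrow> nat \<Rightarrow> real^'n \<Rightarrow> real" where
  "quadratic_test a b k x = (real (Suc k))\<^sup>2 * quadratic_profile a b ((1 / real (Suc k)) *\<^sub>R x)"

lemma quadratic_profile_test: "quadratic_profile a b \<in> test_functions"
  unfolding quadratic_profile_def[abs_def]
  by (intro test_mult smooth_mult smooth_component cutoff_test)

lemma quadratic_test_test: "quadratic_test a b k \<in> test_functions"
  unfolding quadratic_test_def[abs_def]
  by (rule test_cmult) (use test_affine[OF quadratic_profile_test, of "1 / real
      (Suc k)" _ _ 0] in simp)

lemma quadratic_profile_hessian:
  "partial_deriv i (partial_deriv j (quadratic_profile a b)) 0
    = (if i = a \<and> j = b then 1 else 0) + (if i = b \<and> j = a then 1 else 0)"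
proof -
  note d = smooth_diff smooth_mult smooth_add smooth_component smooth_const smooth_partial
      test_smooth[OF cutoff_test]
  have q1: "partial_deriv j (\<lambda>x. x $ a * x $ b) = (\<lambda>x. (if j = a then 1 else 0) * x $ b
      + x $ a * (if j = b then 1 else 0))"
    for j :: 'a
    by (rule ext) (simp add: partial_deriv_mult d partial_deriv_component)
  have p1: "partial_deriv j (quadratic_profile a b)
    = (\<lambda>x. ((if j = a then 1 else 0) * x $ b + x $ a * (if j = b then 1 else 0)) * cutoff x
        + x $ a * x $ b * partial_deriv j cutoff x)" for j
    unfolding quadratic_profile_def[abs_def]
    by (rule ext) (simp add: partial_deriv_mult d q1)
  have "partial_deriv i (\<lambda>x. ((if j = a then 1 else 0) * x $ b + x $ a * (if j
      = b then 1 else 0)) * cutoff x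
        + x $ a * x $ b * partial_deriv j cutoff x) 0
     = partial_deriv i (\<lambda>x. (if j = a then 1 else 0) * x $ b + x $ a * (if j = b then 1 else 0)) 0"
    by (subst partial_deriv_add, (intro d)+, subst partial_deriv_mult, (intro d)+,
        subst partial_deriv_mult, (intro d)+)
       (simp add: q1 cutoff_0)
  also have "\<dots> = (if j = a then 1 else 0) * (if i = b then 1 else 0) + (if i
      = a then 1 else 0) * (if j = b then 1 else 0)"
    by (subst partial_deriv_add, (intro d)+, subst partial_deriv_mult, (intro d)+,
        subst partial_deriv_mult, (intro d)+)
       (simp add: partial_deriv_component)
  finally have "partial_deriv i (partial_deriv j (quadratic_profile a b)) 0
      = (if j = a then 1 else 0) * (if i = b then 1 else 0) + (if i = a then 1 else 0) * (if j
          = b then 1 else 0)"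
    by (simp only: p1)
  then show ?thesis by (cases "i = a"; cases "j = b"; cases "i = b"; cases "j = a") simp_all
qed

lemma quadratic_test_hessian:
  "partial_deriv i (partial_deriv j (quadratic_test a b k)) x
    = partial_deriv i (partial_deriv j (quadratic_profile a b)) ((1 / real (Suc k)) *\<^sub>R x)"
proof -
  let ?c = "1 / real (Suc k)"
  have sm: "smooth (quadratic_profile a b)" by (rule test_smooth[OF quadratic_profile_test])
  have "iter_partial [i, j] (quadratic_test a b k) x
      = (real (Suc k))\<^sup>2 * (?c ^ 2 * iter_partial [i, j] (quadratic_profile a b) (?c *\<^sub>R x))"
    unfolding quadratic_test_def[abs_def]
    using iter_partial_affine[OF sm, of "[i, j]" ?c 0] smooth_affine[OF sm, of ?c 0]
    by (simp only: iter_partial_cmult add_0_right) (simp add: power2_eq_square)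
  also have "\<dots> = iter_partial [i, j] (quadratic_profile a b) (?c *\<^sub>R x)"
    by (simp add: power_divide)
  finally show ?thesis by (simp add: iter_partial_Cons)
qed

lemma quadratic_test_hessian_bound:
  "\<exists>C. \<forall>k i j x. \<bar>partial_deriv i (partial_deriv j (quadratic_test a b k)) x\<bar> \<le> C"
proof -
  obtain C where "\<And>i j x. (1 + norm x) ^ 0 * \<bar>partial_deriv j (partial_deriv i
      (quadratic_profile a b)) x\<bar> \<le> C"
    using schwartz_second_partials[OF test_schwartz[OF quadratic_profile_test]] by metis
  then show ?thesis unfolding quadratic_test_hessian by auto
qed

lemma quadratic_test_hessian_limit:
  "(\<lambda>k. partial_deriv i (partial_deriv j (quadratic_test a b k)) x) \<longlonglongrightarrow>
    (if i = a \<and> j = b then 1 else 0) + (if i = b \<and> j = a then 1 else 0)"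
  unfolding quadratic_test_hessian quadratic_profile_hessian[symmetric]
proof (rule isCont_tendsto_compose[of 0])
  show "isCont (partial_deriv i (partial_deriv j (quadratic_profile a b))) 0"
    by (intro differentiable_imp_continuous_within smooth_diff smooth_partial test_smooth
        quadratic_profile_test)
  have "(\<lambda>k. inverse (real (Suc k)) *\<^sub>R x) \<longlonglongrightarrow> 0 *\<^sub>R x"
    by (intro tendsto_scaleR LIMSEQ_inverse_real_of_nat tendsto_const)
  then show "(\<lambda>k. (1 / real (Suc k)) *\<^sub>R x) \<longlonglongrightarrow> 0" by (simp add: inverse_eq_divide)
qed

lemma sum_delta_pair:
  fixes f :: "'n::finite \<Rightarrow> 'n \<Rightarrow> real"
  shows "(\<Sum>i\<in>UNIV. \<Sum>j\<in>UNIV. f i j * ((if i = a \<and> j = b then 1 else 0) + (if i = b \<and> j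
      = a then 1 else 0)))
    = f a b + f b a"
proof -
  have e: "(\<Sum>i\<in>UNIV. \<Sum>j\<in>UNIV. f i j * (if i = a \<and> j = b then 1 else 0)) = f a b" for a b
  proof -
    have "(\<Sum>j\<in>UNIV. f i j * (if i = a \<and> j = b then 1 else 0)) = (if i = a then f a b else 0)" for i
      by (simp add: if_distrib cong: if_cong)
    then show ?thesis by simp
  qed
  show ?thesis by (simp add: distrib_left sum.distrib e)
qed

lemma hessian_pairing_quadratic_limit:
  fixes w :: "real^'n \<Rightarrow> real^'n"
  assumes w: "w \<in> L2_sigma"
  shows "(\<lambda>k. hessian_pairing w (quadratic_test a b k)) \<longlonglongrightarrow> 2 * (LINT x|lebesgue. w x $ a * w x $ b)"
proof -
  obtain C where C: "\<And>k i j x. \<bar>partial_deriv i (partial_deriv j (quadratic_test a b k)) x\<bar> \<le> C"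
    using quadratic_test_hessian_bound[of a b] by blast
  have "(\<Sum>i\<in>UNIV. \<Sum>j\<in>UNIV. LINT x|lebesgue. w x $ i * w x $ j *
        ((if i = a \<and> j = b then 1 else 0) + (if i = b \<and> j = a then 1 else 0)))
      = (LINT x|lebesgue. w x $ a * w x $ b) + (LINT x|lebesgue. w x $ b * w x $ a)"
    using sum_delta_pair[of "\<lambda>i j. LINT x|lebesgue. w x $ i * w x $ j" a b] by simp
  then show ?thesis
    using hessian_pairing_limit[OF w test_smooth[OF quadratic_test_test] C
        quadratic_test_hessian_limit]
    by (simp add: mult.commute)
qed

lemma laplacian_quadratic_limit:
  fixes a b :: "'n::finite"
  shows "(\<lambda>k. laplacian (quadratic_test a b k) x) \<longlonglongrightarrow> (if a = b then 2 else 0)"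
proof -
  have "(\<lambda>k. laplacian (quadratic_test a b k) x) \<longlonglongrightarrow>
      (\<Sum>i\<in>UNIV. (if i = a \<and> i = b then 1 else 0) + (if i = b \<and> i = a then 1 else 0))"
    unfolding laplacian_def by (intro tendsto_sum quadratic_test_hessian_limit)
  also have "(\<Sum>i\<in>UNIV. (if i = a \<and> i = b then 1 else 0) + (if i = b \<and> i = a then 1 else
      (0::real))) = (if a = b then 2 else 0)"
  proof -
    have "(if i = a \<and> i = b then 1 else 0) + (if i = b \<and> i = a then 1 else 0)
        = (if i = a then (if a = b then 2 else 0) else (0::real))" for i by auto
    then show ?thesis by simp
  qed
  finally show ?thesis .
qed

lemma laplacian_quadratic_bound:
  fixes a b :: "'n::finite"
  shows "\<exists>C. \<forall>k x. \<bar>laplacian (quadratic_test a b k) x\<bar> \<le> C"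
proof -
  obtain C where C: "\<And>k i j x. \<bar>partial_deriv i (partial_deriv j (quadratic_test a b k)) x\<bar> \<le> C"
    using quadratic_test_hessian_bound[of a b] by blast
  have "\<bar>laplacian (quadratic_test a b k) x\<bar> \<le> (\<Sum>i\<in>(UNIV::'n set). C)" for k x
    unfolding laplacian_def by (intro order_trans[OF sum_abs] sum_mono C)
  then show ?thesis by blast
qed

section \<open>Integrable pressure\<close>

text \<open>In the limit the Hessians of the quadratic test functions become $e_a\otimes
    e_b+e_b\otimes e_a$
  and their Laplacians $2\delta_{ab}$. Integrability of $|v(t)|^2$ and of $f(t)$ gives the
  majorants.\<close>

lemma second_moments_of_integrable_pressure:
  fixes v :: "real \<Rightarrow> real^'n \<Rightarrow> real^'n"
  assumes sol: "weak_solution \<nu> T v p" and f: "f \<in> L1_L1 T" and p: "has_density T p f"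
  shows "AE t in time T. \<forall>a b. (LINT x|lebesgue. v t x $ a * v t x $ b)
      = (if a = b then - (LINT x|lebesgue. f t x) else 0)"
proof -
  have v: "AE t in time T. v t \<in> L2_sigma"
    using sol by (simp add: weak_solution_def L1_L2_sigma_def)
  have ft: "AE t in time T. integrable lebesgue (f t)"
    using f by (intro fubini_spacetime(1)) (simp add: L1_L1_def)
  have eq: "AE t in time T. \<forall>a b k. p t (laplacian (quadratic_test a b k)) = - hessian_pairing
      (v t) (quadratic_test a b k)"
    unfolding AE_all_countable AE_finite_all[OF finite_class.finite_UNIV, simplified]
    by (intro allI pressure_equation[OF sol] quadratic_test_test)
  have half: "X = (if c then - L else 0)" if "- (2 * X) = L * (if c then 2 else 0)"
      for X L :: real and c
    using that by (cases c) auto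
  show ?thesis
    using v ft eq p[unfolded has_density_def]
  proof eventually_elim
    case (elim t)
    show ?case
    proof (intro allI)
      fix a b :: 'n
      obtain C where C: "\<And>k x. \<bar>laplacian (quadratic_test a b k) x\<bar> \<le> C"
        using laplacian_quadratic_bound[of a b] by blast
      have "(\<lambda>k. LINT x|lebesgue. f t x * laplacian (quadratic_test a b k) x)
          \<longlonglongrightarrow> (LINT x|lebesgue. f t x * (if a = b then 2 else 0))"
        by (rule integral_times_bounded_limit[OF elim(2) _ C laplacian_quadratic_limit])
           (intro smooth_lebesgue smooth_laplacian test_smooth quadratic_test_test)
      moreover have "(LINT x|lebesgue. f t x * laplacian (quadratic_test a b k) x)
          = - hessian_pairing (v t) (quadratic_test a b k)" for k
      proof -
        have "laplacian (quadratic_test a b k) \<in> schwartz"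
          by (intro test_schwartz laplacian_test quadratic_test_test)
        then have "p t (laplacian (quadratic_test a b k)) = (LINT x|lebesgue. f t x
            * laplacian (quadratic_test a b k) x)"
          using elim(4) by blast
        moreover have "p t (laplacian (quadratic_test a b k)) = - hessian_pairing (v t)
            (quadratic_test a b k)"
          using elim(3) by blast
        ultimately show ?thesis by (rule trans[OF sym])
      qed
      ultimately have "(\<lambda>k. - hessian_pairing (v t) (quadratic_test a b k))
          \<longlonglongrightarrow> (LINT x|lebesgue. f t x * (if a = b then 2 else 0))" by (simp only:)
      then have "- (2 * (LINT x|lebesgue. v t x $ a * v t x $ b)) = (LINT x|lebesgue. f t x *
          (if a = b then 2 else 0))"
        by (rule LIMSEQ_unique[OF tendsto_minus[OF hessian_pairing_quadratic_limit[OF elim(1)]]])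
      also have "\<dots> = (LINT x|lebesgue. f t x) * (if a = b then 2 else 0)"
        by (rule integral_mult_left_zero)
      finally show "(LINT x|lebesgue. v t x $ a * v t x $ b) = (if a = b then -
          (LINT x|lebesgue. f t x) else 0)"
        by (rule half)
    qed
  qed
qed

text \<open>The trace of the second moments is $\int|v(t)|^2$; a measurable set almost all of whose time
  sections are null is null.\<close>

lemma velocity_zero_of_second_moments:
  fixes v :: "real \<Rightarrow> real^'n \<Rightarrow> real^'n"
  assumes v: "v \<in> L1_L2_sigma T"
    and mom: "AE t in time T. \<forall>a. (LINT x|lebesgue. v t x $ a * v t x $ a) \<le> 0"
  shows "AE (t, x) in spacetime T. v t x = 0"
proof -
  let ?O = "{0<..<T} \<times> (UNIV :: (real^'n) set)"
  define S where "S = {z \<in> ?O. (case z of (t, x) \<Rightarrow> v t x) \<noteq> 0}"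
  have "(\<lambda>(t, x). v t x) \<in> borel_measurable (spacetime T)" using v by (simp add: L1_L2_sigma_def)
  from measurable_sets[OF this, of "- {0}"]
  have "(\<lambda>(t, x). v t x) -` (- {0}) \<inter> ?O \<in> sets (spacetime T)" by (simp add: space_restrict_space)
  also have "(\<lambda>(t, x). v t x) -` (- {0}) \<inter> ?O = S" by (auto simp: S_def)
  finally have S: "S \<in> sets lebesgue"
    by (subst (asm) sets_restrict_space_iff[OF time_sets(2)]) simp
  have "AE t in time T. AE x in lebesgue. v t x = 0"
    using mom v[unfolded L1_L2_sigma_def, simplified, THEN conjunct2, THEN conjunct1]
  proof eventually_elim
    case (elim t)
    have "AE x in lebesgue. v t x $ a = 0" for a
    proof -
      have i: "integrable lebesgue (\<lambda>x. v t x $ a * v t x $ a)" by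
          (rule L2_products_integrable[OF elim(2)])
      moreover have "(LINT x|lebesgue. v t x $ a * v t x $ a) \<ge> 0" by
          (intro integral_nonneg_AE) simp
      ultimately have "(LINT x|lebesgue. v t x $ a * v t x $ a) = 0" using elim(1) by
          (meson order_antisym)
      then show ?thesis using integral_nonneg_eq_0_iff_AE[OF i] by auto
    qed
    then have "AE x in lebesgue. \<forall>a. v t x $ a = 0"
      by (simp add: AE_finite_all[OF finite_class.finite_UNIV, simplified])
    then show ?case by eventually_elim (simp add: vec_eq_iff)
  qed
  then have "AE t in lebesgue. AE x in lebesgue. (t, x) \<notin> S"
    unfolding AE_time
  proof eventually_elim
    case (elim t)
    show ?case
    proof (cases "t \<in> {0<..<T}")
      case True
      then have "AE x in lebesgue. v t x = 0" using elim by blast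
      then show ?thesis by eventually_elim (simp add: S_def)
    next
      case False
      then have "(t, x) \<notin> S" for x by (auto simp: S_def)
      then show ?thesis by simp
    qed
  qed
  from AE_lebesgue_of_sections[OF S this] show ?thesis
    by (subst AE_restrict_space_iff[OF time_sets(2)]) (auto simp: S_def elim: eventually_mono)
qed

section \<open>The regularised pressure\<close>

lemma iter_partial_regularize:
  assumes "u \<in> tempered" "\<theta> \<in> schwartz" "c \<noteq> 0"
  shows "iter_partial is (regularize u c \<theta>) = regularize u c (iter_partial is \<theta>)"
  by (induction "is") (simp_all add: iter_partial_Cons regularize_partial schwartz_iter assms)

lemma regularize_smooth:
  assumes "u \<in> tempered" "\<theta> \<in> schwartz" "c \<noteq> 0"
  shows "smooth (regularize u c \<theta>)"
  unfolding smooth_def iter_partial_regularize[OF assms]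
  by (intro allI regularize_differentiable schwartz_iter assms)

lemma laplacian_schwartz: "\<psi> \<in> schwartz \<Longrightarrow> laplacian \<psi> \<in> schwartz"
  unfolding laplacian_def[abs_def] by (intro schwartz_sum schwartz_partial)

lemma laplacian_regularize:
  assumes "u \<in> tempered" "\<theta> \<in> schwartz" "c \<noteq> 0"
  shows "laplacian (regularize u c \<theta>) = regularize u c (laplacian \<theta>)"
proof
  fix x
  have "laplacian (regularize u c \<theta>) x = (\<Sum>i\<in>UNIV. regularize u c (partial_deriv i
      (partial_deriv i \<theta>)) x)"
    by (simp add: laplacian_def regularize_partial schwartz_partial assms)
  also have "\<dots> = regularize u c (laplacian \<theta>) x"
    unfolding regularize_def laplacian_def
    by (rule tempered_sum[symmetric, OF assms(1)]) (intro schwartz_affine schwartz_partial assms)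
  finally show "laplacian (regularize u c \<theta>) x = regularize u c (laplacian \<theta>) x" .
qed

lemma iter_partial_laplacian:
  "smooth f \<Longrightarrow> iter_partial is (laplacian f) x = (\<Sum>i\<in>UNIV. iter_partial (is @ [i, i]) f x)"
  unfolding laplacian_def[abs_def]
  by (simp add: iter_partial_sum smooth_partial iter_partial_append iter_partial_Cons)

lemma laplacian_diff:
  "smooth f \<Longrightarrow> smooth g \<Longrightarrow> laplacian (\<lambda>x. f x - g x) = (\<lambda>x. laplacian f x - laplacian g x)"
  using iter_partial_diff[of f g "[i, i]" for i]
  by (auto simp: laplacian_def fun_eq_iff iter_partial_Cons sum_subtractf)

text \<open>Both sides are continuous under the convergence of $\psi\,\sigma(\cdot/k)$ to $\psi$ in the
  Schwartz space: the left side because \<open>u\<close> is tempered, the right side because the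
  products $w_iw_j$ are integrable and the second derivatives converge boundedly.\<close>

lemma pressure_equation_schwartz:
  fixes w :: "real^'n \<Rightarrow> real^'n"
  assumes u: "u \<in> tempered" and w: "w \<in> L2_sigma" and \<psi>: "\<psi> \<in> schwartz"
    and eq: "\<And>k. u (laplacian (\<lambda>y. \<psi> y * cutoff ((1 / Suc k) *\<^sub>R y)))
        = - hessian_pairing w (\<lambda>y. \<psi> y * cutoff ((1 / Suc k) *\<^sub>R y))"
  shows "u (laplacian \<psi>) = - hessian_pairing w \<psi>"
proof -
  define \<Psi> where "\<Psi> k y = \<psi> y * cutoff ((1 / Suc k) *\<^sub>R y)" for k y
  have sm: "smooth \<psi>" by (rule schwartz_smooth[OF \<psi>])
  have \<Psi>: "\<Psi> k \<in> test_functions" for k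
    unfolding \<Psi>_def[abs_def] by (rule cutoff_mult_test[OF sm])
  note \<Psi>s = test_smooth[OF \<Psi>]
  have conv: "\<exists>C. \<forall>k y. (1 + norm y) ^ m * \<bar>iter_partial is (\<lambda>x. \<Psi> k x - \<psi> x) y\<bar> \<le> C / Suc k"
      for m "is"
    unfolding \<Psi>_def by (rule cutoff_converges[OF \<psi>])
  have "(\<lambda>k. u (laplacian (\<Psi> k))) \<longlonglongrightarrow> u (laplacian \<psi>)"
  proof (rule tempered_tendsto[OF u laplacian_schwartz[OF \<psi>]])
    show "\<forall>\<^sub>F k in sequentially. laplacian (\<Psi> k) \<in> schwartz"
      by (intro always_eventually allI test_schwartz laplacian_test \<Psi>)
    show "(\<lambda>k. 1 / real (Suc k)) \<longlonglongrightarrow> 0"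
      using LIMSEQ_inverse_real_of_nat by (simp add: inverse_eq_divide)
    fix m and il :: "'n list"
    have "\<forall>i. \<exists>C. \<forall>k y. (1 + norm y) ^ m * \<bar>iter_partial (il @ [i, i]) (\<lambda>x. \<Psi> k x - \<psi> x) y\<bar>
        \<le> C / Suc k"
      using conv by blast
    then obtain C where C: "\<And>i k y. (1 + norm y) ^ m * \<bar>iter_partial (il @ [i, i]) (\<lambda>x. \<Psi> k x
        - \<psi> x) y\<bar> \<le> C i / Suc k"
      by metis
    have "(1 + norm y) ^ m * \<bar>iter_partial il (\<lambda>x. laplacian (\<Psi> k) x - laplacian \<psi> x) y\<bar>
        \<le> (\<Sum>i\<in>UNIV. C i) * (1 / real (Suc k))" for k y
    proof -
      have "iter_partial il (\<lambda>x. laplacian (\<Psi> k) x - laplacian \<psi> x) y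
          = (\<Sum>i\<in>UNIV. iter_partial (il @ [i, i]) (\<lambda>x. \<Psi> k x - \<psi> x) y)"
        unfolding laplacian_diff[OF \<Psi>s sm, symmetric]
        by (rule iter_partial_laplacian[OF smooth_minus[OF \<Psi>s sm]])
      then have "(1 + norm y) ^ m * \<bar>iter_partial il (\<lambda>x. laplacian (\<Psi> k) x - laplacian \<psi> x) y\<bar>
          \<le> (1 + norm y) ^ m * (\<Sum>i\<in>UNIV. \<bar>iter_partial (il @ [i, i]) (\<lambda>x. \<Psi> k x - \<psi> x) y\<bar>)"
        by (simp only:) (intro mult_left_mono sum_abs, simp)
      also have "\<dots> \<le> (\<Sum>i\<in>UNIV. C i / Suc k)"
        unfolding sum_distrib_left by (intro sum_mono C)
      finally show ?thesis by (simp add: sum_divide_distrib)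
    qed
    then show "\<exists>C. \<forall>\<^sub>F k in sequentially. \<forall>x. (1 + norm x) ^ m * \<bar>iter_partial il
        (\<lambda>x. laplacian (\<Psi> k) x - laplacian \<psi> x) x\<bar>
        \<le> C * (1 / real (Suc k))"
      by (intro exI[of _ "\<Sum>i\<in>UNIV. C i"] always_eventually allI)
  qed
  moreover have "(\<lambda>k. hessian_pairing w (\<Psi> k)) \<longlonglongrightarrow> hessian_pairing w \<psi>"
  proof -
    have "\<forall>p. \<exists>C. \<forall>k y. (1 + norm y) ^ 0 * \<bar>iter_partial [fst p, snd p] (\<lambda>x. \<Psi> k x - \<psi> x) y\<bar>
        \<le> C / Suc k"
      using conv by blast
    then obtain C where "\<And>p k y. (1 + norm y) ^ 0 * \<bar>iter_partial [fst p, snd p] (\<lambda>x. \<Psi> k x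
        - \<psi> x) y\<bar> \<le> C p / Suc k"
      by metis
    from this[of _ "(i, j)" for i j]
    have C: "\<bar>partial_deriv i (partial_deriv j (\<Psi> k)) y - partial_deriv i
        (partial_deriv j \<psi>) y\<bar> \<le> C (i, j) / Suc k" for i j k y
      by (simp add: iter_partial_diff[OF \<Psi>s sm]) (simp add: iter_partial_Cons)
    obtain D where D: "D \<ge> 0" "\<And>i j x. (1 + norm x) ^ 0 * \<bar>partial_deriv j
        (partial_deriv i \<psi>) x\<bar> \<le> D"
      using schwartz_second_partials[OF \<psi>] by blast
    have C0: "C (i, j) \<ge> 0" for i j
      using order_trans[OF abs_ge_zero C[of i j 0 0]] by simp
    have "\<bar>partial_deriv i (partial_deriv j (\<Psi> k)) x\<bar> \<le> C (i, j) + D" for k i j x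
    proof -
      have "C (i, j) / Suc k \<le> C (i, j)" using C0[of i j] by (simp add: field_simps)
      then show ?thesis using C[of i j k x] D(2)[of x i j] by simp
    qed
    moreover have "(\<lambda>k. partial_deriv i (partial_deriv j (\<Psi> k)) x) \<longlonglongrightarrow> partial_deriv i
        (partial_deriv j \<psi>) x" for i j x
    proof (rule LIM_zero_cancel, rule Lim_null_comparison)
      show "\<forall>\<^sub>F k in sequentially. norm (partial_deriv i (partial_deriv j (\<Psi> k)) x
          - partial_deriv i (partial_deriv j \<psi>) x) \<le> C (i, j) * inverse (real (Suc k))"
        using C by (auto simp: divide_inverse)
      show "(\<lambda>k. C (i, j) * inverse (real (Suc k))) \<longlonglongrightarrow> 0"
        using tendsto_mult_right_zero[OF LIMSEQ_inverse_real_of_nat] by simp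
    qed
    ultimately have "(\<lambda>k. hessian_pairing w (\<Psi> k)) \<longlonglongrightarrow>
        (\<Sum>i\<in>UNIV. \<Sum>j\<in>UNIV. LINT x|lebesgue. w x $ i * w x $ j * partial_deriv i
            (partial_deriv j \<psi>) x)"
      by (intro hessian_pairing_limit[OF w \<Psi>s])
    also have "(\<Sum>i\<in>UNIV. \<Sum>j\<in>UNIV. LINT x|lebesgue. w x $ i * w x $ j * partial_deriv i
        (partial_deriv j \<psi>) x)
        = hessian_pairing w \<psi>"
      by (rule hessian_pairing_sum[symmetric, OF w sm]) (use D(2) in simp)
    finally show ?thesis .
  qed
  then have "(\<lambda>k. - hessian_pairing w (\<Psi> k)) \<longlonglongrightarrow> - hessian_pairing w \<psi>"
    by (rule tendsto_minus)
  moreover have "u (laplacian (\<Psi> k)) = - hessian_pairing w (\<Psi> k)" for k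
    unfolding \<Psi>_def[abs_def] by (rule eq)
  ultimately show ?thesis by (simp add: LIMSEQ_unique)
qed

text \<open>The right side of the pressure equation for the translates
    and dilates of a fixed function, with
  the factor $c^2$ from the chain rule removed.\<close>

definition stress_regularized :: "(real^'n \<Rightarrow> real^'n) \<Rightarrow> real \<Rightarrow>
    (real^'n \<Rightarrow> real) \<Rightarrow> real^'n \<Rightarrow> real" where
  "stress_regularized w c \<theta> x = (\<Sum>i\<in>UNIV. \<Sum>j\<in>UNIV.
     LINT y|lebesgue. w y $ i * w y $ j * partial_deriv i (partial_deriv j \<theta>) (c *\<^sub>R y + x))"

lemma affine_second_partial:
  assumes "smooth \<theta>"
  shows "partial_deriv i (partial_deriv j (\<lambda>y. \<theta> (c *\<^sub>R y + x))) = (\<lambda>y. c\<^sup>2 * partial_deriv i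
      (partial_deriv j \<theta>) (c *\<^sub>R y + x))"
  using iter_partial_affine[OF assms, of "[i, j]" c x] by
      (simp add: iter_partial_Cons power2_eq_square)

context
  fixes w :: "real^'n \<Rightarrow> real^'n" and \<theta> :: "real^'n \<Rightarrow> real"
  assumes w: "w \<in> L2_sigma" and \<theta>: "\<theta> \<in> schwartz"
begin

lemma second_partials_bound: "\<exists>D\<ge>0. \<forall>i j x. \<bar>partial_deriv i (partial_deriv j \<theta>) x\<bar> \<le> D"
  using schwartz_second_partials[OF \<theta>, of 0] by simp metis

lemma second_partials_affine_measurable:
  "(\<lambda>y. partial_deriv i (partial_deriv j \<theta>) (c *\<^sub>R y + x)) \<in> borel_measurable lebesgue"
  by (intro smooth_lebesgue smooth_affine smooth_partial schwartz_smooth \<theta>)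

lemma second_partials_continuous: "isCont (partial_deriv i (partial_deriv j \<theta>)) x"
  by (intro differentiable_imp_continuous_within smooth_diff smooth_partial schwartz_smooth \<theta>)

lemma hessian_pairing_affine:
  "hessian_pairing w (\<lambda>y. \<theta> (c *\<^sub>R y + x)) = c\<^sup>2 * stress_regularized w c \<theta> x"
proof -
  obtain D where D: "\<And>i j x. \<bar>partial_deriv i (partial_deriv j \<theta>) x\<bar> \<le> D"
    using second_partials_bound by blast
  have "hessian_pairing w (\<lambda>y. \<theta> (c *\<^sub>R y + x)) = (\<Sum>i\<in>UNIV. \<Sum>j\<in>UNIV.
      LINT y|lebesgue. w y $ i * w y $ j * partial_deriv i (partial_deriv j (\<lambda>y. \<theta> (c *\<^sub>R y
          + x))) y)"
  proof (rule hessian_pairing_sum[OF w])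
    show "smooth (\<lambda>y. \<theta> (c *\<^sub>R y + x))" by (intro smooth_affine schwartz_smooth \<theta>)
    show "\<bar>partial_deriv i (partial_deriv j (\<lambda>y. \<theta> (c *\<^sub>R y + x))) y\<bar> \<le> c\<^sup>2 * D" for i j y
      unfolding affine_second_partial[OF schwartz_smooth[OF \<theta>]] abs_mult by
          (simp add: mult_left_mono D)
  qed
  also have "\<dots> = c\<^sup>2 * stress_regularized w c \<theta> x"
    unfolding affine_second_partial[OF schwartz_smooth[OF \<theta>]] stress_regularized_def
    by (simp add: sum_distrib_left mult.left_commute[of _ "c\<^sup>2"])
  finally show ?thesis .
qed

lemma stress_regularized_limit:
  assumes "\<And>y. (\<lambda>k. c k *\<^sub>R y + x k) \<longlonglongrightarrow> l y"
  shows "(\<lambda>k. stress_regularized w (c k) \<theta> (x k)) \<longlonglongrightarrow>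
    (\<Sum>i\<in>UNIV. \<Sum>j\<in>UNIV. LINT y|lebesgue. w y $ i * w y $ j * partial_deriv i
        (partial_deriv j \<theta>) (l y))"
proof -
  obtain D where D: "\<And>i j x. \<bar>partial_deriv i (partial_deriv j \<theta>) x\<bar> \<le> D"
    using second_partials_bound by blast
  show ?thesis
    unfolding stress_regularized_def
    by (intro tendsto_sum integral_times_bounded_limit[OF L2_products_integrable[OF w], where C=D]
        second_partials_affine_measurable D isCont_tendsto_compose[OF
            second_partials_continuous] assms)
qed

lemma stress_regularized_continuous: "continuous_on UNIV (stress_regularized w c \<theta>)"
proof (rule continuous_on_sequentiallyI)
  fix x :: "nat \<Rightarrow> real^'n" and a
  assume "x \<longlonglongrightarrow> a"
  then have "(\<lambda>k. c *\<^sub>R y + x k) \<longlonglongrightarrow> c *\<^sub>R y + a" for y by (intro tendsto_intros)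
  from stress_regularized_limit[OF this]
  show "(\<lambda>k. stress_regularized w c \<theta> (x k)) \<longlonglongrightarrow> stress_regularized w c \<theta> a"
    by (simp add: stress_regularized_def[symmetric])
qed

lemma stress_regularized_bound: "\<exists>C. \<forall>c x. \<bar>stress_regularized w c \<theta> x\<bar> \<le> C"
proof -
  obtain D where D: "D \<ge> 0" "\<And>i j x. \<bar>partial_deriv i (partial_deriv j \<theta>) x\<bar> \<le> D"
    using second_partials_bound by blast
  have "\<bar>stress_regularized w c \<theta> x\<bar> \<le> (\<Sum>i\<in>UNIV. \<Sum>j\<in>UNIV. LINT y|lebesgue. \<bar>w y $ i * w y $ j\<bar>
      * D)" for c x
    unfolding stress_regularized_def
  proof (intro order_trans[OF sum_abs] sum_mono order_trans[OF integral_abs_bound] integral_mono)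
    show "integrable lebesgue (\<lambda>y. \<bar>w y $ i * w y $ j * partial_deriv i (partial_deriv j \<theta>)
        (c *\<^sub>R y + x)\<bar>)" for i j
      by (intro integrable_abs integrable_times_bounded[OF L2_products_integrable[OF w]
          second_partials_affine_measurable D(2)])
    show "integrable lebesgue (\<lambda>y. \<bar>w y $ i * w y $ j\<bar> * D)" for i j
      by (intro integrable_mult_left integrable_abs L2_products_integrable w)
    show "\<bar>w y $ i * w y $ j * partial_deriv i (partial_deriv j \<theta>) (c *\<^sub>R y + x)\<bar> \<le> \<bar>w y $ i
        * w y $ j\<bar> * D" for i j y
      unfolding abs_mult[of "w y $ i * w y $ j"] by (intro mult_left_mono D(2)) simp
  qed
  then show ?thesis by blast
qed

text \<open>The factor $c^2$ produced by the two derivatives is the same on both sides of the pressure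
  equation and cancels. The equation is assumed for cut-off functions with translations in a dense
  set only, because at almost every time it is available for countably many test functions; both
  sides are continuous in the translation.\<close>

lemma laplacian_regularize_stress:
  assumes u: "u \<in> tempered" and c: "c \<noteq> 0"
    and D: "\<And>U. open U \<Longrightarrow> U \<noteq> {} \<Longrightarrow> \<exists>d\<in>D. d \<in> U"
    and eq: "\<And>z k. z \<in> D \<Longrightarrow> u (laplacian (\<lambda>y. \<theta> (c *\<^sub>R y + z) * cutoff ((1 / Suc k) *\<^sub>R y)))
        = - hessian_pairing w (\<lambda>y. \<theta> (c *\<^sub>R y + z) * cutoff ((1 / Suc k) *\<^sub>R y))"
  shows "laplacian (regularize u c \<theta>) x = - stress_regularized w c \<theta> x"
proof -
  let ?d = "\<lambda>x. laplacian (regularize u c \<theta>) x + stress_regularized w c \<theta> x"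
  have onD: "?d z = 0" if z: "z \<in> D" for z
  proof -
    have "u (laplacian (\<lambda>y. \<theta> (c *\<^sub>R y + z))) = - hessian_pairing w (\<lambda>y. \<theta> (c *\<^sub>R y + z))"
      by (rule pressure_equation_schwartz[OF u w schwartz_affine[OF \<theta> c] eq[OF z]])
    moreover have "laplacian (\<lambda>y. \<theta> (c *\<^sub>R y + z)) = (\<lambda>y. c\<^sup>2 * laplacian \<theta> (c *\<^sub>R y + z))"
      unfolding laplacian_def[abs_def] affine_second_partial[OF schwartz_smooth[OF \<theta>]]
      by (simp add: sum_distrib_left)
    moreover have "u (\<lambda>y. c\<^sup>2 * laplacian \<theta> (c *\<^sub>R y + z)) = c\<^sup>2 * regularize u c (laplacian \<theta>) z"
      unfolding regularize_def by (intro tempered_cmult u schwartz_affine laplacian_schwartz \<theta> c)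
    ultimately have "c\<^sup>2 * regularize u c (laplacian \<theta>) z = c\<^sup>2 * (- stress_regularized w c \<theta> z)"
      by (simp add: hessian_pairing_affine)
    then have "regularize u c (laplacian \<theta>) z = - stress_regularized w c \<theta> z"
      using c by (subst (asm) mult_cancel_left) simp
    then show ?thesis by (simp add: laplacian_regularize[OF u \<theta> c])
  qed
  have "continuous_on UNIV ?d"
    by (intro continuous_intros stress_regularized_continuous smooth_continuous
        smooth_laplacian regularize_smooth u \<theta> c)
  then have "open (?d -` (- {0}))" by (intro open_vimage) auto
  then have "?d -` (- {0}) = {}" using D onD by force
  then show ?thesis by (auto simp: add_eq_0_iff2 vimage_def)
qed

end

section \<open>Decay of the regularised pressure in a Hardy space\<close>

lemma regularize_eq_convolve:
  fixes \<phi> :: "real^'n \<Rightarrow> real"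
  assumes u: "u \<in> tempered" and \<phi>: "\<phi> \<in> schwartz" and R: "R > 0"
  shows "regularize u (- 1 / R) \<phi> x = R ^ CARD('n) * convolve u (dilate \<phi> R) (R *\<^sub>R x)"
proof -
  have "(\<lambda>y. dilate \<phi> R (R *\<^sub>R x - y)) = (\<lambda>y. (1 / R ^ CARD('n)) * \<phi> ((- 1 / R) *\<^sub>R y + x))"
    using R by (auto simp: dilate_def scaleR_diff_right divide_inverse)
  then have "convolve u (dilate \<phi> R) (R *\<^sub>R x) = (1 / R ^ CARD('n)) * u (\<lambda>y. \<phi>
      ((- 1 / R) *\<^sub>R y + x))"
    unfolding convolve_def using R by (simp only:) (intro tempered_cmult u schwartz_affine \<phi>, auto)
  then show ?thesis using R by (simp add: regularize_def)
qed

text \<open>Replacing the extended maximal function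
    by a real representative: it is finite almost everywhere
  because its power \<open>q\<close> has finite integral.\<close>

lemma hardy_majorant:
  fixes \<phi> :: "real^'n \<Rightarrow> real"
  assumes u: "u \<in> hardy \<phi> q" and q: "0 < q"
  obtains g where "integrable lebesgue g" "\<And>y. g y \<ge> 0"
    "AE y in lebesgue. \<forall>R>0. \<bar>convolve u (dilate \<phi> R) y\<bar> powr q \<le> g y"
proof -
  let ?M = "maximal_fun \<phi> u"
  define g where "g y = enn2real (?M y) powr q" for y
  have m[measurable]: "?M \<in> borel_measurable lebesgue" using u by (simp add: hardy_def)
  have "hardy_norm \<phi> q u < top" using u by (simp add: hardy_def)
  then have fin: "(\<integral>\<^sup>+ x. ennreal_powr (?M x) q \<partial>lebesgue) \<noteq> top"
    by (auto simp: hardy_norm_def ennreal_powr_def split: if_splits)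
  have mp: "(\<lambda>x. ennreal_powr (?M x) q) \<in> borel_measurable lebesgue"
    unfolding ennreal_powr_def by measurable
  have "AE x in lebesgue. ennreal_powr (?M x) q \<noteq> \<infinity>"
    by (rule nn_integral_PInf_AE[OF mp]) (use fin in simp)
  then have fM: "AE x in lebesgue. ?M x \<noteq> top"
    by eventually_elim (auto simp: ennreal_powr_def)
  have gm: "g \<in> borel_measurable lebesgue" unfolding g_def by measurable
  have "(\<integral>\<^sup>+ x. ennreal (g x) \<partial>lebesgue) = (\<integral>\<^sup>+ x. ennreal_powr (?M x) q \<partial>lebesgue)"
    by (rule nn_integral_cong_AE) (use fM in eventually_elim, simp add: g_def ennreal_powr_def)
  then have "integrable lebesgue g"
    using fin by (intro integrableI_nonneg gm) (auto simp: g_def less_top)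
  moreover have "g y \<ge> 0" for y by (simp add: g_def)
  moreover have "AE y in lebesgue. \<forall>R>0. \<bar>convolve u (dilate \<phi> R) y\<bar> powr q \<le> g y"
    using fM
  proof eventually_elim
    case (elim y)
    show ?case
    proof (intro allI impI)
      fix R :: real assume "R > 0"
      then have "ennreal \<bar>convolve u (dilate \<phi> R) y\<bar> \<le> ?M y"
        unfolding maximal_fun_def by (intro SUP_upper) simp
      also have "?M y = ennreal (enn2real (?M y))" using elim by (simp add: less_top)
      finally have "\<bar>convolve u (dilate \<phi> R) y\<bar> \<le> enn2real (?M y)" by (simp add: ennreal_le_iff)
      then show "\<bar>convolve u (dilate \<phi> R) y\<bar> powr q \<le> g y"
        unfolding g_def using q by (intro powr_mono2) auto
    qed
  qed
  ultimately show ?thesis by (rule that)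
qed

text \<open>The substitution $y=Rx$ costs $R^{-N}$ and the bound
    by the maximal function costs $R^{Nq}$; the
  product is at most \<open>1\<close> because $q\le1\le R$.\<close>

lemma regularize_Lq_bound:
  fixes \<phi> :: "real^'n \<Rightarrow> real"
  assumes u: "u \<in> tempered" and \<phi>: "\<phi> \<in> schwartz" and R: "R \<ge> 1" and q: "0 < q" "q \<le> 1"
    and g: "integrable lebesgue g" "\<And>y. g y \<ge> 0"
    and maj: "AE y in lebesgue. \<forall>R>0. \<bar>convolve u (dilate \<phi> R) y\<bar> powr q \<le> g y"
    and A: "A \<in> sets borel"
  shows "integrable lebesgue (\<lambda>x. indicator A x * \<bar>regularize u (- 1 / R) \<phi> x\<bar> powr q)"
    and "(LINT x|lebesgue. indicator A x * \<bar>regularize u (- 1 / R) \<phi> x\<bar> powr q)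
      \<le> (LINT y|lebesgue. indicator A ((1 / R) *\<^sub>R y) * g y)"
proof -
  let ?N = "CARD('n)"
  let ?F = "regularize u (- 1 / R) \<phi>"
  define h where "h x = indicator A x * \<bar>?F x\<bar> powr q" for x
  have sm: "smooth ?F" using R by (intro regularize_smooth u \<phi>) auto
  have cq: "continuous_on UNIV (\<lambda>x. \<bar>?F x\<bar> powr q)"
    using q by (intro continuous_on_powr' continuous_intros smooth_continuous sm) auto
  have h[measurable]: "h \<in> borel_measurable borel"
    unfolding h_def by (intro borel_measurable_times borel_measurable_indicator A
        borel_measurable_continuous_onI cq)
  have hR: "(\<lambda>y. h (0 + (1 / R) *\<^sub>R y)) \<in> borel_measurable borel" by measurable
  have indm: "(\<lambda>y. indicator A ((1 / R) *\<^sub>R y) :: real) \<in> borel_measurable lebesgue"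
    by (intro measurable_completion measurable_compose[OF _ borel_measurable_indicator[OF A]]) simp
  have ig: "integrable lebesgue (\<lambda>y. indicator A ((1 / R) *\<^sub>R y) * g y)"
    using integrable_times_bounded[OF g(1) indm, of 1] by (simp add: mult.commute indicator_def)
  have le: "AE y in lebesgue. h (0 + (1 / R) *\<^sub>R y) \<le> (R ^ ?N) powr q * (indicator A
      ((1 / R) *\<^sub>R y) * g y)"
    using maj
  proof eventually_elim
    case (elim y)
    have "\<bar>?F ((1 / R) *\<^sub>R y)\<bar> = R ^ ?N * \<bar>convolve u (dilate \<phi> R) y\<bar>"
      using regularize_eq_convolve[OF u \<phi>, of R "(1 / R) *\<^sub>R y"] R by (simp add: abs_mult)
    then have "\<bar>?F ((1 / R) *\<^sub>R y)\<bar> powr q = (R ^ ?N) powr q * \<bar>convolve u (dilate \<phi> R) y\<bar> powr q"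
      using R by (simp add: powr_mult)
    also have "\<dots> \<le> (R ^ ?N) powr q * g y" using elim R by (intro mult_left_mono) auto
    finally show ?case by (auto simp: h_def indicator_def)
  qed
  have ihR: "integrable lebesgue (\<lambda>y. h (0 + (1 / R) *\<^sub>R y))"
  proof (rule Bochner_Integration.integrable_bound)
    show "integrable lebesgue (\<lambda>y. (R ^ ?N) powr q * (indicator A ((1 / R) *\<^sub>R y) * g y))"
      using ig by (rule integrable_mult_right)
    show "(\<lambda>y. h (0 + (1 / R) *\<^sub>R y)) \<in> borel_measurable lebesgue"
      using hR by (intro measurable_completion) simp
    show "AE y in lebesgue. norm (h (0 + (1 / R) *\<^sub>R y)) \<le> norm ((R ^ ?N) powr q *
        (indicator A ((1 / R) *\<^sub>R y) * g y))"
      using le by eventually_elim (use g(2) in \<open>auto simp: h_def indicator_def\<close>)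
  qed
  have "integrable lborel h"
  proof -
    have "integrable lborel (\<lambda>y. h (0 + (1 / R) *\<^sub>R y))"
      using ihR integrable_lebesgue_borel[OF hR] by simp
    then have "integrable (distr lborel borel (\<lambda>y. 0 + (1 / R) *\<^sub>R y)) h"
      by (subst integrable_distr_eq) auto
    then have "integrable (density (distr lborel borel (\<lambda>y. 0 + (1 / R) *\<^sub>R y))
        (\<lambda>_. \<bar>1 / R\<bar> ^ DIM(real^'n))) h"
      by (subst integrable_density) auto
    then show ?thesis using lborel_affine[of "1 / R" "0::real^'n"] R by simp
  qed
  then show "integrable lebesgue (\<lambda>x. indicator A x * \<bar>?F x\<bar> powr q)"
    unfolding h_def[symmetric] using integrable_lebesgue_borel[OF h] by simp
  have "(LINT x|lebesgue. h x) = (1 / R) ^ ?N * (LINT y|lebesgue. h (0 + (1 / R) *\<^sub>R y))"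
    using integral_affine[OF h, of "1 / R" 0] R by simp
  also have "\<dots> \<le> (1 / R) ^ ?N * (LINT y|lebesgue. (R ^ ?N) powr q * (indicator A
      ((1 / R) *\<^sub>R y) * g y))"
    using R by (intro mult_left_mono integral_mono_AE ihR integrable_mult_right ig le) auto
  also have "\<dots> = ((1 / R) ^ ?N * (R ^ ?N) powr q) * (LINT y|lebesgue. indicator A
      ((1 / R) *\<^sub>R y) * g y)"
    by simp
  also have "\<dots> \<le> 1 * (LINT y|lebesgue. indicator A ((1 / R) *\<^sub>R y) * g y)"
  proof (rule mult_right_mono)
    have "(R ^ ?N) powr q \<le> (R ^ ?N) powr 1" using R q by (intro powr_mono) auto
    then show "(1 / R) ^ ?N * (R ^ ?N) powr q \<le> 1" using R by
        (simp add: power_one_over divide_simps)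
    show "0 \<le> (LINT y|lebesgue. indicator A ((1 / R) *\<^sub>R y) * g y)"
      using g(2) by (intro integral_nonneg_AE) simp
  qed
  finally show "(LINT x|lebesgue. indicator A x * \<bar>?F x\<bar> powr q)
      \<le> (LINT y|lebesgue. indicator A ((1 / R) *\<^sub>R y) * g y)" by (simp add: h_def)
qed

text \<open>The sets $\{|y|\ge d(k+1)\}$ shrink to the empty set.\<close>

lemma integral_far_tendsto_0:
  fixes g :: "real^'n \<Rightarrow> real"
  assumes g: "integrable lebesgue g" and d: "d > 0"
  shows "(\<lambda>k. LINT y|lebesgue. g y * indicator {y. d \<le> norm ((1 / real (Suc k)) *\<^sub>R y)} y) \<longlonglongrightarrow> 0"
proof -
  have "(\<lambda>k. LINT y|lebesgue. g y * indicator {y. d \<le> norm ((1 / real (Suc k)) *\<^sub>R y)} y) \<longlonglongrightarrow>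
      (LINT y|lebesgue. g y * 0)"
  proof (rule integral_times_bounded_limit[OF g])
    have "closed {y::real^'n. d \<le> norm ((1 / real (Suc k)) *\<^sub>R y)}" for k
      by (intro closed_Collect_le continuous_intros)
    then show "indicator {y::real^'n. d \<le> norm ((1 / real
        (Suc k)) *\<^sub>R y)} \<in> borel_measurable lebesgue" for k
      by (intro measurable_completion borel_measurable_indicator) (simp add: borel_closed)
    show "\<bar>indicator {y. d \<le> norm ((1 / real (Suc k)) *\<^sub>R y)} y :: real\<bar> \<le> 1" for k
        and y :: "real^'n"
      by (simp add: indicator_def)
    fix y :: "real^'n"
    have "(\<lambda>k. norm (inverse (real (Suc k)) *\<^sub>R y)) \<longlonglongrightarrow> norm (0 *\<^sub>R y)"
      by (intro tendsto_norm tendsto_scaleR LIMSEQ_inverse_real_of_nat tendsto_const)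
    then have "\<forall>\<^sub>F k in sequentially. norm (inverse (real (Suc k)) *\<^sub>R y) < d"
      using d by (intro order_tendstoD(2)) auto
    then have "\<forall>\<^sub>F k in sequentially. indicator {y. d \<le> norm ((1 / real (Suc k)) *\<^sub>R y)} y =
        (0::real)"
      by (rule eventually_mono) (simp add: inverse_eq_divide)
    then show "(\<lambda>k. indicator {y. d \<le> norm ((1 / real (Suc k)) *\<^sub>R y)} y :: real) \<longlonglongrightarrow> 0"
      by (rule tendsto_eventually)
  qed
  then show ?thesis by simp
qed

lemma laplacian_eq_0_near:
  assumes "\<And>x. norm x < d \<Longrightarrow> \<eta> x = 0" "norm x < d"
  shows "laplacian \<eta> x = 0"
proof -
  have "{x. \<eta> x \<noteq> 0} \<subseteq> - ball 0 d" using assms(1) by auto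
  then have "supp \<eta> \<subseteq> - ball 0 d" unfolding supp_def by (rule closure_minimal)
      (simp add: closed_def)
  then have "x \<notin> supp \<eta>" using assms(2) by auto
  then have "x \<notin> supp (partial_deriv i \<eta>)" for i using supp_partial[of i \<eta>] by blast
  then show ?thesis by (simp add: laplacian_def partial_deriv_eq_0)
qed

text \<open>Bounded Laplacians and the uniform $L^q$ bound give a bound \<open>B\<close> for all
  regularisations at once. Where $\Delta\eta$ does not vanish one is away from the origin, and
  there $|F|\le B^{1-q}|F|^q$ with $\int_{|x|\ge d}|F|^q\to0$. For $q=1$ the restriction $|x|\ge
  d$ is essential: the integral of $|F|$ over the whole space stays bounded but need not become
  small.\<close>

lemma regularize_pairing_tendsto_0:
  fixes \<phi> :: "real^'n \<Rightarrow> real"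
  assumes u: "u \<in> hardy \<phi> q" and q: "0 < q" "q \<le> 1" and \<phi>: "\<phi> \<in> schwartz"
    and C: "\<And>k x. \<bar>laplacian (regularize u (- 1 / real (Suc k)) \<phi>) x\<bar> \<le> C"
    and \<eta>: "\<eta> \<in> test_functions" and d: "d > 0" "\<And>x. norm x < d \<Longrightarrow> \<eta> x = 0"
  shows "(\<lambda>k. LINT x|lebesgue. regularize u (- 1 / real (Suc k)) \<phi> x * laplacian \<eta> x) \<longlonglongrightarrow> 0"
proof -
  have ut: "u \<in> tempered" using u by (simp add: hardy_def)
  define F where "F k = regularize u (- 1 / real (Suc k)) \<phi>" for k
  have smF: "smooth (F k)" for k unfolding F_def by (intro regularize_smooth ut \<phi>) auto
  obtain g where g: "integrable lebesgue g" "\<And>y. g y \<ge> 0" and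
    maj: "AE y in lebesgue. \<forall>R>0. \<bar>convolve u (dilate \<phi> R) y\<bar> powr q \<le> g y"
    using hardy_majorant[OF u q(1)] by blast
  have Lq: "integrable lebesgue (\<lambda>x. indicator A x * \<bar>F k x\<bar> powr q)"
    "(LINT x|lebesgue. indicator A x * \<bar>F k x\<bar> powr q) \<le> (LINT y|lebesgue. indicator A
        ((1 / real (Suc k)) *\<^sub>R y) * g y)"
    if "A \<in> sets borel" for A k
    unfolding F_def by (rule regularize_Lq_bound[OF ut \<phi> _ q g maj that], simp)+
  define A where "A = {x::real^'n. d \<le> norm x}"
  have A: "A \<in> sets borel" unfolding A_def by
      (intro borel_closed closed_Collect_le continuous_intros)
  have to0: "(\<lambda>k. LINT x|lebesgue. indicator A x * \<bar>F k x\<bar> powr q) \<longlonglongrightarrow> 0"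
  proof (rule tendsto_sandwich[OF _ _ tendsto_const integral_far_tendsto_0[OF g(1) d(1)]])
    show "\<forall>\<^sub>F k in sequentially. 0 \<le> (LINT x|lebesgue. indicator A x * \<bar>F k x\<bar> powr q)"
      by (intro always_eventually allI integral_nonneg_AE) simp
    have eq: "indicator A ((1 / real (Suc k)) *\<^sub>R y) * g y
        = g y * indicator {y. d \<le> norm ((1 / real (Suc k)) *\<^sub>R y)} y" for k y
      by (simp add: A_def indicator_def)
    show "\<forall>\<^sub>F k in sequentially. (LINT x|lebesgue. indicator A x * \<bar>F k x\<bar> powr q)
        \<le> (LINT y|lebesgue. g y * indicator {y. d \<le> norm ((1 / real (Suc k)) *\<^sub>R y)} y)"
      using Lq(2)[OF A] unfolding eq by (intro always_eventually allI)
  qed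
  obtain B where B: "\<And>(G :: real^'n \<Rightarrow> real) x0. smooth G \<Longrightarrow> (\<And>x. \<bar>laplacian G x\<bar> \<le> C) \<Longrightarrow>
      (LINT x|lebesgue. indicator (cball x0 1) x * \<bar>G x\<bar> powr q) \<le> (LINT y|lebesgue. g y)
          \<Longrightarrow> \<bar>G x0\<bar> \<le> B"
    using local_sup_bound[OF q zero_less_one, of C "LINT y|lebesgue. g y"] by blast
  have FB: "\<bar>F k x\<bar> \<le> B" for k x
  proof (rule B[OF smF])
    show "\<bar>laplacian (F k) x\<bar> \<le> C" for x unfolding F_def by (rule C)
    have "(LINT z|lebesgue. indicator (cball x 1) z * \<bar>F k z\<bar> powr q)
        \<le> (LINT y|lebesgue. indicator (cball x 1) ((1 / real (Suc k)) *\<^sub>R y) * g y)"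
      by (rule Lq(2)) simp
    also have "\<dots> \<le> (LINT y|lebesgue. g y)"
    proof (rule integral_mono[OF _ g(1)])
      have "(\<lambda>y. indicator (cball x 1) ((1 / real
          (Suc k)) *\<^sub>R y) :: real) \<in> borel_measurable lebesgue"
        by (intro measurable_completion measurable_compose[OF _ borel_measurable_indicator[OF
            borel_closed[OF closed_cball]]]) simp
      from integrable_times_bounded[OF g(1) this, of 1]
      show "integrable lebesgue (\<lambda>y. indicator (cball x 1) ((1 / real (Suc k)) *\<^sub>R y) * g y)"
        by (simp add: mult.commute indicator_def)
      show "indicator (cball x 1) ((1 / real (Suc k)) *\<^sub>R y) * g y \<le> g y" for y
        using g(2)[of y] by (simp add: indicator_def)
    qed
    finally show "(LINT z|lebesgue. indicator (cball x 1) z * \<bar>F k z\<bar> powr q) \<le>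
        (LINT y|lebesgue. g y)" .
  qed
  obtain L where L: "\<And>x. \<bar>laplacian \<eta> x\<bar> \<le> L" using test_bounded[OF laplacian_test[OF \<eta>]] by blast
  have L0: "L \<ge> 0" by (rule order_trans[OF abs_ge_zero L])
  have pt: "\<bar>F k x * laplacian \<eta> x\<bar> \<le> (L * B powr (1 - q)) * (indicator A x * \<bar>F k x\<bar> powr q)"
      for k x
  proof (cases "x \<in> A")
    case True
    have "\<bar>F k x\<bar> \<le> B powr (1 - q) * \<bar>F k x\<bar> powr q"
    proof (cases "F k x = 0")
      case False
      then have "\<bar>F k x\<bar> = \<bar>F k x\<bar> powr (1 - q) * \<bar>F k x\<bar> powr q" by (simp add: powr_add[symmetric])
      also have "\<dots> \<le> B powr (1 - q) * \<bar>F k x\<bar> powr q"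
        using FB q by (intro mult_right_mono powr_mono2) auto
      finally show ?thesis .
    qed simp
    then have "\<bar>F k x\<bar> * \<bar>laplacian \<eta> x\<bar> \<le> (B powr (1 - q) * \<bar>F k x\<bar> powr q) * L"
      using L[of x] by (intro mult_mono) auto
    then show ?thesis using True by (simp add: abs_mult mult_ac)
  next
    case False
    then have "laplacian \<eta> x = 0" by (intro laplacian_eq_0_near[OF d(2)]) (auto simp: A_def)
    then show ?thesis using L0 by simp
  qed
  have "(\<lambda>k. LINT x|lebesgue. F k x * laplacian \<eta> x) \<longlonglongrightarrow> 0"
  proof (rule Lim_null_comparison)
    show "(\<lambda>k. (L * B powr (1 - q)) * (LINT x|lebesgue. indicator A x * \<bar>F k x\<bar> powr q)) \<longlonglongrightarrow> 0"
      by (rule tendsto_mult_right_zero[OF to0])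
    have "\<bar>LINT x|lebesgue. F k x * laplacian \<eta> x\<bar> \<le> (L * B powr (1 - q)) *
        (LINT x|lebesgue. indicator A x * \<bar>F k x\<bar> powr q)" for k
      unfolding integral_mult_right_zero[symmetric]
      by (intro order_trans[OF integral_abs_bound integral_mono[OF _ _ pt]] integrable_abs
          integrable_test
          test_mult smF laplacian_test \<eta> integrable_mult_right Lq(1) A)
    then show "\<forall>\<^sub>F k in sequentially. norm (LINT x|lebesgue. F k x * laplacian \<eta> x)
        \<le> (L * B powr (1 - q)) * (LINT x|lebesgue. indicator A x * \<bar>F k x\<bar> powr q)" by simp
  qed
  then show ?thesis by (simp add: F_def)
qed

lemma laplacian_by_parts:
  fixes f \<eta> :: "real^'n \<Rightarrow> real"
  assumes f: "smooth f" and \<eta>: "\<eta> \<in> test_functions"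
  shows "(LINT x|lebesgue. f x * laplacian \<eta> x) = (LINT x|lebesgue. laplacian f x * \<eta> x)"
proof -
  have "(LINT x|lebesgue. f x * laplacian \<eta> x) = (\<Sum>i\<in>UNIV. LINT x|lebesgue. f x
      * partial_deriv i (partial_deriv i \<eta>) x)"
    unfolding laplacian_def sum_distrib_left
    by (rule Bochner_Integration.integral_sum) (intro integrable_test test_mult f test_partial \<eta>)
  also have "\<dots> = (\<Sum>i\<in>UNIV. LINT x|lebesgue. partial_deriv i (partial_deriv i f) x * \<eta> x)"
    by (simp add: integral_by_parts2[OF f \<eta>])
  also have "\<dots> = (LINT x|lebesgue. laplacian f x * \<eta> x)"
    unfolding laplacian_def sum_distrib_right
    by (rule Bochner_Integration.integral_sum[symmetric])
        (intro integrable_test test_mult smooth_partial f \<eta>)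
  finally show ?thesis .
qed

section \<open>Pressure in a Hardy space\<close>

text \<open>The functions $x\mapsto e^{-1/(k|x|^2-1)}$, extended by zero, vanish near the origin
    and tend to
  \<open>1\<close> elsewhere.\<close>

lemma bump_tendsto_1:
  assumes "s > 0"
  shows "(\<lambda>k. bump 0 (real (Suc k) * s - 1)) \<longlonglongrightarrow> 1"
proof -
  have "filterlim (\<lambda>k. (-1) + s * real (Suc k)) at_top sequentially"
    by (intro filterlim_tendsto_add_at_top[OF tendsto_const]
        filterlim_tendsto_pos_mult_at_top[OF tendsto_const assms]
        filterlim_compose[OF filterlim_real_sequentially filterlim_Suc])
  then have top: "filterlim (\<lambda>k. real (Suc k) * s - 1) at_top sequentially"
    by (simp add: mult.commute)
  have "((\<lambda>t::real. exp (- (1 / t))) \<longlongrightarrow> exp (- 0)) at_top"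
    by (intro tendsto_intros tendsto_divide_0[OF tendsto_const]
        filterlim_at_top_imp_at_infinity filterlim_ident)
  moreover have "\<forall>\<^sub>F t in at_top. exp (- (1 / t)) = bump 0 t"
    using eventually_gt_at_top[of 0] by eventually_elim (simp add: bump_def)
  ultimately have "(bump 0 \<longlongrightarrow> 1) at_top" using Lim_transform_eventually by fastforce
  from filterlim_compose[OF this top] show ?thesis .
qed

text \<open>The function $H=\sum_{i,j}G_{ij}\partial_i\partial_j\varphi$ is the negative of the limit
    of the
  Laplacians of the regularised pressures. Pairing with test functions shows that \<open>H\<close>
  vanishes weakly, first away from the origin and then everywhere. Integrating $H$ against the
  quadratic test functions moves both derivatives away from $\varphi$ and isolates a diagonal
  entry of \<open>G\<close> times $2\int\varphi$.\<close>

lemma second_moments_of_hardy_pressure: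
  fixes \<phi> :: "real^'n \<Rightarrow> real"
  assumes \<phi>: "\<phi> \<in> schwartz" "(LINT x|lebesgue. \<phi> x) \<noteq> 0"
    and u: "u \<in> hardy \<phi> q" and q: "0 < q" "q \<le> 1" and w: "w \<in> L2_sigma"
    and D: "\<And>U. open U \<Longrightarrow> U \<noteq> {} \<Longrightarrow> \<exists>d\<in>D. d \<in> U"
    and eq: "\<And>n z k. z \<in> D \<Longrightarrow>
      u (laplacian (\<lambda>y. \<phi> ((- 1 / Suc n) *\<^sub>R y + z) * cutoff ((1 / Suc k) *\<^sub>R y)))
        = - hessian_pairing w (\<lambda>y. \<phi> ((- 1 / Suc n) *\<^sub>R y + z) * cutoff ((1 / Suc k) *\<^sub>R y))"
  shows "(LINT x|lebesgue. w x $ a * w x $ a) = 0"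
proof -
  have ut: "u \<in> tempered" using u by (simp add: hardy_def)
  note sm = schwartz_smooth[OF \<phi>(1)]
  define c where "c n = - 1 / real (Suc n)" for n
  have c0: "c n \<noteq> 0" for n by (simp add: c_def)
  define F where "F n = regularize u (c n) \<phi>" for n
  have smF: "smooth (F n)" for n unfolding F_def by (rule regularize_smooth[OF ut \<phi>(1) c0])
  have lapF: "laplacian (F n) x = - stress_regularized w (c n) \<phi> x" for n x
    unfolding F_def by (rule laplacian_regularize_stress[OF w \<phi>(1) ut c0 D])
        (auto simp only: c_def intro: eq)
  obtain C where C: "\<And>c x. \<bar>stress_regularized w c \<phi> x\<bar> \<le> C"
    using stress_regularized_bound[OF w \<phi>(1)] by blast
  define G where "G i j = (LINT x|lebesgue. w x $ i * w x $ j)" for i j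
  define H where "H x = (\<Sum>i\<in>UNIV. \<Sum>j\<in>UNIV. G i j * partial_deriv i (partial_deriv j \<phi>) x)" for x
  have smH: "smooth H"
    unfolding H_def[abs_def] by (intro smooth_sum smooth_cmult smooth_partial sm)
  have stress: "(\<lambda>n. stress_regularized w (c n) \<phi> x) \<longlonglongrightarrow> H x" for x
  proof -
    have "(\<lambda>n. c n *\<^sub>R y + x) \<longlonglongrightarrow> x" for y
    proof -
      have "(\<lambda>n. (- inverse (real (Suc n))) *\<^sub>R y + x) \<longlonglongrightarrow> (- 0) *\<^sub>R y + x"
        by (intro tendsto_intros LIMSEQ_inverse_real_of_nat)
      then show ?thesis by (simp add: c_def inverse_eq_divide)
    qed
    from stress_regularized_limit[OF w \<phi>(1) this]
    show ?thesis by (simp add: H_def G_def)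
  qed
  \<comment> \<open>Test functions that vanish near the origin: the two limits of $\int F_n\,\Delta\eta$ agree.\<close>
  have near: "(LINT x|lebesgue. \<eta> x * H x) = 0"
    if \<eta>: "\<eta> \<in> test_functions" and d: "d > 0" "\<And>x. norm x < d \<Longrightarrow> \<eta> x = 0" for \<eta> d
  proof -
    have "(\<lambda>n. LINT x|lebesgue. F n x * laplacian \<eta> x) \<longlonglongrightarrow> 0"
      unfolding F_def c_def
      by (rule regularize_pairing_tendsto_0[OF u q \<phi>(1) _ \<eta> d, where C=C])
         (use lapF C in \<open>auto simp: F_def c_def\<close>)
    moreover have "(LINT x|lebesgue. F n x * laplacian \<eta> x) = - (LINT x|lebesgue. \<eta> x
        * stress_regularized w (c n) \<phi> x)" for n
      by (simp add: laplacian_by_parts[OF smF \<eta>] lapF mult.commute)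
    moreover have "(\<lambda>n. LINT x|lebesgue. \<eta> x * stress_regularized w (c n) \<phi> x) \<longlonglongrightarrow>
        (LINT x|lebesgue. \<eta> x * H x)"
      by (rule integral_times_bounded_limit[OF integrable_test[OF \<eta>] _ C stress])
         (intro measurable_completion, simp,
             intro borel_measurable_continuous_onI stress_regularized_continuous w \<phi>)
    ultimately show ?thesis using LIMSEQ_unique[OF tendsto_minus] by fastforce
  qed
  \<comment> \<open>All test functions: multiply
      by a smooth function that removes a shrinking ball around the origin.\<close>
  have all: "(LINT x|lebesgue. \<zeta> x * H x) = 0" if \<zeta>: "\<zeta> \<in> test_functions" for \<zeta>
  proof -
    define b where "b k x = bump 0 (real (Suc k) * (norm x)\<^sup>2 - 1)" for k and x :: "real^'n"
    have smb: "smooth (b k)" for k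
      unfolding b_def[abs_def] by
          (intro smooth_bump smooth_minus smooth_cmult smooth_norm_sq smooth_const)
    have iz: "integrable lebesgue (\<lambda>x. \<zeta> x * H x)"
      using integrable_test[OF test_mult[OF smH \<zeta>]] by (simp add: mult.commute)
    have "(\<lambda>k. LINT x|lebesgue. (\<zeta> x * H x) * b k x) \<longlonglongrightarrow> (LINT x|lebesgue. (\<zeta> x * H x) * (if x
        = 0 then 0 else 1))"
    proof (rule integral_times_bounded_limit[OF iz])
      show "b k \<in> borel_measurable lebesgue" for k by (rule smooth_lebesgue[OF smb])
      show "\<bar>b k x\<bar> \<le> 1" for k x by (simp add: b_def bump_nonneg bump_le_1)
      show "(\<lambda>k. b k x) \<longlonglongrightarrow> (if x = 0 then 0 else 1)" for x
        unfolding b_def using bump_tendsto_1[of "(norm x)\<^sup>2"] by (simp add: bump_nonpos)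
    qed
    moreover have "(LINT x|lebesgue. (\<zeta> x * H x) * b k x) = 0" for k
    proof -
      have "(\<lambda>x. b k x * \<zeta> x) \<in> test_functions" by (rule test_mult[OF smb \<zeta>])
      moreover have "b k x * \<zeta> x = 0" if "norm x < 1 / real (Suc k)" for x
      proof -
        have "norm x \<le> 1" using that by (rule order_trans[OF less_imp_le]) simp
        then have "(norm x)\<^sup>2 \<le> norm x" by (simp add: power2_eq_square mult_left_le)
        then have "real (Suc k) * (norm x)\<^sup>2 \<le> real (Suc k) * norm x" by (intro mult_left_mono) auto
        also have "\<dots> \<le> 1" using that by (simp add: field_simps)
        finally show ?thesis by (simp add: b_def bump_nonpos)
      qed
      ultimately have "(LINT x|lebesgue. (b k x * \<zeta> x) * H x) = 0" by
          (intro near[of _ "1 / real (Suc k)"]) auto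
      then show ?thesis by (simp add: mult_ac)
    qed
    ultimately have "(LINT x|lebesgue. (\<zeta> x * H x) * (if x = 0 then 0 else 1)) = 0"
      by (simp add: LIMSEQ_const_iff)
    moreover have "(LINT x|lebesgue. (\<zeta> x * H x) * (if x = 0 then 0 else 1)) =
        (LINT x|lebesgue. \<zeta> x * H x)"
    proof (rule integral_cong_AE)
      have "(\<lambda>x::real^'n. if x = 0 then 0 else 1 :: real) \<in> borel_measurable lebesgue"
        by (intro measurable_completion) simp
      then show "(\<lambda>x. (\<zeta> x * H x) * (if x = 0 then 0 else 1)) \<in> borel_measurable lebesgue"
        by (rule borel_measurable_times[OF borel_measurable_integrable[OF iz]])
      have "AE x in lebesgue. x \<noteq> (0::real^'n)" by (rule AE_completion[OF AE_lborel_singleton])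
      then show "AE x in lebesgue. (\<zeta> x * H x) * (if x = 0 then 0 else 1) = \<zeta> x * H x"
        by eventually_elim simp
    qed (rule borel_measurable_integrable[OF iz])
    ultimately show ?thesis by simp
  qed
  \<comment> \<open>A function with a nonzero Bochner integral is integrable.\<close>
  have \<phi>i: "integrable lebesgue \<phi>" using \<phi>(2) not_integrable_integral_eq by blast
  define Q where "Q = quadratic_test a a"
  have Q: "Q k \<in> test_functions" for k unfolding Q_def by (rule quadratic_test_test)
  obtain B where B: "\<And>k i j x. \<bar>partial_deriv i (partial_deriv j (Q k)) x\<bar> \<le> B"
    using quadratic_test_hessian_bound[of a a] unfolding Q_def by blast
  have "(\<Sum>i\<in>UNIV. \<Sum>j\<in>UNIV. G i j * (LINT x|lebesgue. \<phi> x * partial_deriv j (partial_deriv i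
      (Q k)) x)) = 0" for k
  proof -
    have "(LINT x|lebesgue. Q k x * H x)
        = (LINT x|lebesgue. (\<Sum>i\<in>UNIV. \<Sum>j\<in>UNIV. G i j * (partial_deriv i (partial_deriv j \<phi>) x
            * Q k x)))"
      by (simp add: H_def sum_distrib_left mult_ac)
    also have "\<dots> = (\<Sum>i\<in>UNIV. \<Sum>j\<in>UNIV. G i j * (LINT x|lebesgue. partial_deriv i
        (partial_deriv j \<phi>) x * Q k x))"
    proof -
      have i: "integrable lebesgue (\<lambda>x. G i j * (partial_deriv i (partial_deriv j \<phi>) x
          * Q k x))" for i j
        by (intro integrable_mult_right integrable_test test_mult smooth_partial sm Q)
      show ?thesis
        by (subst Bochner_Integration.integral_sum, intro Bochner_Integration.integrable_sum i,
            subst Bochner_Integration.integral_sum, rule i, simp)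
    qed
    finally show ?thesis using all[OF Q] by (simp add: integral_by_parts2[OF sm Q])
  qed
  moreover have "(\<lambda>k. \<Sum>i\<in>UNIV. \<Sum>j\<in>UNIV. G i j * (LINT x|lebesgue. \<phi> x * partial_deriv j
      (partial_deriv i (Q k)) x))
    \<longlonglongrightarrow> (\<Sum>i\<in>UNIV. \<Sum>j\<in>UNIV. G i j * (LINT x|lebesgue. \<phi> x * ((if j = a \<and> i = a then 1 else 0) +
        (if j = a \<and> i = a then 1 else 0))))"
    unfolding Q_def
    by (intro tendsto_sum tendsto_mult_left integral_times_bounded_limit[OF \<phi>i _ B[unfolded
        Q_def] quadratic_test_hessian_limit]
        smooth_lebesgue smooth_partial test_smooth quadratic_test_test)
  ultimately have "(\<Sum>i\<in>UNIV. \<Sum>j\<in>UNIV. G i j * (LINT x|lebesgue. \<phi> x * ((if j = a \<and> i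
      = a then 1 else 0) + (if j = a \<and> i = a then 1 else 0)))) = 0"
    by (simp add: LIMSEQ_const_iff)
  moreover have "G i j * (LINT x|lebesgue. \<phi> x * ((if j = a \<and> i = a then 1 else 0) + (if j = a
      \<and> i = a then 1 else 0)))
      = (G i j * (LINT x|lebesgue. \<phi> x)) * ((if i = a \<and> j = a then 1 else 0) + (if i = a \<and> j
          = a then 1 else 0))" for i j
    by (simp add: conj_commute)
  ultimately have "G a a * (LINT x|lebesgue. \<phi> x) + G a a * (LINT x|lebesgue. \<phi> x) = 0"
    by (simp only: sum_delta_pair)
  then show ?thesis using \<phi>(2) by (simp add: G_def)
qed

theorem theorem1p1:
  fixes T \<nu> :: real
    and \<phi> :: "real^'n \<Rightarrow> real"
    and v :: "real \<Rightarrow> real^'n \<Rightarrow> real^'n"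
    and p :: "real \<Rightarrow> (real^'n \<Rightarrow> real) \<Rightarrow> real"
  assumes "CARD('n) \<ge> 2" and "T > 0" and "\<nu> \<ge> 0"
    and "\<phi> \<in> schwartz" and "(LINT x|lebesgue. \<phi> x) \<noteq> 0"
    and "weak_solution \<nu> T v p"
  shows "((\<exists>f\<in>L1_L1_plus T. has_density T p f) \<or>
          (\<exists>q. 0 < q \<and> q \<le> 1 \<and> p \<in> L1_hardy \<phi> q T)
            \<longrightarrow> (AE (t, x) in spacetime T. v t x = 0)) \<and>
         (\<forall>f\<in>L1_L1_minus T. has_density T p f \<longrightarrow>
            (AE t in time T.
               (\<forall>j. energy v j t = - (1/2) * (LINT x|lebesgue. f t x)) \<and>
               (\<forall>j k. j \<noteq> k \<longrightarrow> (LINT x|lebesgue. v t x $ j * v t x $ k) = 0)))"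
proof (intro conjI impI ballI)
  note sol = assms(6)
  have vL: "v \<in> L1_L2_sigma T" using sol by (simp add: weak_solution_def)
  assume "(\<exists>f\<in>L1_L1_plus T. has_density T p f) \<or> (\<exists>q. 0 < q \<and> q \<le> 1 \<and> p \<in> L1_hardy \<phi> q T)"
  then have "AE t in time T. \<forall>a. (LINT x|lebesgue. v t x $ a * v t x $ a) \<le> 0"
  proof (elim disjE bexE exE conjE)
    fix f assume f: "f \<in> L1_L1_plus T" "has_density T p f"
    have "AE t in time T. 0 \<le> (LINT x|lebesgue. f t x)" using f(1) by (simp add: L1_L1_plus_def)
    moreover have "f \<in> L1_L1 T" using f(1) by (simp add: L1_L1_plus_def)
    ultimately show ?thesis
      using second_moments_of_integrable_pressure[OF sol _ f(2)] by (auto elim!: eventually_elim2)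
  next
    fix q assume q: "0 < q" "q \<le> 1" and p: "p \<in> L1_hardy \<phi> q T"
    \<comment> \<open>Countably many test functions: translations in a countable dense set, integer dilations
        and cutoffs.\<close>
    obtain D :: "(real^'n) set" where D: "countable D" "\<And>U. open U \<Longrightarrow> U \<noteq> {} \<Longrightarrow> \<exists>d\<in>D. d \<in> U"
      using countable_dense_setE by blast
    define \<Psi> where "\<Psi> n z k y = \<phi> ((- 1 / Suc n) *\<^sub>R y + z) * cutoff ((1 / Suc k) *\<^sub>R y)"
        for n z k y
    have \<Psi>: "\<Psi> n z k \<in> test_functions" for n z k
      unfolding \<Psi>_def[abs_def] by (intro cutoff_mult_test smooth_affine schwartz_smooth assms)
    have "AE t in time T. \<forall>z\<in>D. \<forall>n k. p t (laplacian (\<Psi> n z k)) = - hessian_pairing (v t) (\<Psi> n z k)"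
      unfolding AE_ball_countable[OF D(1)] AE_all_countable
      by (intro ballI allI pressure_equation[OF sol \<Psi>])
    moreover have "AE t in time T. p t \<in> hardy \<phi> q" using p by (simp add: L1_hardy_def)
    moreover have "AE t in time T. v t \<in> L2_sigma" using vL by (simp add: L1_L2_sigma_def)
    ultimately show ?thesis
    proof eventually_elim
      case (elim t)
      have "(LINT x|lebesgue. v t x $ a * v t x $ a) = 0" for a
        by (rule second_moments_of_hardy_pressure[OF assms(4,5) elim(2) q elim(3) D(2)])
           (use elim(1) in \<open>auto simp: \<Psi>_def[abs_def]\<close>)
      then show ?case by simp
    qed
  qed
  then show "AE (t, x) in spacetime T. v t x = 0" by (rule velocity_zero_of_second_moments[OF vL])
next
  fix f assume f: "f \<in> L1_L1_minus T" "has_density T p f"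
  have "f \<in> L1_L1 T" using f(1) by (simp add: L1_L1_minus_def)
  from second_moments_of_integrable_pressure[OF assms(6) this f(2)]
  show "AE t in time T. (\<forall>j. energy v j t = - (1/2) * (LINT x|lebesgue. f t x)) \<and>
      (\<forall>j k. j \<noteq> k \<longrightarrow> (LINT x|lebesgue. v t x $ j * v t x $ k) = 0)"
    by eventually_elim (simp add: energy_def power2_eq_square)
qed

end
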